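(* Let $\mathbb{k}$ be a field containing $\mathbb{Q}$, and let $\mathcal{T}=(A,B,\varepsilon)$ be a commutative triple, i.e. $A$ and $B$ are commutative $\mathbb{k}$-algebras and $\varepsilon:B\to A$ is a morphism of $\mathbb{k}$-algebras. Let $HH_1(A,B,\varepsilon)$ be the first secondary Hochschild homology of the triple, $\Omega^1_{\mathcal{T}|\mathbb{k}}$ its module of secondary Kähler differentials, $J\subseteq A^{\otimes 2}\otimes B$ the kernel of the multiplication map to $A$, and $\hat{J}\subseteq J$ the set of all finite sums of elements of the form $$\otimes\begin{pmatrix} 1 & \alpha\\ 1 & 1\end{pmatrix}-\otimes\begin{pmatrix} \varepsilon(\alpha) & 1\\ 1 & 1\end{pmatrix}+\otimes\begin{pmatrix} 1 & \alpha\\ 1 & 1\end{pmatrix}-\otimes\begin{pmatrix} 1 & 1\\ 1 & \varepsilon(\alpha)\end{pmatrix},\qquad \alpha\in B,$$ all as defined in the context. Then $$HH_1(A,B,\varepsilon)\;\cong\;\Omega^1_{\mathcal{T}|\mathbb{k}}\;\cong\; J/(J^2+\hat{J}).$$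
   Context: All tensor products are over the field $\mathbb{k}\supseteq\mathbb{Q}$. Algebras are associative with multiplicative unit. Here $A$ and $B$ are commutative. **Notation.** An elementary tensor of $A^{\otimes 2}\otimes B$ is written $\otimes\begin{pmatrix} a & \alpha\\ 1 & b\end{pmatrix}$ with $a,b\in A$, $\alpha\in B$. An elementary tensor of $A^{\otimes 3}\otimes B^{\otimes 3}$ is written $\otimes\begin{pmatrix} a & \alpha & \beta\\ 1 & b & \gamma\\ 1 & 1 & c\end{pmatrix}$ with $a,b,c\in A$, $\alpha,\beta,\gamma\in B$. Products in $A^{\otimes 2}\otimes B$ are taken componentwise. **Secondary Hochschild homology.** The secondary Hochschild complex of the triple has degree $n$ term $A^{\otimes (n+1)}\otimes B^{\otimes n(n+1)/2}$. In low degrees it reads $$\cdots\to A^{\otimes 3}\otimes B^{\otimes 3}\xrightarrow{\partial_2}A^{\otimes 2}\otimes B\xrightarrow{\partial_1}A\to 0,$$ with $\mathbb{k}$-linear maps determined by $$\partial_1\Big(\otimes\begin{pmatrix} a & \alpha\\ 1 & b\end{pmatrix}\Big)=a\varepsilon(\alpha)b-b\varepsilon(\alpha)a,$$ $$\partial_2\Big(\otimes\begin{pmatrix} a & \alpha & \beta\\ 1 & b & \gamma\\ 1 & 1 & c\end{pmatrix}\Big)=\otimes\begin{pmatrix} a\varepsilon(\alpha)b & \beta\gamma\\ 1 & c\end{pmatrix}-\otimes\begin{pmatrix} a & \alpha\beta\\ 1 & b\varepsilon(\gamma)c\end{pmatrix}+\otimes\begin{pmatrix} c\varepsilon(\beta)a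 & \alpha\gamma\\ 1 & b\end{pmatrix}.$$ Then $HH_1(A,B,\varepsilon)=\mathrm{Ker}(\partial_1)/\mathrm{Im}(\partial_2)$. **Secondary Kähler differentials.** $\Omega^1_{\mathcal{T}|\mathbb{k}}$ is the left $B\otimes A$-module generated by the $\mathbb{k}$-linear symbols $d(\alpha\otimes a)$ for $\alpha\in B$ and $a\in A$, with module structure $(\alpha\otimes a)\cdot d(\beta\otimes b)=a\varepsilon(\alpha)\,d(\beta\otimes b)$, along with the following relations, for all $a,b\in A$, $\alpha,\beta\in B$, $\lambda,\mu\in\mathbb{k}$: (i) $d(\lambda(\alpha\otimes a)+\mu(\beta\otimes b))=\lambda d(\alpha\otimes a)+\mu d(\beta\otimes b)$; (ii) $d((\alpha\otimes a)(\beta\otimes b))=a\varepsilon(\alpha)\,d(\beta\otimes b)+b\varepsilon(\beta)\,d(\alpha\otimes a)$, where $(\alpha\otimes a)(\beta\otimes b)=\alpha\beta\otimes ab$; (iii) $d(\alpha\otimes 1)+d(\alpha\otimes 1)=d(1\otimes\varepsilon(\alpha))$. **The sets $J$ and $\hat J$.** Let $m:A^{\otimes 2}\otimes B\to A$ be the multiplication map $m\Big(\otimes\begin{pmatrix} a & \alpha\\ 1 & b\end{pmatrix}\Big)=ab\varepsilon(\alpha)$. Put $J=\mathrm{Ker}(m)$, an ideal of $A^{\otimes 2}\otimes B$, and let $J^2$ be its square. The set $\hat J$ consists of all finite sums of the elements displayed in the claim, with $\alpha\in B$ (no coefficients from $A$ are included in the definition).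
   Formalization: J/(J²+Ĵ) is taken as the quotient of J by the ideal generated by J²+Ĵ; with the coefficient-free Ĵ the claim fails, e.g. for A=B=k[x,y]/(x,y)², ε=id, where J/(J²+Ĵ) has dimension 4 but the secondary differentials have dimension 3. *)

theory Defs
  imports "HOL-Algebra.Module" "HOL-Algebra.QuotRing" "HOL-Algebra.Ideal_Product"
begin

section \<open>Modules\<close>

definition module_isomorphic ::
  "('r, 's) ring_scheme \<Rightarrow> ('r, 'm, 't) module_scheme \<Rightarrow> ('r, 'n, 'u) module_scheme \<Rightarrow> bool"
  where "module_isomorphic R M N \<longleftrightarrow>
    (\<exists>h. bij_betw h (carrier M) (carrier N) \<and>
         (\<forall>x\<in>carrier M. \<forall>y\<in>carrier M. h (x \<oplus>\<^bsub>M\<^esub> y) = h x \<oplus>\<^bsub>N\<^esub> h y) \<and>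
         (\<forall>r\<in>carrier R. \<forall>x\<in>carrier M. h (r \<odot>\<^bsub>M\<^esub> x) = r \<odot>\<^bsub>N\<^esub> h x))"

definition span_module :: "('r, 's) ring_scheme \<Rightarrow> ('r, 'm, 't) module_scheme \<Rightarrow> 'm set \<Rightarrow> 'm set"
  where "span_module R M S = \<Inter>{H. submodule H R M \<and> S \<subseteq> H}"

text \<open>The module analogue of \<^const>\<open>FactRing\<close>.\<close>

definition quot_module :: "('r, 'm, 't) module_scheme \<Rightarrow> 'm set \<Rightarrow> ('r, 'm set) module"
  where "quot_module M H =
    \<lparr>carrier = a_rcosets\<^bsub>M\<^esub> H, mult = rcoset_mult M H, one = H +>\<^bsub>M\<^esub> \<one>\<^bsub>M\<^esub>,
     zero = H, add = set_add M, smult = (\<lambda>r X. \<Union>x\<in>X. H +>\<^bsub>M\<^esub> (r \<odot>\<^bsub>M\<^esub> x))\<rparr>"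

definition restrict_scalars :: "('q \<Rightarrow> 'r) \<Rightarrow> ('r, 'm, 't) module_scheme \<Rightarrow> ('q, 'm) module"
  where "restrict_scalars f M =
    \<lparr>carrier = carrier M, mult = mult M, one = one M, zero = zero M, add = add M,
     smult = (\<lambda>q x. f q \<odot>\<^bsub>M\<^esub> x)\<rparr>"

text \<open>The free module on \<open>X\<close>: finitely supported functions. The ring fields of the record that
  have no meaning for a module are left unspecified.\<close>

definition free_module :: "('r, 's) ring_scheme \<Rightarrow> 'x set \<Rightarrow> ('r, 'x \<Rightarrow> 'r) module"
  where "free_module R X =
    \<lparr>carrier = {p. range p \<subseteq> carrier R \<and> {x. p x \<noteq> \<zero>\<^bsub>R\<^esub>} \<subseteq> X \<and> finite {x. p x \<noteq> \<zero>\<^bsub>R\<^esub>}},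
     mult = undefined, one = undefined, zero = (\<lambda>x. \<zero>\<^bsub>R\<^esub>),
     add = (\<lambda>p q x. p x \<oplus>\<^bsub>R\<^esub> q x), smult = (\<lambda>r p x. r \<otimes>\<^bsub>R\<^esub> p x)\<rparr>"

definition free_gen :: "('r, 's) ring_scheme \<Rightarrow> 'x \<Rightarrow> 'x \<Rightarrow> 'r"
  where "free_gen R x = (\<lambda>y. if y = x then \<one>\<^bsub>R\<^esub> else \<zero>\<^bsub>R\<^esub>)"

definition algebra_hom ::
  "('k, 's) ring_scheme \<Rightarrow> ('k, 'b, 't) module_scheme \<Rightarrow> ('k, 'a, 'u) module_scheme \<Rightarrow> ('b \<Rightarrow> 'a) set"
  where "algebra_hom K B A =
    {h \<in> ring_hom B A. \<forall>r\<in>carrier K. \<forall>x\<in>carrier B. h (r \<odot>\<^bsub>B\<^esub> x) = r \<odot>\<^bsub>A\<^esub> h x}"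


section \<open>The tensor products of n copies of A and m copies of B\<close>

text \<open>An elementary tensor is given by the list of its \<open>n\<close> entries in \<open>A\<close> and the list of its
  \<open>m\<close> entries in \<open>B\<close>. Matrices are read row by row: the diagonal gives the first list and the
  entries above the diagonal the second, so the matrix with rows \<open>(a \<alpha> \<beta>)\<close>, \<open>(1 b \<gamma>)\<close>,
  \<open>(1 1 c)\<close> is \<open>([a, b, c], [\<alpha>, \<beta>, \<gamma>])\<close>.\<close>

type_synonym ('k, 'a, 'b) tensor = "('a list \<times> 'b list \<Rightarrow> 'k) set"

definition tensor_index ::
  "('k, 'a) module \<Rightarrow> ('k, 'b) module \<Rightarrow> nat \<Rightarrow> nat \<Rightarrow> ('a list \<times> 'b list) set"
  where "tensor_index A B n m =
    {(as, bs). set as \<subseteq> carrier A \<and> length as = n \<and> set bs \<subseteq> carrier B \<and> length bs = m}"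

abbreviation tensor_free ::
  "'k ring \<Rightarrow> ('k, 'a) module \<Rightarrow> ('k, 'b) module \<Rightarrow> nat \<Rightarrow> nat \<Rightarrow> ('k, 'a list \<times> 'b list \<Rightarrow> 'k) module"
  where "tensor_free K A B n m \<equiv> free_module K (tensor_index A B n m)"

definition multilinear_rels ::
  "'k ring \<Rightarrow> ('k, 'a) module \<Rightarrow> ('k, 'b) module \<Rightarrow> nat \<Rightarrow> nat \<Rightarrow> ('a list \<times> 'b list \<Rightarrow> 'k) set"
  where "multilinear_rels K A B n m = (let F = tensor_free K A B n m; e = free_gen K in
    {e (as[i := x \<oplus>\<^bsub>A\<^esub> y], bs) \<ominus>\<^bsub>F\<^esub> (e (as[i := x], bs) \<oplus>\<^bsub>F\<^esub> e (as[i := y], bs)) | as bs i x y.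
       (as, bs) \<in> tensor_index A B n m \<and> i < n \<and> x \<in> carrier A \<and> y \<in> carrier A} \<union>
    {e (as[i := r \<odot>\<^bsub>A\<^esub> x], bs) \<ominus>\<^bsub>F\<^esub> r \<odot>\<^bsub>F\<^esub> e (as[i := x], bs) | as bs i r x.
       (as, bs) \<in> tensor_index A B n m \<and> i < n \<and> r \<in> carrier K \<and> x \<in> carrier A} \<union>
    {e (as, bs[j := x \<oplus>\<^bsub>B\<^esub> y]) \<ominus>\<^bsub>F\<^esub> (e (as, bs[j := x]) \<oplus>\<^bsub>F\<^esub> e (as, bs[j := y])) | as bs j x y.
       (as, bs) \<in> tensor_index A B n m \<and> j < m \<and> x \<in> carrier B \<and> y \<in> carrier B} \<union>
    {e (as, bs[j := r \<odot>\<^bsub>B\<^esub> x]) \<ominus>\<^bsub>F\<^esub> r \<odot>\<^bsub>F\<^esub> e (as, bs[j := x]) | as bs j r x.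
       (as, bs) \<in> tensor_index A B n m \<and> j < m \<and> r \<in> carrier K \<and> x \<in> carrier B})"

definition tensor_rels ::
  "'k ring \<Rightarrow> ('k, 'a) module \<Rightarrow> ('k, 'b) module \<Rightarrow> nat \<Rightarrow> nat \<Rightarrow> ('k, 'a, 'b) tensor"
  where "tensor_rels K A B n m =
    span_module K (tensor_free K A B n m) (multilinear_rels K A B n m)"

definition elem_tensor ::
  "'k ring \<Rightarrow> ('k, 'a) module \<Rightarrow> ('k, 'b) module \<Rightarrow> 'a list \<Rightarrow> 'b list \<Rightarrow> ('k, 'a, 'b) tensor"
  where "elem_tensor K A B as bs =
    tensor_rels K A B (length as) (length bs)
      +>\<^bsub>tensor_free K A B (length as) (length bs)\<^esub> free_gen K (as, bs)"

text \<open>The \<open>K\<close>-linear map from a tensor product to \<open>M\<close> determined by its values \<open>f\<close> on elementary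
  tensors, for multilinear \<open>f\<close>: the linear extension of \<open>f\<close> to the free module is then constant on
  each coset \<open>X\<close> of the relations.\<close>

definition tensor_lift ::
  "'k ring \<Rightarrow> ('k, 'm) module \<Rightarrow> ('a list \<times> 'b list \<Rightarrow> 'm) \<Rightarrow> ('k, 'a, 'b) tensor \<Rightarrow> 'm"
  where "tensor_lift K M f X =
    the_elem ((\<lambda>p. \<Oplus>\<^bsub>M\<^esub>x\<in>{x. p x \<noteq> \<zero>\<^bsub>K\<^esub>}. p x \<odot>\<^bsub>M\<^esub> f x) ` X)"

definition tensor_module ::
  "'k ring \<Rightarrow> ('k, 'a) module \<Rightarrow> ('k, 'b) module \<Rightarrow> nat \<Rightarrow> nat \<Rightarrow> ('k, ('k, 'a, 'b) tensor) module"
  where "tensor_module K A B n m = quot_module (tensor_free K A B n m) (tensor_rels K A B n m)"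

definition tensor_mult ::
  "'k ring \<Rightarrow> ('k, 'a) module \<Rightarrow> ('k, 'b) module \<Rightarrow> nat \<Rightarrow> nat \<Rightarrow>
    ('k, 'a, 'b) tensor \<Rightarrow> ('k, 'a, 'b) tensor \<Rightarrow> ('k, 'a, 'b) tensor"
  where "tensor_mult K A B n m X Y =
    tensor_lift K (tensor_module K A B n m) (\<lambda>(as, bs).
      tensor_lift K (tensor_module K A B n m) (\<lambda>(as', bs').
        elem_tensor K A B (map2 (mult A) as as') (map2 (mult B) bs bs')) Y) X"

definition tensor_algebra ::
  "'k ring \<Rightarrow> ('k, 'a) module \<Rightarrow> ('k, 'b) module \<Rightarrow> nat \<Rightarrow> nat \<Rightarrow> ('k, ('k, 'a, 'b) tensor) module"
  where "tensor_algebra K A B n m = (tensor_module K A B n m)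
    \<lparr>mult := tensor_mult K A B n m,
     one := elem_tensor K A B (replicate n \<one>\<^bsub>A\<^esub>) (replicate m \<one>\<^bsub>B\<^esub>)\<rparr>"


section \<open>First secondary Hochschild homology\<close>

text \<open>The action of \<open>B \<otimes> A\<close> on all modules below is through this map \<open>\<alpha> \<otimes> a \<mapsto> a \<epsilon>(\<alpha>)\<close> to \<open>A\<close>; the
  tensor \<open>\<alpha> \<otimes> a\<close> of \<open>B \<otimes> A\<close> is \<open>elem_tensor K A B [a] [\<alpha>]\<close>.\<close>

definition scalar_map ::
  "'k ring \<Rightarrow> ('k, 'a) module \<Rightarrow> ('b \<Rightarrow> 'a) \<Rightarrow> ('k, 'a, 'b) tensor \<Rightarrow> 'a"
  where "scalar_map K A \<epsilon> = tensor_lift K A (\<lambda>z. case z of ([a], [\<alpha>]) \<Rightarrow> a \<otimes>\<^bsub>A\<^esub> \<epsilon> \<alpha>)"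

text \<open>\<open>A\<^sup>\<otimes>\<^sup>2 \<otimes> B\<close> as an \<open>A\<close>-module, acting on the first factor \<open>A\<close>.\<close>

definition tensor21_A ::
  "'k ring \<Rightarrow> ('k, 'a) module \<Rightarrow> ('k, 'b) module \<Rightarrow> ('a, ('k, 'a, 'b) tensor) module"
  where "tensor21_A K A B = (let T = tensor_algebra K A B 2 1 in
    \<lparr>carrier = carrier T, mult = mult T, one = one T, zero = zero T, add = add T,
     smult = (\<lambda>a z. elem_tensor K A B [a, \<one>\<^bsub>A\<^esub>] [\<one>\<^bsub>B\<^esub>] \<otimes>\<^bsub>T\<^esub> z)\<rparr>)"

definition boundary1 ::
  "'k ring \<Rightarrow> ('k, 'a) module \<Rightarrow> ('b \<Rightarrow> 'a) \<Rightarrow> ('k, 'a, 'b) tensor \<Rightarrow> 'a"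
  where "boundary1 K A \<epsilon> = tensor_lift K A (\<lambda>z. case z of ([a, b], [\<alpha>]) \<Rightarrow>
    (a \<otimes>\<^bsub>A\<^esub> \<epsilon> \<alpha> \<otimes>\<^bsub>A\<^esub> b) \<ominus>\<^bsub>A\<^esub> (b \<otimes>\<^bsub>A\<^esub> \<epsilon> \<alpha> \<otimes>\<^bsub>A\<^esub> a))"

definition boundary2 ::
  "'k ring \<Rightarrow> ('k, 'a) module \<Rightarrow> ('k, 'b) module \<Rightarrow> ('b \<Rightarrow> 'a) \<Rightarrow>
    ('k, 'a, 'b) tensor \<Rightarrow> ('k, 'a, 'b) tensor"
  where "boundary2 K A B \<epsilon> = (let T = tensor_algebra K A B 2 1; t = elem_tensor K A B in
    tensor_lift K T (\<lambda>z. case z of ([a, b, c], [\<alpha>, \<beta>, \<gamma>]) \<Rightarrow>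
      t [a \<otimes>\<^bsub>A\<^esub> \<epsilon> \<alpha> \<otimes>\<^bsub>A\<^esub> b, c] [\<beta> \<otimes>\<^bsub>B\<^esub> \<gamma>]
      \<ominus>\<^bsub>T\<^esub> t [a, b \<otimes>\<^bsub>A\<^esub> \<epsilon> \<gamma> \<otimes>\<^bsub>A\<^esub> c] [\<alpha> \<otimes>\<^bsub>B\<^esub> \<beta>]
      \<oplus>\<^bsub>T\<^esub> t [c \<otimes>\<^bsub>A\<^esub> \<epsilon> \<beta> \<otimes>\<^bsub>A\<^esub> a, b] [\<alpha> \<otimes>\<^bsub>B\<^esub> \<gamma>]))"

definition sec_HH1 ::
  "'k ring \<Rightarrow> ('k, 'a) module \<Rightarrow> ('k, 'b) module \<Rightarrow> ('b \<Rightarrow> 'a) \<Rightarrow>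
    (('k, 'a, 'b) tensor, ('k, 'a, 'b) tensor set) module"
  where "sec_HH1 K A B \<epsilon> = restrict_scalars (scalar_map K A \<epsilon>)
    (quot_module
      ((tensor21_A K A B)\<lparr>carrier := a_kernel (tensor_algebra K A B 2 1) A (boundary1 K A \<epsilon>)\<rparr>)
      (boundary2 K A B \<epsilon> ` carrier (tensor_algebra K A B 3 3)))"


section \<open>Secondary Kaehler differentials\<close>

text \<open>Generators are symbols \<open>d x\<close> for all \<open>x\<close> in \<open>B \<otimes> A\<close>. Since \<open>B \<otimes> A\<close> acts on them through
  \<open>scalar_map\<close>, the module is a quotient of the free \<open>A\<close>-module on these symbols; a scalar \<open>\<lambda>\<close> of
  \<open>K\<close> acts as \<open>\<lambda> \<cdot> 1\<close> of \<open>A\<close>.\<close>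

definition sec_kaehler_rels ::
  "'k ring \<Rightarrow> ('k, 'a) module \<Rightarrow> ('k, 'b) module \<Rightarrow> ('b \<Rightarrow> 'a) \<Rightarrow> (('k, 'a, 'b) tensor \<Rightarrow> 'a) set"
  where "sec_kaehler_rels K A B \<epsilon> =
    (let T = tensor_algebra K A B 1 1; F = free_module A (carrier T); d = free_gen A;
         t = (\<lambda>\<alpha> a. elem_tensor K A B [a] [\<alpha>]) in
    {d (l \<odot>\<^bsub>T\<^esub> x \<oplus>\<^bsub>T\<^esub> u \<odot>\<^bsub>T\<^esub> y) \<ominus>\<^bsub>F\<^esub> ((l \<odot>\<^bsub>A\<^esub> \<one>\<^bsub>A\<^esub>) \<odot>\<^bsub>F\<^esub> d x \<oplus>\<^bsub>F\<^esub> (u \<odot>\<^bsub>A\<^esub> \<one>\<^bsub>A\<^esub>) \<odot>\<^bsub>F\<^esub> d y) | l u x y.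
       l \<in> carrier K \<and> u \<in> carrier K \<and> x \<in> carrier T \<and> y \<in> carrier T} \<union>
    {d (t \<alpha> a \<otimes>\<^bsub>T\<^esub> t \<beta> b)
       \<ominus>\<^bsub>F\<^esub> ((a \<otimes>\<^bsub>A\<^esub> \<epsilon> \<alpha>) \<odot>\<^bsub>F\<^esub> d (t \<beta> b) \<oplus>\<^bsub>F\<^esub> (b \<otimes>\<^bsub>A\<^esub> \<epsilon> \<beta>) \<odot>\<^bsub>F\<^esub> d (t \<alpha> a)) | \<alpha> \<beta> a b.
       \<alpha> \<in> carrier B \<and> \<beta> \<in> carrier B \<and> a \<in> carrier A \<and> b \<in> carrier A} \<union>
    {(d (t \<alpha> \<one>\<^bsub>A\<^esub>) \<oplus>\<^bsub>F\<^esub> d (t \<alpha> \<one>\<^bsub>A\<^esub>)) \<ominus>\<^bsub>F\<^esub> d (t \<one>\<^bsub>B\<^esub> (\<epsilon> \<alpha>)) | \<alpha>. \<alpha> \<in> carrier B})"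

definition sec_kaehler ::
  "'k ring \<Rightarrow> ('k, 'a) module \<Rightarrow> ('k, 'b) module \<Rightarrow> ('b \<Rightarrow> 'a) \<Rightarrow>
    (('k, 'a, 'b) tensor, (('k, 'a, 'b) tensor \<Rightarrow> 'a) set) module"
  where "sec_kaehler K A B \<epsilon> = (let F = free_module A (carrier (tensor_algebra K A B 1 1)) in
    restrict_scalars (scalar_map K A \<epsilon>)
      (quot_module F (span_module A F (sec_kaehler_rels K A B \<epsilon>))))"


section \<open>The quotient of J\<close>

definition mult_map ::
  "'k ring \<Rightarrow> ('k, 'a) module \<Rightarrow> ('b \<Rightarrow> 'a) \<Rightarrow> ('k, 'a, 'b) tensor \<Rightarrow> 'a"
  where "mult_map K A \<epsilon> = tensor_lift K A (\<lambda>z. case z of ([a, b], [\<alpha>]) \<Rightarrow> a \<otimes>\<^bsub>A\<^esub> b \<otimes>\<^bsub>A\<^esub> \<epsilon> \<alpha>)"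

definition J_ideal ::
  "'k ring \<Rightarrow> ('k, 'a) module \<Rightarrow> ('k, 'b) module \<Rightarrow> ('b \<Rightarrow> 'a) \<Rightarrow> ('k, 'a, 'b) tensor set"
  where "J_ideal K A B \<epsilon> = a_kernel (tensor_algebra K A B 2 1) A (mult_map K A \<epsilon>)"

definition J_hat_elem ::
  "'k ring \<Rightarrow> ('k, 'a) module \<Rightarrow> ('k, 'b) module \<Rightarrow> ('b \<Rightarrow> 'a) \<Rightarrow> 'b \<Rightarrow> ('k, 'a, 'b) tensor"
  where "J_hat_elem K A B \<epsilon> \<alpha> = (let T = tensor_algebra K A B 2 1; t = elem_tensor K A B in
    t [\<one>\<^bsub>A\<^esub>, \<one>\<^bsub>A\<^esub>] [\<alpha>] \<ominus>\<^bsub>T\<^esub> t [\<epsilon> \<alpha>, \<one>\<^bsub>A\<^esub>] [\<one>\<^bsub>B\<^esub>]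
    \<oplus>\<^bsub>T\<^esub> t [\<one>\<^bsub>A\<^esub>, \<one>\<^bsub>A\<^esub>] [\<alpha>] \<ominus>\<^bsub>T\<^esub> t [\<one>\<^bsub>A\<^esub>, \<epsilon> \<alpha>] [\<one>\<^bsub>B\<^esub>])"

definition J_hat ::
  "'k ring \<Rightarrow> ('k, 'a) module \<Rightarrow> ('k, 'b) module \<Rightarrow> ('b \<Rightarrow> 'a) \<Rightarrow> ('k, 'a, 'b) tensor set"
  where "J_hat K A B \<epsilon> =
    {(\<Oplus>\<^bsub>tensor_algebra K A B 2 1\<^esub>i\<in>{..<n}. J_hat_elem K A B \<epsilon> (s i)) | (n::nat) s.
       s \<in> {..<n} \<rightarrow> carrier B}"

text \<open>\<open>J\<^sup>2 + J_hat\<close> is closed under addition but in general not under multiplication by \<open>A\<close>, so that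
  the quotient module is the quotient by the ideal which it generates. For
  \<open>A = B = K[x,y]/(x,y)\<^sup>2\<close> and \<open>\<epsilon> = id\<close> the quotient of \<open>K\<close>-vector spaces by \<open>J\<^sup>2 + J_hat\<close> itself has
  dimension 4, whereas the secondary differentials have dimension 3.\<close>

definition J_quotient ::
  "'k ring \<Rightarrow> ('k, 'a) module \<Rightarrow> ('k, 'b) module \<Rightarrow> ('b \<Rightarrow> 'a) \<Rightarrow>
    (('k, 'a, 'b) tensor, ('k, 'a, 'b) tensor set) module"
  where "J_quotient K A B \<epsilon> = (let T = tensor_algebra K A B 2 1; J = J_ideal K A B \<epsilon> in
    restrict_scalars (scalar_map K A \<epsilon>)
      (quot_module ((tensor21_A K A B)\<lparr>carrier := J\<rparr>)
        (Idl\<^bsub>T\<^esub> ((J \<cdot>\<^bsub>T\<^esub> J) <+>\<^bsub>T\<^esub> J_hat K A B \<epsilon>))))"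

end

theory Submission
  imports Defs
begin

text \<open>Write \<open>m\<close> for the multiplication \<open>A \<otimes> A \<otimes> B \<rightarrow> A\<close>. The assignment
  \<open>\<psi>(a \<otimes> b \<otimes> \<alpha>) = a d(\<alpha> \<otimes> b)\<close> defines a surjective \<open>A\<close>-linear map from \<open>A \<otimes> A \<otimes> B\<close> onto the
  secondary differentials, and \<open>\<psi>\<close> is a derivation along \<open>m\<close>. Both isomorphisms are the first
  isomorphism theorem, for \<open>\<psi>\<close> and for its restriction to \<open>J\<close>.

  Since \<open>\<partial>\<^sub>1 = 0\<close>, the first one needs \<open>Ker \<psi> = Im \<partial>\<^sub>2\<close>. That \<open>\<psi>\<close> kills boundaries follows by writing
  \<open>d(\<alpha> \<otimes> b) = b d(\<alpha> \<otimes> 1) + \<epsilon>(\<alpha>) d(1 \<otimes> b)\<close>. Conversely \<open>d(\<alpha> \<otimes> b) \<mapsto> [1 \<otimes> b \<otimes> \<alpha>]\<close> respects the relations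
  modulo boundaries, because the Leibniz rule is \<open>\<partial>\<^sub>2\<close> with \<open>\<gamma> = 1\<close> and relation (iii) is \<open>\<partial>\<^sub>2\<close> with
  all entries but \<open>\<gamma>\<close> equal to \<open>1\<close>; this gives a left inverse of \<open>\<psi>\<close> modulo boundaries.

  For the second one, a derivation along \<open>m\<close> kills \<open>J\<^sup>2\<close>, and it kills the ideal generated by any
  subset of \<open>J\<close> on which it vanishes. Modulo the ideal generated by \<open>J\<^sup>2\<close> and \<open>J_hat\<close>, the assignment
  \<open>d(\<alpha> \<otimes> b) \<mapsto> [1 \<otimes> b \<otimes> \<alpha> - b \<epsilon>(\<alpha>) \<otimes> 1 \<otimes> 1]\<close> is well defined, and composed with \<open>\<psi>\<close> it sends \<open>z\<close> to
  the class of \<open>z - m(z) \<otimes> 1 \<otimes> 1\<close>, which is that of \<open>z\<close> when \<open>z\<close> lies in \<open>J\<close>.\<close>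

section \<open>Linear maps and quotient modules\<close>

text \<open>One notion serves two base rings: maps out of tensor products are linear over
  \<open>K\<close>, maps between \<open>tensor21_A\<close> and the differentials over
  \<open>A\<close>. Products in the records are ignored.\<close>

locale linear_map = M: module R M + N: module R N
  for R :: "('r, 's) ring_scheme" and M :: "('r, 'm, 't) module_scheme"
    and N :: "('r, 'n, 'u) module_scheme" +
  fixes h :: "'m \<Rightarrow> 'n"
  assumes closed [simp, intro]: "x \<in> carrier M \<Longrightarrow> h x \<in> carrier N"
    and add: "\<lbrakk>x \<in> carrier M; y \<in> carrier M\<rbrakk> \<Longrightarrow> h (x \<oplus>\<^bsub>M\<^esub> y) = h x \<oplus>\<^bsub>N\<^esub> h y"
    and smult: "\<lbrakk>r \<in> carrier R; x \<in> carrier M\<rbrakk> \<Longrightarrow> h (r \<odot>\<^bsub>M\<^esub> x) = r \<odot>\<^bsub>N\<^esub> h x"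
begin

lemma zero: "h \<zero>\<^bsub>M\<^esub> = \<zero>\<^bsub>N\<^esub>"
proof -
  have "h \<zero>\<^bsub>M\<^esub> \<oplus>\<^bsub>N\<^esub> h \<zero>\<^bsub>M\<^esub> = h \<zero>\<^bsub>M\<^esub>"
    using add[of "\<zero>\<^bsub>M\<^esub>" "\<zero>\<^bsub>M\<^esub>"] by simp
  then show ?thesis
    by (simp add: N.add.r_cancel_one')
qed

lemma uminus: "x \<in> carrier M \<Longrightarrow> h (\<ominus>\<^bsub>M\<^esub> x) = \<ominus>\<^bsub>N\<^esub> h x"
  using add[of "\<ominus>\<^bsub>M\<^esub> x" x] by (simp add: M.l_neg zero N.minus_equality)

lemma minus: "\<lbrakk>x \<in> carrier M; y \<in> carrier M\<rbrakk> \<Longrightarrow> h (x \<ominus>\<^bsub>M\<^esub> y) = h x \<ominus>\<^bsub>N\<^esub> h y"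
  unfolding a_minus_def by (simp add: add uminus)

lemma kernel_submodule: "submodule (a_kernel M N h) R M"
  unfolding a_kernel_def' by (rule M.submoduleI) (simp_all add: add smult zero uminus)

text \<open>Pulling back along a coset projection turns a generation statement for a free module
  into one for its quotients.\<close>

lemma vimage_submodule:
  assumes "submodule H R N"
  shows "submodule {x \<in> carrier M. h x \<in> H} R M"
proof -
  note H = N.submoduleE[OF assms]
  have "\<zero>\<^bsub>N\<^esub> \<in> H"
    using H(2,3,5) H(1) by (metis N.r_neg ex_in_conv subsetD)
  then show ?thesis
    by (intro M.submoduleI) (auto simp: add smult zero uminus H)
qed

lemma image_submodule: "submodule (h ` carrier M) R N"
proof (rule N.submoduleI)
  show "h ` carrier M \<subseteq> carrier N"
    by (simp add: image_subset_iff)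
  show "\<zero>\<^bsub>N\<^esub> \<in> h ` carrier M"
    by (simp add: zero[symmetric])
next
  fix a b r assume "a \<in> h ` carrier M"
  then obtain x where x: "x \<in> carrier M" "a = h x" by blast
  then show "\<ominus>\<^bsub>N\<^esub> a \<in> h ` carrier M"
    by (simp add: uminus[symmetric])
  show "r \<odot>\<^bsub>N\<^esub> a \<in> h ` carrier M" if "r \<in> carrier R"
    using x that by (simp add: smult[symmetric])
  assume "b \<in> h ` carrier M"
  then obtain y where "y \<in> carrier M" "b = h y" by blast
  with x show "a \<oplus>\<^bsub>N\<^esub> b \<in> h ` carrier M"
    by (simp add: add[symmetric])
qed

end

lemma linear_mapI:
  assumes "module R M" "module R N"
    and "\<And>x. x \<in> carrier M \<Longrightarrow> h x \<in> carrier N"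
    and "\<And>x y. \<lbrakk>x \<in> carrier M; y \<in> carrier M\<rbrakk> \<Longrightarrow> h (x \<oplus>\<^bsub>M\<^esub> y) = h x \<oplus>\<^bsub>N\<^esub> h y"
    and "\<And>r x. \<lbrakk>r \<in> carrier R; x \<in> carrier M\<rbrakk> \<Longrightarrow> h (r \<odot>\<^bsub>M\<^esub> x) = r \<odot>\<^bsub>N\<^esub> h x"
  shows "linear_map R M N h"
  using assms unfolding linear_map_def linear_map_axioms_def by blast

lemma linear_map_cong:
  assumes "linear_map R M N g" "\<And>x. x \<in> carrier M \<Longrightarrow> h x = g x"
  shows "linear_map R M N h"
proof -
  interpret linear_map R M N g by fact
  show ?thesis
    by (rule linear_mapI) (auto simp: assms(2) add smult intro: M.module_axioms N.module_axioms)
qed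

lemma linear_map_comp:
  assumes "linear_map R M N f" "linear_map R N P g"
  shows "linear_map R M P (\<lambda>x. g (f x))"
proof -
  interpret f: linear_map R M N f by fact
  interpret g: linear_map R N P g by fact
  show ?thesis
    by (rule linear_mapI)
      (auto simp: f.add g.add f.smult g.smult intro: f.M.module_axioms g.N.module_axioms)
qed

lemma linear_map_add:
  assumes "linear_map R M N f" "linear_map R M N g"
  shows "linear_map R M N (\<lambda>x. f x \<oplus>\<^bsub>N\<^esub> g x)"
proof -
  interpret f: linear_map R M N f by fact
  interpret g: linear_map R M N g by fact
  show ?thesis
    by (rule linear_mapI)
      (auto simp: f.add g.add f.smult g.smult f.N.smult_r_distr f.N.add.m_ac
        intro: f.M.module_axioms f.N.module_axioms)
qed

lemma linear_map_uminus:
  assumes "linear_map R M N f"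
  shows "linear_map R M N (\<lambda>x. \<ominus>\<^bsub>N\<^esub> f x)"
proof -
  interpret f: linear_map R M N f by fact
  show ?thesis
    by (rule linear_mapI)
      (auto simp: f.add f.smult f.N.smult_r_minus f.N.minus_add
        intro: f.M.module_axioms f.N.module_axioms)
qed

lemma linear_map_minus:
  assumes "linear_map R M N f" "linear_map R M N g"
  shows "linear_map R M N (\<lambda>x. f x \<ominus>\<^bsub>N\<^esub> g x)"
  unfolding a_minus_def using assms by (intro linear_map_add linear_map_uminus)

lemma (in module) linear_map_id: "linear_map R M M (\<lambda>x. x)"
  by (rule linear_mapI) (auto intro: module_axioms)

lemma (in module) linear_map_smult:
  assumes "a \<in> carrier R"
  shows "linear_map R M M (\<lambda>x. a \<odot>\<^bsub>M\<^esub> x)"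
  using assms
  by (intro linear_mapI)
    (auto simp: smult_r_distr smult_assoc1[symmetric] R.m_comm intro: module_axioms)

section \<open>Submodules and spans\<close>

lemma (in module) submodule_zero:
  assumes "submodule H R M"
  shows "\<zero>\<^bsub>M\<^esub> \<in> H"
  using subgroup.one_closed[OF submodule.axioms(1)[OF assms]] by simp

lemma (in module) submodule_Inter:
  assumes "\<And>H. H \<in> \<H> \<Longrightarrow> submodule H R M" "\<H> \<noteq> {}"
  shows "submodule (\<Inter>\<H>) R M"
proof (rule submoduleI)
  show "\<Inter>\<H> \<subseteq> carrier M"
    using assms submoduleE(1) by blast
  show "\<zero>\<^bsub>M\<^esub> \<in> \<Inter>\<H>"
    using assms submodule_zero by blast
qed (auto intro: submoduleE(3-5)[OF assms(1)])

text \<open>The whole carrier is one of the submodules containing \<open>S\<close>, so the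
  intersection runs over a nonempty family.\<close>

lemma (in module) span_module_submodule:
  assumes "S \<subseteq> carrier M"
  shows "submodule (span_module R M S) R M"
  unfolding span_module_def using assms carrier_is_submodule
  by (intro submodule_Inter) auto

lemma span_module_superset: "S \<subseteq> span_module R M S"
  unfolding span_module_def by blast

lemma span_module_least:
  assumes "submodule H R M" "S \<subseteq> H"
  shows "span_module R M S \<subseteq> H"
  unfolding span_module_def using assms by blast

section \<open>Quotient modules by cosets\<close>

lemma quot_module_simps:
  "carrier (quot_module M H) = a_rcosets\<^bsub>M\<^esub> H"
  "\<zero>\<^bsub>quot_module M H\<^esub> = H"
  "X \<oplus>\<^bsub>quot_module M H\<^esub> Y = X <+>\<^bsub>M\<^esub> Y"
  "r \<odot>\<^bsub>quot_module M H\<^esub> X = (\<Union>x\<in>X. H +>\<^bsub>M\<^esub> (r \<odot>\<^bsub>M\<^esub> x))"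
  by (simp_all add: quot_module_def)

locale module_quotient = module R M
  for R :: "('r, 's) ring_scheme" and M :: "('r, 'm, 't) module_scheme" +
  fixes H :: "'m set"
  assumes sub: "submodule H R M"
begin

sublocale abelian_subgroup H M
  using submodule.axioms(1)[OF sub] a_comm_group by (rule abelian_subgroupI2[rotated])

abbreviation proj :: "'m \<Rightarrow> 'm set"
  where "proj x \<equiv> H +>\<^bsub>M\<^esub> x"

lemma proj_closed: "x \<in> carrier M \<Longrightarrow> proj x \<in> carrier (quot_module M H)"
  using a_rcosetsI[OF a_subset] by (simp add: quot_module_simps)

lemma carrier_quot: "carrier (quot_module M H) = proj ` carrier M"
  by (auto simp: quot_module_simps A_RCOSETS_def')

lemma proj_add:
  "\<lbrakk>x \<in> carrier M; y \<in> carrier M\<rbrakk> \<Longrightarrow> proj x \<oplus>\<^bsub>quot_module M H\<^esub> proj y = proj (x \<oplus>\<^bsub>M\<^esub> y)"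
  by (simp add: quot_module_simps a_rcos_sum)

lemma proj_eq_iff:
  assumes "x \<in> carrier M" "y \<in> carrier M"
  shows "proj x = proj y \<longleftrightarrow> x \<ominus>\<^bsub>M\<^esub> y \<in> H"
proof
  assume "proj x = proj y"
  then have "proj (x \<ominus>\<^bsub>M\<^esub> y) = H"
    using a_coset_add_inv2 assms a_subset by (simp add: a_minus_def)
  then show "x \<ominus>\<^bsub>M\<^esub> y \<in> H"
    using a_coset_join1 assms a_subgroup by simp
next
  assume "x \<ominus>\<^bsub>M\<^esub> y \<in> H"
  then have "proj (x \<ominus>\<^bsub>M\<^esub> y) = H"
    using a_coset_join2 assms a_subgroup by simp
  then show "proj x = proj y"
    using a_coset_add_inv1 assms a_subset by (simp add: a_minus_def)
qed

text \<open>The union over representatives in \<open>quot_module\<close> is a union of equal cosets: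
  two representatives differ by an element of \<open>H\<close>, and \<open>H\<close> is stable under
  scalars. It is not empty, since \<open>x\<close> lies in its own coset.\<close>

lemma proj_smult:
  assumes "r \<in> carrier R" "x \<in> carrier M"
  shows "r \<odot>\<^bsub>quot_module M H\<^esub> proj x = proj (r \<odot>\<^bsub>M\<^esub> x)"
proof -
  have "proj (r \<odot>\<^bsub>M\<^esub> y) = proj (r \<odot>\<^bsub>M\<^esub> x)" if "y \<in> proj x" for y
  proof -
    have y: "y \<in> carrier M"
      using that assms a_elemrcos_carrier by blast
    have "proj x = proj y"
      using a_repr_independence[OF that assms(2) a_subgroup] .
    then have "r \<odot>\<^bsub>M\<^esub> (y \<ominus>\<^bsub>M\<^esub> x) \<in> H"
      using proj_eq_iff[of y x] y assms submodule.smult_closed[OF sub] by simp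
    then show ?thesis
      using y assms by (simp add: proj_eq_iff a_minus_def smult_r_distr smult_r_minus)
  qed
  moreover have "x \<in> proj x"
    using assms a_rcos_self by simp
  ultimately show ?thesis
    unfolding quot_module_simps by blast
qed

lemma abelian_group_quot: "abelian_group (quot_module M H)"
proof (rule abelian_groupI)
  \<comment> \<open>The zero of the record is \<open>H\<close> itself; written as a coset it falls
    under \<open>proj_add\<close>.\<close>
  have zero: "\<zero>\<^bsub>quot_module M H\<^esub> = proj \<zero>\<^bsub>M\<^esub>"
    using a_coset_add_zero[OF a_subset] by (simp add: quot_module_simps)
  show "\<zero>\<^bsub>quot_module M H\<^esub> \<in> carrier (quot_module M H)"
    by (simp add: zero proj_closed)
  fix X assume "X \<in> carrier (quot_module M H)"
  then obtain x where x: "X = proj x" "x \<in> carrier M"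
    by (auto simp: carrier_quot)
  show "\<zero>\<^bsub>quot_module M H\<^esub> \<oplus>\<^bsub>quot_module M H\<^esub> X = X"
    using x by (simp add: zero proj_add)
  show "\<exists>Y\<in>carrier (quot_module M H). Y \<oplus>\<^bsub>quot_module M H\<^esub> X = \<zero>\<^bsub>quot_module M H\<^esub>"
    using x by (intro bexI[of _ "proj (\<ominus>\<^bsub>M\<^esub> x)"]) (simp_all add: zero proj_add proj_closed M.l_neg)
qed (auto simp: carrier_quot proj_add M.add.m_ac)

lemma module_quot: "module R (quot_module M H)"
proof (rule moduleI)
  fix a b X Y
  assume ab: "a \<in> carrier R" "b \<in> carrier R"
    and X: "X \<in> carrier (quot_module M H)"
  then obtain x where x: "x \<in> carrier M" "X = proj x"
    by (auto simp: carrier_quot)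
  show "(a \<oplus>\<^bsub>R\<^esub> b) \<odot>\<^bsub>quot_module M H\<^esub> X =
      a \<odot>\<^bsub>quot_module M H\<^esub> X \<oplus>\<^bsub>quot_module M H\<^esub> b \<odot>\<^bsub>quot_module M H\<^esub> X"
    using ab x by (simp add: proj_add proj_smult smult_l_distr)
  show "(a \<otimes>\<^bsub>R\<^esub> b) \<odot>\<^bsub>quot_module M H\<^esub> X = a \<odot>\<^bsub>quot_module M H\<^esub> (b \<odot>\<^bsub>quot_module M H\<^esub> X)"
    using ab x by (simp add: proj_smult smult_assoc1)
next
  fix a X Y
  assume a: "a \<in> carrier R"
    and "X \<in> carrier (quot_module M H)" "Y \<in> carrier (quot_module M H)"
  then obtain x y where "x \<in> carrier M" "X = proj x" "y \<in> carrier M" "Y = proj y"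
    by (auto simp: carrier_quot)
  then show "a \<odot>\<^bsub>quot_module M H\<^esub> (X \<oplus>\<^bsub>quot_module M H\<^esub> Y) =
      a \<odot>\<^bsub>quot_module M H\<^esub> X \<oplus>\<^bsub>quot_module M H\<^esub> a \<odot>\<^bsub>quot_module M H\<^esub> Y"
    using a by (simp add: proj_add proj_smult smult_r_distr)
qed (auto simp: carrier_quot proj_smult intro: R.is_cring abelian_group_quot)

lemma linear_map_proj: "linear_map R M (quot_module M H) proj"
  by (rule linear_mapI)
    (auto simp: proj_add proj_smult carrier_quot intro: module_axioms module_quot)

lemma proj_eq_zero_iff:
  assumes "x \<in> carrier M"
  shows "proj x = \<zero>\<^bsub>quot_module M H\<^esub> \<longleftrightarrow> x \<in> H"
  unfolding quot_module_simps
  using a_coset_join1[OF _ assms a_subgroup] a_coset_join2[OF assms a_subgroup] by blast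

text \<open>When \<open>h\<close> vanishes on \<open>H\<close>, the image of a coset is a singleton.
  The shape matches \<open>tensor_lift\<close>, which is therefore an instance of
  \<open>induced\<close>.\<close>

definition induced :: "('m \<Rightarrow> 'n) \<Rightarrow> 'm set \<Rightarrow> 'n"
  where "induced h X = the_elem (h ` X)"

lemma induced_proj:
  assumes "linear_map R M N h" "H \<subseteq> a_kernel M N h" "x \<in> carrier M"
  shows "induced h (proj x) = h x"
proof -
  interpret h: linear_map R M N h by fact
  have "h y = h x" if y: "y \<in> proj x" for y
  proof -
    obtain k where "k \<in> H" "y = k \<oplus>\<^bsub>M\<^esub> x"
      using y by (auto simp: a_r_coset_def')
    then show ?thesis
      using assms(2,3) by (auto simp: a_kernel_def' h.add)
  qed
  then have "h ` proj x = {h x}"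
    using a_rcos_self[OF assms(3)] by blast
  then show ?thesis
    by (simp add: induced_def)
qed

lemma linear_map_induced:
  assumes "linear_map R M N h" "H \<subseteq> a_kernel M N h"
  shows "linear_map R (quot_module M H) N (induced h)"
proof -
  interpret h: linear_map R M N h by fact
  show ?thesis
    by (rule linear_mapI)
      (auto simp: carrier_quot proj_add proj_smult induced_proj[OF assms] h.add h.smult
        intro: module_quot h.N.module_axioms)
qed

end

text \<open>Equal values of the induced map put the difference of two representatives into the
  kernel, which gives injectivity. The set \<open>H\<close> is kept apart from the kernel because in
  both applications it has a description of its own, as an image of boundaries and as a generated
  ideal.\<close>

lemma module_isomorphic_first_isomorphism:
  assumes "linear_map R M N h" "h ` carrier M = carrier N" "H = a_kernel M N h"
  shows "module_isomorphic R (quot_module M H) N"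
proof -
  interpret h: linear_map R M N h by fact
  interpret module_quotient R M H
    by (intro module_quotient.intro module_quotient_axioms.intro)
      (simp_all add: assms(3) h.kernel_submodule h.M.module_axioms)
  have ind: "induced h (proj x) = h x" if "x \<in> carrier M" for x
    using induced_proj[OF assms(1)] assms(3) that by blast
  interpret i: linear_map R "quot_module M H" N "induced h"
    using linear_map_induced[OF assms(1)] assms(3) by blast
  have "inj_on (induced h) (carrier (quot_module M H))"
  proof (rule inj_onI)
    fix X Y assume "X \<in> carrier (quot_module M H)" "Y \<in> carrier (quot_module M H)"
      and eq: "induced h X = induced h Y"
    then obtain x y where xy: "x \<in> carrier M" "y \<in> carrier M" "X = proj x" "Y = proj y"
      by (auto simp: carrier_quot)
    with eq have "h (x \<ominus>\<^bsub>M\<^esub> y) = \<zero>\<^bsub>N\<^esub>"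
      by (simp add: ind h.minus) (simp add: a_minus_def h.N.r_neg)
    then show "X = Y"
      using xy proj_eq_iff[of x y] by (simp add: assms(3)) (simp add: a_kernel_def')
  qed
  moreover have "induced h ` carrier (quot_module M H) = carrier N"
    using assms(2) by (simp add: carrier_quot image_image ind cong: image_cong_simp)
  ultimately show ?thesis
    unfolding module_isomorphic_def bij_betw_def using i.add i.smult by blast
qed

text \<open>The inverse bijection carries the operations back; the closure conditions keep sums and
  multiples in the domain on which it undoes \<open>h\<close>.\<close>

lemma module_isomorphic_sym:
  assumes "module_isomorphic R M N"
    and "\<And>x y. \<lbrakk>x \<in> carrier M; y \<in> carrier M\<rbrakk> \<Longrightarrow> x \<oplus>\<^bsub>M\<^esub> y \<in> carrier M"
    and "\<And>r x. \<lbrakk>r \<in> carrier R; x \<in> carrier M\<rbrakk> \<Longrightarrow> r \<odot>\<^bsub>M\<^esub> x \<in> carrier M"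
  shows "module_isomorphic R N M"
proof -
  obtain h where h: "bij_betw h (carrier M) (carrier N)"
    "\<forall>x\<in>carrier M. \<forall>y\<in>carrier M. h (x \<oplus>\<^bsub>M\<^esub> y) = h x \<oplus>\<^bsub>N\<^esub> h y"
    "\<forall>r\<in>carrier R. \<forall>x\<in>carrier M. h (r \<odot>\<^bsub>M\<^esub> x) = r \<odot>\<^bsub>N\<^esub> h x"
    using assms(1) unfolding module_isomorphic_def by blast
  define g where "g = inv_into (carrier M) h"
  have g: "bij_betw g (carrier N) (carrier M)"
    unfolding g_def by (rule bij_betw_inv_into[OF h(1)])
  have gh: "g (h x) = x" if "x \<in> carrier M" for x
    unfolding g_def by (rule bij_betw_inv_into_left[OF h(1) that])
  have N: "carrier N = h ` carrier M"
    using h(1) by (simp add: bij_betw_def)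
  have "g (x \<oplus>\<^bsub>N\<^esub> y) = g x \<oplus>\<^bsub>M\<^esub> g y" if "x \<in> carrier N" "y \<in> carrier N" for x y
    using that h(2)[rule_format, symmetric] assms(2) by (auto simp: N gh)
  moreover have "g (r \<odot>\<^bsub>N\<^esub> x) = r \<odot>\<^bsub>M\<^esub> g x" if "r \<in> carrier R" "x \<in> carrier N" for r x
    using that h(3)[rule_format, symmetric] assms(3) by (auto simp: N gh)
  ultimately show ?thesis
    unfolding module_isomorphic_def using g by blast
qed

section \<open>Restriction of scalars\<close>

lemma restrict_scalars_simps [simp]:
  "carrier (restrict_scalars f M) = carrier M"
  "zero (restrict_scalars f M) = zero M"
  "add (restrict_scalars f M) = add M"
  "smult (restrict_scalars f M) = (\<lambda>q x. f q \<odot>\<^bsub>M\<^esub> x)"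
  by (simp_all add: restrict_scalars_def)

text \<open>Both isomorphisms are built over \<open>A\<close>; this carries them over to B \<otimes>
  A, which acts through \<open>scalar_map\<close>.\<close>

lemma module_isomorphic_restrict_scalars:
  assumes "module_isomorphic R M N" "f \<in> carrier Q \<rightarrow> carrier R"
  shows "module_isomorphic Q (restrict_scalars f M) (restrict_scalars f N)"
proof -
  obtain h where "bij_betw h (carrier M) (carrier N)"
    "\<forall>x\<in>carrier M. \<forall>y\<in>carrier M. h (x \<oplus>\<^bsub>M\<^esub> y) = h x \<oplus>\<^bsub>N\<^esub> h y"
    "\<forall>r\<in>carrier R. \<forall>x\<in>carrier M. h (r \<odot>\<^bsub>M\<^esub> x) = r \<odot>\<^bsub>N\<^esub> h x"
    using assms(1) unfolding module_isomorphic_def by blast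
  then show ?thesis
    using assms(2) unfolding module_isomorphic_def by (intro exI[of _ h]) (simp add: Pi_iff)
qed

lemma module_restrict_scalars:
  assumes "module R M" "cring Q" "f \<in> ring_hom Q R"
  shows "module Q (restrict_scalars f M)"
proof -
  interpret module R M by fact
  have "abelian_group (restrict_scalars f M)"
    by (rule abelian_groupI) (auto simp: M.add.m_ac intro: bexI[of _ "\<ominus>\<^bsub>M\<^esub> x" for x] M.l_neg)
  then show ?thesis
    using assms(2,3)
    by (intro moduleI)
      (auto simp: ring_hom_def Pi_iff smult_l_distr smult_r_distr smult_assoc1)
qed


section \<open>Free modules\<close>

lemma free_module_simps:
  "carrier (free_module R X) =
    {p. range p \<subseteq> carrier R \<and> {x. p x \<noteq> \<zero>\<^bsub>R\<^esub>} \<subseteq> X \<and> finite {x. p x \<noteq> \<zero>\<^bsub>R\<^esub>}}"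
  "\<zero>\<^bsub>free_module R X\<^esub> = (\<lambda>x. \<zero>\<^bsub>R\<^esub>)"
  "p \<oplus>\<^bsub>free_module R X\<^esub> q = (\<lambda>x. p x \<oplus>\<^bsub>R\<^esub> q x)"
  "r \<odot>\<^bsub>free_module R X\<^esub> p = (\<lambda>x. r \<otimes>\<^bsub>R\<^esub> p x)"
  by (simp_all add: free_module_def)

text \<open>The linear extension of \<open>f\<close>, written as the very expression that
  \<open>tensor_lift\<close> applies to the members of a coset.\<close>

definition free_lift ::
  "('r, 's) ring_scheme \<Rightarrow> ('r, 'm, 't) module_scheme \<Rightarrow> ('x \<Rightarrow> 'm) \<Rightarrow> ('x \<Rightarrow> 'r) \<Rightarrow> 'm"
  where "free_lift R N f p = (\<Oplus>\<^bsub>N\<^esub>x\<in>{x. p x \<noteq> \<zero>\<^bsub>R\<^esub>}. p x \<odot>\<^bsub>N\<^esub> f x)"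

context cring
begin

lemma free_module_carrier_add:
  assumes "p \<in> carrier (free_module R X)" "q \<in> carrier (free_module R X)"
  shows "(\<lambda>x. p x \<oplus> q x) \<in> carrier (free_module R X)"
proof -
  have "{x. p x \<oplus> q x \<noteq> \<zero>} \<subseteq> {x. p x \<noteq> \<zero>} \<union> {x. q x \<noteq> \<zero>}"
    by auto
  with assms show ?thesis
    by (auto simp: free_module_simps image_subset_iff intro: finite_subset)
qed

text \<open>Handles negation and scalar multiplication together: a map that fixes zero cannot
  enlarge the support.\<close>

lemma free_module_carrier_map:
  assumes "p \<in> carrier (free_module R X)" "g \<in> carrier R \<rightarrow> carrier R" "g \<zero> = \<zero>"
  shows "(\<lambda>x. g (p x)) \<in> carrier (free_module R X)"
proof -
  have "{x. g (p x) \<noteq> \<zero>} \<subseteq> {x. p x \<noteq> \<zero>}"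
    using assms by auto
  with assms show ?thesis
    by (auto simp: free_module_simps image_subset_iff intro: finite_subset)
qed

lemma free_module_module: "module R (free_module R X)"
proof (rule moduleI)
  show "abelian_group (free_module R X)"
  proof (rule abelian_groupI)
    fix p assume p: "p \<in> carrier (free_module R X)"
    have "(\<lambda>x. \<ominus> p x) \<in> carrier (free_module R X)"
      using free_module_carrier_map[OF p, of "a_inv R"] by simp
    moreover have "(\<lambda>x. \<ominus> p x) \<oplus>\<^bsub>free_module R X\<^esub> p = \<zero>\<^bsub>free_module R X\<^esub>"
      using p by (auto simp: free_module_simps image_subset_iff l_neg)
    ultimately show "\<exists>q\<in>carrier (free_module R X). q \<oplus>\<^bsub>free_module R X\<^esub> p = \<zero>\<^bsub>free_module R X\<^esub>"
      by blast
  next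
    fix p q assume "p \<in> carrier (free_module R X)" "q \<in> carrier (free_module R X)"
    then show "p \<oplus>\<^bsub>free_module R X\<^esub> q \<in> carrier (free_module R X)"
      using free_module_carrier_add by (simp add: free_module_simps(3))
  qed (auto simp: free_module_simps image_subset_iff add.m_ac)
next
  fix r p assume "r \<in> carrier R" "p \<in> carrier (free_module R X)"
  then show "r \<odot>\<^bsub>free_module R X\<^esub> p \<in> carrier (free_module R X)"
    using free_module_carrier_map[of p X "\<lambda>y. r \<otimes> y"] by (simp add: free_module_simps(4))
qed (auto simp: free_module_simps image_subset_iff l_distr r_distr m_assoc intro: is_cring)

lemma free_gen_closed: "x \<in> X \<Longrightarrow> free_gen R x \<in> carrier (free_module R X)"
  by (auto simp: free_module_simps free_gen_def)

text \<open>Induction on a finite set containing the support: \<open>p\<close> is \<open>p x\<close>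
  times the generator at \<open>x\<close>, plus \<open>p\<close> with its value at \<open>x\<close>
  set to zero.\<close>

lemma free_module_submodule_eq:
  assumes "submodule P R (free_module R X)" "free_gen R ` X \<subseteq> P"
  shows "P = carrier (free_module R X)"
proof
  let ?F = "free_module R X"
  interpret F: module R ?F
    by (rule free_module_module)
  note P = F.submoduleE[OF assms(1)]
  show "P \<subseteq> carrier ?F"
    by (rule P)
  have "p \<in> P" if "finite S" "S \<subseteq> X" "range p \<subseteq> carrier R" "{x. p x \<noteq> \<zero>} \<subseteq> S" for S p
    using that
  proof (induction S arbitrary: p rule: finite_induct)
    case empty
    then have "p = \<zero>\<^bsub>?F\<^esub>"
      by (auto simp: free_module_simps)
    then show ?case
      using F.submodule_zero[OF assms(1)] by simp
  next
    case (insert x S)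
    have "p(x := \<zero>) \<in> P"
      using insert.prems by (intro insert.IH) (auto split: if_splits)
    moreover have "p x \<odot>\<^bsub>?F\<^esub> free_gen R x \<in> P"
      using insert.prems assms(2) by (intro P) auto
    moreover have "p = p x \<odot>\<^bsub>?F\<^esub> free_gen R x \<oplus>\<^bsub>?F\<^esub> p(x := \<zero>)"
      using insert.prems by (auto simp: free_module_simps free_gen_def image_subset_iff)
    ultimately show ?case
      using P(5) by metis
  qed
  then show "carrier ?F \<subseteq> P"
    by (auto simp: free_module_simps)
qed

end

text \<open>Points outside the support contribute zero. The freedom in \<open>S\<close> lets
  functions with different supports be summed over one index set.\<close>

lemma (in module) free_lift_superset:
  assumes f: "f \<in> X \<rightarrow> carrier M" and "finite S" "S \<subseteq> X" "range p \<subseteq> carrier R"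
    "{x. p x \<noteq> \<zero>\<^bsub>R\<^esub>} \<subseteq> S"
  shows "free_lift R M f p = (\<Oplus>\<^bsub>M\<^esub>x\<in>S. p x \<odot>\<^bsub>M\<^esub> f x)"
  unfolding free_lift_def
  by (rule M.add.finprod_mono_neutral_cong_left)
    (use assms in \<open>auto simp: image_subset_iff Pi_iff subset_iff\<close>)

lemma (in module) linear_map_free_lift:
  assumes f: "f \<in> X \<rightarrow> carrier M"
  shows "linear_map R (free_module R X) M (free_lift R M f)"
proof (rule linear_mapI)
  let ?F = "free_module R X"
  interpret F: module R ?F
    by (rule free_module_module)
  fix p assume p: "p \<in> carrier ?F"
  then show "free_lift R M f p \<in> carrier M"
    unfolding free_lift_def using f
    by (intro M.finsum_closed) (auto simp: free_module_simps image_subset_iff Pi_iff subset_iff)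
  {
    fix q assume q: "q \<in> carrier ?F"
    \<comment> \<open>Cancellation can shrink the support of a sum, so all three values are computed
      over the union of the two supports.\<close>
    define S where "S = {x. p x \<noteq> \<zero>\<^bsub>R\<^esub>} \<union> {x. q x \<noteq> \<zero>\<^bsub>R\<^esub>}"
    have S: "finite S" "S \<subseteq> X"
      using p q by (auto simp: S_def free_module_simps)
    have "free_lift R M f (p \<oplus>\<^bsub>?F\<^esub> q) = (\<Oplus>\<^bsub>M\<^esub>x\<in>S. (p x \<oplus>\<^bsub>R\<^esub> q x) \<odot>\<^bsub>M\<^esub> f x)"
      using p q unfolding free_module_simps
      by (intro free_lift_superset[OF f S]) (auto simp: S_def image_subset_iff)
    also have "\<dots> = (\<Oplus>\<^bsub>M\<^esub>x\<in>S. p x \<odot>\<^bsub>M\<^esub> f x \<oplus>\<^bsub>M\<^esub> q x \<odot>\<^bsub>M\<^esub> f x)"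
      using p q f S
      by (intro M.finsum_cong')
        (auto simp: free_module_simps image_subset_iff smult_l_distr Pi_iff subset_iff)
    also have "\<dots> = (\<Oplus>\<^bsub>M\<^esub>x\<in>S. p x \<odot>\<^bsub>M\<^esub> f x) \<oplus>\<^bsub>M\<^esub> (\<Oplus>\<^bsub>M\<^esub>x\<in>S. q x \<odot>\<^bsub>M\<^esub> f x)"
      using p q f S
      by (intro M.finsum_addf) (auto simp: free_module_simps image_subset_iff Pi_iff subset_iff)
    also have "(\<Oplus>\<^bsub>M\<^esub>x\<in>S. p x \<odot>\<^bsub>M\<^esub> f x) = free_lift R M f p"
      using p by (intro free_lift_superset[OF f S, symmetric]) (auto simp: S_def free_module_simps)
    also have "(\<Oplus>\<^bsub>M\<^esub>x\<in>S. q x \<odot>\<^bsub>M\<^esub> f x) = free_lift R M f q"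
      using q by (intro free_lift_superset[OF f S, symmetric]) (auto simp: S_def free_module_simps)
    finally show "free_lift R M f (p \<oplus>\<^bsub>?F\<^esub> q) = free_lift R M f p \<oplus>\<^bsub>M\<^esub> free_lift R M f q" .
  }
  {
    fix r assume r: "r \<in> carrier R"
    let ?S = "{x. p x \<noteq> \<zero>\<^bsub>R\<^esub>}"
    have S: "finite ?S" "?S \<subseteq> X"
      using p by (auto simp: free_module_simps)
    have pf: "p x \<in> carrier R" "x \<in> ?S \<Longrightarrow> f x \<in> carrier M" for x
      using p f S by (auto simp: free_module_simps image_subset_iff)
    have "free_lift R M f (r \<odot>\<^bsub>?F\<^esub> p) = (\<Oplus>\<^bsub>M\<^esub>x\<in>?S. (r \<otimes>\<^bsub>R\<^esub> p x) \<odot>\<^bsub>M\<^esub> f x)"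
      unfolding free_module_simps
      by (intro free_lift_superset[OF f S]) (use pf r in auto)
    also have "\<dots> = (\<Oplus>\<^bsub>M\<^esub>x\<in>?S. r \<odot>\<^bsub>M\<^esub> (p x \<odot>\<^bsub>M\<^esub> f x))"
      by (intro M.finsum_cong') (use pf r in \<open>auto simp: smult_assoc1\<close>)
    also have "\<dots> = r \<odot>\<^bsub>M\<^esub> free_lift R M f p"
      unfolding free_lift_def
      by (intro finsum_smult_ldistr[symmetric]) (use pf r S in auto)
    finally show "free_lift R M f (r \<odot>\<^bsub>?F\<^esub> p) = r \<odot>\<^bsub>M\<^esub> free_lift R M f p" .
  }
qed (intro module_axioms free_module_module)+

lemma (in module) free_lift_gen:
  assumes "f \<in> X \<rightarrow> carrier M" "x \<in> X"
  shows "free_lift R M f (free_gen R x) = f x"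
proof -
  have "free_lift R M f (free_gen R x) = (\<Oplus>\<^bsub>M\<^esub>y\<in>{x}. free_gen R x y \<odot>\<^bsub>M\<^esub> f y)"
    by (rule free_lift_superset[OF assms(1)]) (use assms in \<open>auto simp: free_gen_def\<close>)
  then show ?thesis
    using assms by (simp add: free_gen_def Pi_iff)
qed

section \<open>The universal property of the tensor product\<close>

text \<open>Overwriting one list entry while the others stay fixed treats all \<open>n + m\<close>
  slots alike, and has the same form as the generators in \<open>multilinear_rels\<close>.\<close>

definition multilinear ::
  "'k ring \<Rightarrow> ('k, 'a) module \<Rightarrow> ('k, 'b) module \<Rightarrow> nat \<Rightarrow> nat \<Rightarrow> ('k, 'm) module \<Rightarrow>
    ('a list \<times> 'b list \<Rightarrow> 'm) \<Rightarrow> bool"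
  where "multilinear K A B n m M f \<longleftrightarrow> f \<in> tensor_index A B n m \<rightarrow> carrier M \<and>
    (\<forall>as bs. (as, bs) \<in> tensor_index A B n m \<longrightarrow>
      (\<forall>i<n. linear_map K A M (\<lambda>x. f (as[i := x], bs))) \<and>
      (\<forall>j<m. linear_map K B M (\<lambda>x. f (as, bs[j := x]))))"

lemma multilinearI:
  assumes "\<And>as bs. (as, bs) \<in> tensor_index A B n m \<Longrightarrow> f (as, bs) \<in> carrier M"
    and "\<And>as bs i. \<lbrakk>(as, bs) \<in> tensor_index A B n m; i < n\<rbrakk> \<Longrightarrow>
      linear_map K A M (\<lambda>x. f (as[i := x], bs))"
    and "\<And>as bs j. \<lbrakk>(as, bs) \<in> tensor_index A B n m; j < m\<rbrakk> \<Longrightarrow>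
      linear_map K B M (\<lambda>x. f (as, bs[j := x]))"
  shows "multilinear K A B n m M f"
  using assms unfolding multilinear_def by auto

lemma multilinearD:
  assumes "multilinear K A B n m M f" "(as, bs) \<in> tensor_index A B n m"
  shows "f (as, bs) \<in> carrier M"
    and "i < n \<Longrightarrow> linear_map K A M (\<lambda>x. f (as[i := x], bs))"
    and "j < m \<Longrightarrow> linear_map K B M (\<lambda>x. f (as, bs[j := x]))"
  using assms unfolding multilinear_def by auto

lemma tensor_index_update:
  assumes "(as, bs) \<in> tensor_index A B n m"
  shows "x \<in> carrier A \<Longrightarrow> (as[i := x], bs) \<in> tensor_index A B n m"
    and "y \<in> carrier B \<Longrightarrow> (as, bs[j := y]) \<in> tensor_index A B n m"
  using assms by (auto simp: tensor_index_def dest: set_update_subset_insert[THEN subsetD])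

lemma (in abelian_group) diff_self: "x \<in> carrier G \<Longrightarrow> x \<ominus> x = \<zero>"
  by (simp add: a_minus_def r_neg)

lemma (in abelian_group) diff_zero: "x \<in> carrier G \<Longrightarrow> x \<ominus> \<zero> = x"
  using minus_equality[of \<zero> \<zero>] by (simp add: a_minus_def)

section \<open>The additive structure shared by tensor algebra and tensor module\<close>

lemma tensor_algebra_simps [simp]:
  "carrier (tensor_algebra K A B n m) = carrier (tensor_module K A B n m)"
  "zero (tensor_algebra K A B n m) = zero (tensor_module K A B n m)"
  "add (tensor_algebra K A B n m) = add (tensor_module K A B n m)"
  "smult (tensor_algebra K A B n m) = smult (tensor_module K A B n m)"
  "mult (tensor_algebra K A B n m) = tensor_mult K A B n m"
  "one (tensor_algebra K A B n m) = elem_tensor K A B (replicate n \<one>\<^bsub>A\<^esub>) (replicate m \<one>\<^bsub>B\<^esub>)"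
  by (simp_all add: tensor_algebra_def)

lemma tensor_algebra_a_inv [simp]:
  "a_inv (tensor_algebra K A B n m) = a_inv (tensor_module K A B n m)"
  by (simp add: a_inv_def)

lemma tensor_algebra_a_minus [simp]:
  "a_minus (tensor_algebra K A B n m) = a_minus (tensor_module K A B n m)"
  by (simp add: a_minus_def fun_eq_iff)

lemma tensor_algebra_finsum [simp]:
  "finsum (tensor_algebra K A B n m) = finsum (tensor_module K A B n m)"
  by (simp add: finsum_def fun_eq_iff)

section \<open>Tensor products as quotients of free modules\<close>

locale algebra_pair = A: algebra K A + B: algebra K B
  for K :: "'k ring" and A :: "('k, 'a) module" and B :: "('k, 'b) module"
begin

abbreviation T :: "nat \<Rightarrow> nat \<Rightarrow> ('k, ('k, 'a, 'b) tensor) module"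
  where "T n m \<equiv> tensor_module K A B n m"

abbreviation t :: "'a list \<Rightarrow> 'b list \<Rightarrow> ('k, 'a, 'b) tensor"
  where "t as bs \<equiv> elem_tensor K A B as bs"

abbreviation idx :: "nat \<Rightarrow> nat \<Rightarrow> ('a list \<times> 'b list) set"
  where "idx n m \<equiv> tensor_index A B n m"

lemma module_free: "module K (tensor_free K A B n m)"
  by (rule A.R.free_module_module)

lemma multilinear_rels_cases:
  assumes "z \<in> multilinear_rels K A B n m"
  obtains
    (add1) as bs i x y where "(as, bs) \<in> idx n m" "i < n" "x \<in> carrier A" "y \<in> carrier A"
      "z = free_gen K (as[i := x \<oplus>\<^bsub>A\<^esub> y], bs) \<ominus>\<^bsub>tensor_free K A B n m\<^esub>
        (free_gen K (as[i := x], bs) \<oplus>\<^bsub>tensor_free K A B n m\<^esub> free_gen K (as[i := y], bs))"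
  | (smult1) as bs i r x where "(as, bs) \<in> idx n m" "i < n" "r \<in> carrier K" "x \<in> carrier A"
      "z = free_gen K (as[i := r \<odot>\<^bsub>A\<^esub> x], bs) \<ominus>\<^bsub>tensor_free K A B n m\<^esub>
        r \<odot>\<^bsub>tensor_free K A B n m\<^esub> free_gen K (as[i := x], bs)"
  | (add2) as bs j x y where "(as, bs) \<in> idx n m" "j < m" "x \<in> carrier B" "y \<in> carrier B"
      "z = free_gen K (as, bs[j := x \<oplus>\<^bsub>B\<^esub> y]) \<ominus>\<^bsub>tensor_free K A B n m\<^esub>
        (free_gen K (as, bs[j := x]) \<oplus>\<^bsub>tensor_free K A B n m\<^esub> free_gen K (as, bs[j := y]))"
  | (smult2) as bs j r x where "(as, bs) \<in> idx n m" "j < m" "r \<in> carrier K" "x \<in> carrier B"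
      "z = free_gen K (as, bs[j := r \<odot>\<^bsub>B\<^esub> x]) \<ominus>\<^bsub>tensor_free K A B n m\<^esub>
        r \<odot>\<^bsub>tensor_free K A B n m\<^esub> free_gen K (as, bs[j := x])"
  using assms unfolding multilinear_rels_def Let_def
  by (elim UnE CollectE exE conjE) (rule that; assumption)+

lemma multilinear_rels_subset: "multilinear_rels K A B n m \<subseteq> carrier (tensor_free K A B n m)"
proof
  interpret F: module K "tensor_free K A B n m"
    by (rule module_free)
  have gen: "free_gen K p \<in> carrier (tensor_free K A B n m)" if "p \<in> idx n m" for p
    using that by (rule A.R.free_gen_closed)
  fix z assume "z \<in> multilinear_rels K A B n m"
  then show "z \<in> carrier (tensor_free K A B n m)"
    by (cases rule: multilinear_rels_cases)
      (simp_all add: gen tensor_index_update A.smult_closed B.smult_closed)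
qed

lemma module_quotient_tensor:
  "module_quotient K (tensor_free K A B n m) (tensor_rels K A B n m)"
  unfolding tensor_rels_def
  by (intro module_quotient.intro module_quotient_axioms.intro module_free
      module.span_module_submodule[OF module_free] multilinear_rels_subset)

lemma module_T: "module K (T n m)"
  unfolding tensor_module_def by (rule module_quotient.module_quot[OF module_quotient_tensor])

lemma elem_tensor_eq:
  "(as, bs) \<in> idx n m \<Longrightarrow>
    t as bs = tensor_rels K A B n m +>\<^bsub>tensor_free K A B n m\<^esub> free_gen K (as, bs)"
  by (auto simp: elem_tensor_def tensor_index_def)

lemma elem_tensor_closed: "(as, bs) \<in> idx n m \<Longrightarrow> t as bs \<in> carrier (T n m)"
  unfolding elem_tensor_eq tensor_module_def
  by (intro module_quotient.proj_closed[OF module_quotient_tensor] A.R.free_gen_closed)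

text \<open>Each law in a slot is one of the four kinds of generating relations, read after
  projection to cosets.\<close>

lemma elem_tensor_linear:
  assumes ab: "(as, bs) \<in> idx n m"
  shows elem_tensor_linear1: "i < n \<Longrightarrow> linear_map K A (T n m) (\<lambda>x. t (as[i := x]) bs)"
    and elem_tensor_linear2: "j < m \<Longrightarrow> linear_map K B (T n m) (\<lambda>x. t as (bs[j := x]))"
proof -
  let ?F = "tensor_free K A B n m"
  interpret Q: module_quotient K ?F "tensor_rels K A B n m"
    by (rule module_quotient_tensor)
  have gen: "free_gen K p \<in> carrier ?F" if "p \<in> idx n m" for p
    using that by (rule A.R.free_gen_closed)
  have rel: "Q.proj x = Q.proj y"
    if "x \<in> carrier ?F" "y \<in> carrier ?F" "x \<ominus>\<^bsub>?F\<^esub> y \<in> multilinear_rels K A B n m" for x y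
  proof -
    have "x \<ominus>\<^bsub>?F\<^esub> y \<in> tensor_rels K A B n m"
      unfolding tensor_rels_def using that(3) by (rule span_module_superset[THEN subsetD])
    then show ?thesis
      using that(1,2) by (simp add: Q.proj_eq_iff)
  qed
  note idx = tensor_index_update[OF ab] and te = elem_tensor_eq[where n = n and m = m]
  show "linear_map K A (T n m) (\<lambda>x. t (as[i := x]) bs)" if i: "i < n"
  proof (rule linear_mapI[OF A.module module_T])
    show "t (as[i := x]) bs \<in> carrier (T n m)" if "x \<in> carrier A" for x
      using idx that by (intro elem_tensor_closed)
    show "t (as[i := x \<oplus>\<^bsub>A\<^esub> y]) bs = t (as[i := x]) bs \<oplus>\<^bsub>T n m\<^esub> t (as[i := y]) bs"
      if xy: "x \<in> carrier A" "y \<in> carrier A" for x y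
    proof -
      have "Q.proj (free_gen K (as[i := x \<oplus>\<^bsub>A\<^esub> y], bs)) =
          Q.proj (free_gen K (as[i := x], bs) \<oplus>\<^bsub>?F\<^esub> free_gen K (as[i := y], bs))"
        using ab i xy
        by (intro rel) (auto simp: multilinear_rels_def Let_def intro!: gen idx)
      then show ?thesis
        using xy idx by (simp add: te tensor_module_def Q.proj_add gen)
    qed
    show "t (as[i := r \<odot>\<^bsub>A\<^esub> x]) bs = r \<odot>\<^bsub>T n m\<^esub> t (as[i := x]) bs"
      if xr: "r \<in> carrier K" "x \<in> carrier A" for r x
    proof -
      have "Q.proj (free_gen K (as[i := r \<odot>\<^bsub>A\<^esub> x], bs)) =
          Q.proj (r \<odot>\<^bsub>?F\<^esub> free_gen K (as[i := x], bs))"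
        using ab i xr
        by (intro rel) (auto simp: multilinear_rels_def Let_def intro!: gen idx)
      then show ?thesis
        using xr idx by (simp add: te tensor_module_def Q.proj_smult gen)
    qed
  qed
  show "linear_map K B (T n m) (\<lambda>x. t as (bs[j := x]))" if j: "j < m"
  proof (rule linear_mapI[OF B.module module_T])
    show "t as (bs[j := x]) \<in> carrier (T n m)" if "x \<in> carrier B" for x
      using idx that by (intro elem_tensor_closed)
    show "t as (bs[j := x \<oplus>\<^bsub>B\<^esub> y]) = t as (bs[j := x]) \<oplus>\<^bsub>T n m\<^esub> t as (bs[j := y])"
      if xy: "x \<in> carrier B" "y \<in> carrier B" for x y
    proof -
      have "Q.proj (free_gen K (as, bs[j := x \<oplus>\<^bsub>B\<^esub> y])) =
          Q.proj (free_gen K (as, bs[j := x]) \<oplus>\<^bsub>?F\<^esub> free_gen K (as, bs[j := y]))"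
        using ab j xy
        by (intro rel) (auto simp: multilinear_rels_def Let_def intro!: gen idx)
      then show ?thesis
        using xy idx by (simp add: te tensor_module_def Q.proj_add gen)
    qed
    show "t as (bs[j := r \<odot>\<^bsub>B\<^esub> x]) = r \<odot>\<^bsub>T n m\<^esub> t as (bs[j := x])"
      if xr: "r \<in> carrier K" "x \<in> carrier B" for r x
    proof -
      have "Q.proj (free_gen K (as, bs[j := r \<odot>\<^bsub>B\<^esub> x])) =
          Q.proj (r \<odot>\<^bsub>?F\<^esub> free_gen K (as, bs[j := x]))"
        using ab j xr
        by (intro rel) (auto simp: multilinear_rels_def Let_def intro!: gen idx)
      then show ?thesis
        using xr idx by (simp add: te tensor_module_def Q.proj_smult gen)
    qed
  qed
qed

text \<open>Linearity of \<open>f\<close> in each slot makes its linear extension vanish on the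
  generating relations, hence on their span, so that it descends to cosets. By definition
  \<open>tensor_lift\<close> is the descended map.\<close>

lemma tensor_lift:
  assumes M: "module K M" and f: "multilinear K A B n m M f"
  shows linear_map_tensor_lift: "linear_map K (T n m) M (tensor_lift K M f)"
    and tensor_lift_elem: "(as, bs) \<in> idx n m \<Longrightarrow> tensor_lift K M f (t as bs) = f (as, bs)"
proof -
  let ?F = "tensor_free K A B n m"
  interpret M: module K M by fact
  interpret Q: module_quotient K ?F "tensor_rels K A B n m"
    by (rule module_quotient_tensor)
  have fX: "f \<in> idx n m \<rightarrow> carrier M"
    using f by (simp add: multilinear_def)
  interpret L: linear_map K ?F M "free_lift K M f"
    using fX by (rule M.linear_map_free_lift)
  have gen: "free_gen K p \<in> carrier ?F" if "p \<in> idx n m" for p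
    using that by (rule A.R.free_gen_closed)
  have lift: "free_lift K M f (free_gen K p) = f p" if "p \<in> idx n m" for p
    using fX that by (rule M.free_lift_gen)
  have fc: "f p \<in> carrier M" if "p \<in> idx n m" for p
    using fX that by blast
  have "multilinear_rels K A B n m \<subseteq> a_kernel ?F M (free_lift K M f)"
  proof
    fix z assume z: "z \<in> multilinear_rels K A B n m"
    then have "free_lift K M f z = \<zero>\<^bsub>M\<^esub>"
    proof (cases rule: multilinear_rels_cases)
      case (add1 as bs i x y)
      interpret l: linear_map K A M "\<lambda>x. f (as[i := x], bs)"
        using multilinearD(2)[OF f add1(1,2)] .
      show ?thesis
        using add1 tensor_index_update[OF add1(1)]
        by (simp add: L.minus L.add gen lift l.add fc M.diff_self)
    next
      case (smult1 as bs i r x)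
      interpret l: linear_map K A M "\<lambda>x. f (as[i := x], bs)"
        using multilinearD(2)[OF f smult1(1,2)] .
      show ?thesis
        using smult1 tensor_index_update[OF smult1(1)]
        by (simp add: L.minus L.smult gen lift l.smult fc M.diff_self)
    next
      case (add2 as bs j x y)
      interpret l: linear_map K B M "\<lambda>x. f (as, bs[j := x])"
        using multilinearD(3)[OF f add2(1,2)] .
      show ?thesis
        using add2 tensor_index_update[OF add2(1)]
        by (simp add: L.minus L.add gen lift l.add fc M.diff_self)
    next
      case (smult2 as bs j r x)
      interpret l: linear_map K B M "\<lambda>x. f (as, bs[j := x])"
        using multilinearD(3)[OF f smult2(1,2)] .
      show ?thesis
        using smult2 tensor_index_update[OF smult2(1)]
        by (simp add: L.minus L.smult gen lift l.smult fc M.diff_self)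
    qed
    then show "z \<in> a_kernel ?F M (free_lift K M f)"
      using z multilinear_rels_subset by (auto simp: a_kernel_def')
  qed
  then have ker: "tensor_rels K A B n m \<subseteq> a_kernel ?F M (free_lift K M f)"
    unfolding tensor_rels_def by (intro span_module_least L.kernel_submodule)
  have eq: "tensor_lift K M f = Q.induced (free_lift K M f)"
    by (simp add: fun_eq_iff tensor_lift_def Q.induced_def free_lift_def)
  show "linear_map K (T n m) M (tensor_lift K M f)"
    unfolding eq tensor_module_def by (rule Q.linear_map_induced[OF L.linear_map_axioms ker])
  show "tensor_lift K M f (t as bs) = f (as, bs)" if "(as, bs) \<in> idx n m"
    using that
    by (simp add: eq elem_tensor_eq Q.induced_proj[OF L.linear_map_axioms ker] gen lift)
qed

text \<open>The preimage of \<open>P\<close> in the free module contains all free generators and is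
  therefore everything.\<close>

lemma tensor_submodule_eq:
  assumes P: "submodule P K (T n m)" and "\<And>as bs. (as, bs) \<in> idx n m \<Longrightarrow> t as bs \<in> P"
  shows "P = carrier (T n m)"
proof -
  let ?F = "tensor_free K A B n m"
  interpret Q: module_quotient K ?F "tensor_rels K A B n m"
    by (rule module_quotient_tensor)
  interpret p: linear_map K ?F "T n m" Q.proj
    unfolding tensor_module_def by (rule Q.linear_map_proj)
  have "submodule {x \<in> carrier ?F. Q.proj x \<in> P} K ?F"
    by (rule p.vimage_submodule[OF P])
  then have "{x \<in> carrier ?F. Q.proj x \<in> P} = carrier ?F"
    using assms(2)
    by (intro A.R.free_module_submodule_eq) (auto simp: A.R.free_gen_closed elem_tensor_eq)
  then have "carrier (T n m) \<subseteq> P"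
    unfolding tensor_module_def Q.carrier_quot by blast
  then show ?thesis
    using p.N.submoduleE(1)[OF P] by blast
qed

lemma one_index: "(replicate n \<one>\<^bsub>A\<^esub>, replicate m \<one>\<^bsub>B\<^esub>) \<in> idx n m"
  by (auto simp: tensor_index_def)

text \<open>Zero and negatives come from the scalar case, as 0 times the tensor of ones and as
  multiples by -1; so the elements satisfying \<open>P\<close> form a submodule.\<close>

lemma tensor_induct [consumes 1, case_names elem add smult]:
  assumes "z \<in> carrier (T n m)"
    and elem: "\<And>as bs. (as, bs) \<in> idx n m \<Longrightarrow> P (t as bs)"
    and add: "\<And>x y. \<lbrakk>x \<in> carrier (T n m); y \<in> carrier (T n m); P x; P y\<rbrakk> \<Longrightarrow> P (x \<oplus>\<^bsub>T n m\<^esub> y)"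
    and smult: "\<And>r x. \<lbrakk>r \<in> carrier K; x \<in> carrier (T n m); P x\<rbrakk> \<Longrightarrow> P (r \<odot>\<^bsub>T n m\<^esub> x)"
  shows "P z"
proof -
  interpret T: module K "T n m"
    by (rule module_T)
  let ?P = "{z \<in> carrier (T n m). P z}"
  have neg: "\<ominus>\<^bsub>T n m\<^esub> x = (\<ominus>\<^bsub>K\<^esub> \<one>\<^bsub>K\<^esub>) \<odot>\<^bsub>T n m\<^esub> x" if "x \<in> carrier (T n m)" for x
    using that by (simp add: T.smult_l_minus)
  have zero: "P \<zero>\<^bsub>T n m\<^esub>"
    using smult[OF _ elem_tensor_closed[OF one_index] elem[OF one_index], of "\<zero>\<^bsub>K\<^esub>"]
    by (simp add: elem_tensor_closed one_index)
  have "submodule ?P K (T n m)"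
    by (rule T.submoduleI) (auto simp: neg intro: zero add smult)
  then have "?P = carrier (T n m)"
    using elem elem_tensor_closed by (intro tensor_submodule_eq) auto
  then show ?thesis
    using assms(1) by blast
qed

lemma tensor_ext:
  assumes "linear_map K (T n m) M f" "linear_map K (T n m) M g" "z \<in> carrier (T n m)"
    and "\<And>as bs. (as, bs) \<in> idx n m \<Longrightarrow> f (t as bs) = g (t as bs)"
  shows "f z = g z"
proof -
  interpret f: linear_map K "T n m" M f by fact
  interpret g: linear_map K "T n m" M g by fact
  show ?thesis
    using assms(3) by (induction rule: tensor_induct) (simp_all add: assms(4) f.add g.add f.smult g.smult)
qed

text \<open>Sums and scalar multiples of linear maps are linear, so linearity in the parameter
  \<open>x\<close> spreads from elementary tensors to every \<open>z\<close>. This supplies the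
  second variable of the bilinear product.\<close>

lemma linear_map_parameter:
  assumes "module K M" "module K N"
    and g: "\<And>x. x \<in> carrier M \<Longrightarrow> linear_map K (T n m) N (g x)"
    and elem: "\<And>as bs. (as, bs) \<in> idx n m \<Longrightarrow> linear_map K M N (\<lambda>x. g x (t as bs))"
    and "z \<in> carrier (T n m)"
  shows "linear_map K M N (\<lambda>x. g x z)"
  using assms(5)
proof (induction rule: tensor_induct)
  case (elem as bs)
  then show ?case by (rule assms(4))
next
  case (add y z)
  show ?case
    using add linear_map.add[OF g]
    by (intro linear_map_cong[OF linear_map_add[OF add(3,4)]]) auto
next
  case (smult r z)
  show ?case
    using smult linear_map.smult[OF g]
    by (intro linear_map_cong[OF linear_map_comp[OF smult(3) module.linear_map_smult[OF assms(2) smult(1)]]])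
      auto
qed

end

section \<open>The tensor algebra\<close>

context algebra_pair
begin

lemma map2_index:
  assumes "(as, bs) \<in> idx n m" "(as', bs') \<in> idx n m"
  shows "(map2 (mult A) as as', map2 (mult B) bs bs') \<in> idx n m"
  using assms by (auto simp: tensor_index_def set_zip subset_iff)

lemma map2_update:
  assumes "length xs = length ys" "i < length xs"
  shows "map2 f (xs[i := x]) ys = (map2 f xs ys)[i := f x (ys ! i)]"
    and "map2 f ys (xs[i := x]) = (map2 f ys xs)[i := f (ys ! i) x]"
  using assms by (auto intro!: nth_equalityI simp: nth_list_update)

lemma linear_map_mult_A:
  assumes "a \<in> carrier A"
  shows "linear_map K A A (\<lambda>x. x \<otimes>\<^bsub>A\<^esub> a)" "linear_map K A A (\<lambda>x. a \<otimes>\<^bsub>A\<^esub> x)"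
proof -
  show *: "linear_map K A A (\<lambda>x. x \<otimes>\<^bsub>A\<^esub> a)"
    using assms by (intro linear_mapI[OF A.module A.module]) (auto simp: A.l_distr A.smult_assoc2)
  show "linear_map K A A (\<lambda>x. a \<otimes>\<^bsub>A\<^esub> x)"
    using assms by (intro linear_map_cong[OF *]) (auto simp: A.m_comm)
qed

lemma linear_map_mult_B:
  assumes "a \<in> carrier B"
  shows "linear_map K B B (\<lambda>x. x \<otimes>\<^bsub>B\<^esub> a)" "linear_map K B B (\<lambda>x. a \<otimes>\<^bsub>B\<^esub> x)"
proof -
  show *: "linear_map K B B (\<lambda>x. x \<otimes>\<^bsub>B\<^esub> a)"
    using assms by (intro linear_mapI[OF B.module B.module]) (auto simp: B.l_distr B.smult_assoc2)
  show "linear_map K B B (\<lambda>x. a \<otimes>\<^bsub>B\<^esub> x)"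
    using assms by (intro linear_map_cong[OF *]) (auto simp: B.m_comm)
qed

text \<open>By \<open>map2_update\<close>, varying one entry of a factor is multiplication by the
  opposite entry of the other factor, followed by the corresponding slot map of the product
  tensor.\<close>

lemma elem_mult_linear:
  assumes ab: "(as, bs) \<in> idx n m" and ab': "(as', bs') \<in> idx n m"
  shows "i < n \<Longrightarrow>
      linear_map K A (T n m) (\<lambda>x. t (map2 (mult A) as (as'[i := x])) (map2 (mult B) bs bs'))"
    and "i < n \<Longrightarrow>
      linear_map K A (T n m) (\<lambda>x. t (map2 (mult A) (as[i := x]) as') (map2 (mult B) bs bs'))"
    and "j < m \<Longrightarrow>
      linear_map K B (T n m) (\<lambda>x. t (map2 (mult A) as as') (map2 (mult B) bs (bs'[j := x])))"
    and "j < m \<Longrightarrow>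
      linear_map K B (T n m) (\<lambda>x. t (map2 (mult A) as as') (map2 (mult B) (bs[j := x]) bs'))"
proof -
  have len: "length as = n" "length as' = n" "length bs = m" "length bs' = m"
    and sub: "set as \<subseteq> carrier A" "set as' \<subseteq> carrier A" "set bs \<subseteq> carrier B" "set bs' \<subseteq> carrier B"
    using ab ab' by (auto simp: tensor_index_def)
  have nth: "i < n \<Longrightarrow> as ! i \<in> carrier A" "i < n \<Longrightarrow> as' ! i \<in> carrier A"
    "j < m \<Longrightarrow> bs ! j \<in> carrier B" "j < m \<Longrightarrow> bs' ! j \<in> carrier B"
    using len sub by (auto simp: subset_iff)
  note lin = elem_tensor_linear[OF map2_index[OF ab ab']]
  show "i < n \<Longrightarrow>
      linear_map K A (T n m) (\<lambda>x. t (map2 (mult A) as (as'[i := x])) (map2 (mult B) bs bs'))"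
    "i < n \<Longrightarrow>
      linear_map K A (T n m) (\<lambda>x. t (map2 (mult A) (as[i := x]) as') (map2 (mult B) bs bs'))"
    "j < m \<Longrightarrow>
      linear_map K B (T n m) (\<lambda>x. t (map2 (mult A) as as') (map2 (mult B) bs (bs'[j := x])))"
    "j < m \<Longrightarrow>
      linear_map K B (T n m) (\<lambda>x. t (map2 (mult A) as as') (map2 (mult B) (bs[j := x]) bs'))"
    using linear_map_comp[OF linear_map_mult_A(1)[OF nth(2)] lin(1)]
      linear_map_comp[OF linear_map_mult_A(2)[OF nth(1)] lin(1)]
      linear_map_comp[OF linear_map_mult_B(1)[OF nth(4)] lin(2)]
      linear_map_comp[OF linear_map_mult_B(2)[OF nth(3)] lin(2)]
    by (simp_all add: map2_update len)
qed

text \<open>The inner of the two nested lifts in \<open>tensor_mult\<close>, isolated so that each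
  lift can be justified separately.\<close>

definition elem_lmult :: "nat \<Rightarrow> nat \<Rightarrow> 'a list \<times> 'b list \<Rightarrow> ('k, 'a, 'b) tensor \<Rightarrow> ('k, 'a, 'b) tensor"
  where "elem_lmult n m = (\<lambda>(as, bs). tensor_lift K (T n m)
    (\<lambda>(as', bs'). t (map2 (mult A) as as') (map2 (mult B) bs bs')))"

lemma elem_lmult:
  assumes "(as, bs) \<in> idx n m"
  shows linear_map_elem_lmult: "linear_map K (T n m) (T n m) (elem_lmult n m (as, bs))"
    and elem_lmult_elem: "(as', bs') \<in> idx n m \<Longrightarrow>
      elem_lmult n m (as, bs) (t as' bs') = t (map2 (mult A) as as') (map2 (mult B) bs bs')"
proof -
  have "multilinear K A B n m (T n m) (\<lambda>(as', bs'). t (map2 (mult A) as as') (map2 (mult B) bs bs'))"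
    using assms by (intro multilinearI) (auto intro: elem_tensor_closed map2_index elem_mult_linear)
  note lift = tensor_lift[OF module_T this]
  show "linear_map K (T n m) (T n m) (elem_lmult n m (as, bs))"
    using lift(1) by (simp add: elem_lmult_def)
  show "elem_lmult n m (as, bs) (t as' bs') = t (map2 (mult A) as as') (map2 (mult B) bs bs')"
    if "(as', bs') \<in> idx n m"
    using lift(2)[OF that] by (simp add: elem_lmult_def)
qed

lemma tensor_mult_eq:
  "tensor_mult K A B n m x y = tensor_lift K (T n m) (\<lambda>p. elem_lmult n m p y) x"
  by (simp add: tensor_mult_def elem_lmult_def case_prod_unfold)

text \<open>For elementary \<open>y\<close> this is \<open>elem_mult_linear\<close>;
  \<open>linear_map_parameter\<close> extends it to all \<open>y\<close>. It is what makes the outer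
  lift of \<open>tensor_mult\<close> legitimate.\<close>

lemma multilinear_elem_lmult:
  assumes "y \<in> carrier (T n m)"
  shows "multilinear K A B n m (T n m) (\<lambda>p. elem_lmult n m p y)"
proof (rule multilinearI)
  fix as bs assume ab: "(as, bs) \<in> idx n m"
  show "elem_lmult n m (as, bs) y \<in> carrier (T n m)"
    using linear_map.closed[OF linear_map_elem_lmult[OF ab] assms] .
  note upd = tensor_index_update[OF ab]
  show "linear_map K A (T n m) (\<lambda>x. elem_lmult n m (as[i := x], bs) y)" if "i < n" for i
  proof (rule linear_map_parameter[OF A.module module_T _ _ assms])
    show "linear_map K (T n m) (T n m) (elem_lmult n m (as[i := x], bs))" if "x \<in> carrier A" for x
      using that by (intro linear_map_elem_lmult upd)
    show "linear_map K A (T n m) (\<lambda>x. elem_lmult n m (as[i := x], bs) (t as' bs'))"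
      if "(as', bs') \<in> idx n m" for as' bs'
      using \<open>i < n\<close> that
      by (intro linear_map_cong[OF elem_mult_linear(2)[OF ab that]]) (simp_all add: elem_lmult_elem upd)
  qed
  show "linear_map K B (T n m) (\<lambda>x. elem_lmult n m (as, bs[j := x]) y)" if "j < m" for j
  proof (rule linear_map_parameter[OF B.module module_T _ _ assms])
    show "linear_map K (T n m) (T n m) (elem_lmult n m (as, bs[j := x]))" if "x \<in> carrier B" for x
      using that by (intro linear_map_elem_lmult upd)
    show "linear_map K B (T n m) (\<lambda>x. elem_lmult n m (as, bs[j := x]) (t as' bs'))"
      if "(as', bs') \<in> idx n m" for as' bs'
      using \<open>j < m\<close> that
      by (intro linear_map_cong[OF elem_mult_linear(4)[OF ab that]]) (simp_all add: elem_lmult_elem upd)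
  qed
qed

lemma linear_map_tensor_mult_left:
  assumes "y \<in> carrier (T n m)"
  shows "linear_map K (T n m) (T n m) (\<lambda>x. tensor_mult K A B n m x y)"
  unfolding tensor_mult_eq
  by (rule linear_map_tensor_lift[OF module_T multilinear_elem_lmult[OF assms]])

lemma tensor_mult_elem_left:
  assumes "(as, bs) \<in> idx n m" "y \<in> carrier (T n m)"
  shows "tensor_mult K A B n m (t as bs) y = elem_lmult n m (as, bs) y"
  unfolding tensor_mult_eq
  by (rule tensor_lift_elem[OF module_T multilinear_elem_lmult[OF assms(2)] assms(1)])

lemma tensor_mult_elem:
  assumes "(as, bs) \<in> idx n m" "(as', bs') \<in> idx n m"
  shows "tensor_mult K A B n m (t as bs) (t as' bs') = t (map2 (mult A) as as') (map2 (mult B) bs bs')"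
  using assms by (simp add: tensor_mult_elem_left elem_tensor_closed elem_lmult_elem)

text \<open>The outer lift gives linearity on the left only. On the right, an elementary left factor
  acts by the linear map \<open>elem_lmult\<close>, and \<open>linear_map_parameter\<close> does the
  rest.\<close>

lemma linear_map_tensor_mult_right:
  assumes "x \<in> carrier (T n m)"
  shows "linear_map K (T n m) (T n m) (\<lambda>y. tensor_mult K A B n m x y)"
  by (rule linear_map_parameter[OF module_T module_T _ _ assms])
    (auto intro: linear_map_tensor_mult_left
      intro!: linear_map_cong[OF linear_map_elem_lmult tensor_mult_elem_left])

text \<open>Both sides are linear in each argument, so the arguments become elementary one after the
  other, and the claim is commutativity of the entries. Associativity follows the same pattern with
  three arguments.\<close>

lemma tensor_mult_comm:
  assumes x: "x \<in> carrier (T n m)" and y: "y \<in> carrier (T n m)"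
  shows "tensor_mult K A B n m x y = tensor_mult K A B n m y x"
proof (rule tensor_ext[OF linear_map_tensor_mult_left[OF y] linear_map_tensor_mult_right[OF y] x])
  fix as bs assume ab: "(as, bs) \<in> idx n m"
  note c = elem_tensor_closed[OF ab]
  show "tensor_mult K A B n m (t as bs) y = tensor_mult K A B n m y (t as bs)"
  proof (rule tensor_ext[OF linear_map_tensor_mult_right[OF c] linear_map_tensor_mult_left[OF c] y])
    fix as' bs' assume ab': "(as', bs') \<in> idx n m"
    have "map2 (mult A) as as' = map2 (mult A) as' as" "map2 (mult B) bs bs' = map2 (mult B) bs' bs"
      using ab ab'
      by (auto intro!: nth_equalityI A.m_comm B.m_comm simp: tensor_index_def subset_iff)
    then show "tensor_mult K A B n m (t as bs) (t as' bs') = tensor_mult K A B n m (t as' bs') (t as bs)"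
      using ab ab' by (simp add: tensor_mult_elem)
  qed
qed

lemma tensor_mult_closed:
  "\<lbrakk>x \<in> carrier (T n m); y \<in> carrier (T n m)\<rbrakk> \<Longrightarrow> tensor_mult K A B n m x y \<in> carrier (T n m)"
  using linear_map.closed[OF linear_map_tensor_mult_left] .

lemma tensor_mult_assoc:
  assumes x: "x \<in> carrier (T n m)" and y: "y \<in> carrier (T n m)" and z: "z \<in> carrier (T n m)"
  shows "tensor_mult K A B n m (tensor_mult K A B n m x y) z =
    tensor_mult K A B n m x (tensor_mult K A B n m y z)"
proof (rule tensor_ext[OF linear_map_comp[OF linear_map_tensor_mult_left[OF y]
        linear_map_tensor_mult_left[OF z]]
      linear_map_tensor_mult_left[OF tensor_mult_closed[OF y z]] x])
  fix as bs assume ab: "(as, bs) \<in> idx n m"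
  note c = elem_tensor_closed[OF ab]
  show "tensor_mult K A B n m (tensor_mult K A B n m (t as bs) y) z =
      tensor_mult K A B n m (t as bs) (tensor_mult K A B n m y z)"
  proof (rule tensor_ext[OF linear_map_comp[OF linear_map_tensor_mult_right[OF c]
          linear_map_tensor_mult_left[OF z]]
        linear_map_comp[OF linear_map_tensor_mult_left[OF z] linear_map_tensor_mult_right[OF c]] y])
    fix as' bs' assume ab': "(as', bs') \<in> idx n m"
    note c' = elem_tensor_closed[OF ab']
    show "tensor_mult K A B n m (tensor_mult K A B n m (t as bs) (t as' bs')) z =
        tensor_mult K A B n m (t as bs) (tensor_mult K A B n m (t as' bs') z)"
    proof (rule tensor_ext[OF linear_map_tensor_mult_right[OF tensor_mult_closed[OF c c']]
          linear_map_comp[OF linear_map_tensor_mult_right[OF c'] linear_map_tensor_mult_right[OF c]] z])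
      fix as'' bs'' assume ab'': "(as'', bs'') \<in> idx n m"
      have "map2 (mult A) (map2 (mult A) as as') as'' = map2 (mult A) as (map2 (mult A) as' as'')"
        "map2 (mult B) (map2 (mult B) bs bs') bs'' = map2 (mult B) bs (map2 (mult B) bs' bs'')"
        using ab ab' ab''
        by (auto intro!: nth_equalityI A.m_assoc B.m_assoc simp: tensor_index_def subset_iff)
      then show "tensor_mult K A B n m (tensor_mult K A B n m (t as bs) (t as' bs')) (t as'' bs'') =
          tensor_mult K A B n m (t as bs) (tensor_mult K A B n m (t as' bs') (t as'' bs''))"
        using ab ab' ab'' by (simp add: tensor_mult_elem map2_index)
    qed
  qed
qed

lemma tensor_mult_one:
  assumes x: "x \<in> carrier (T n m)"
  shows "tensor_mult K A B n m (t (replicate n \<one>\<^bsub>A\<^esub>) (replicate m \<one>\<^bsub>B\<^esub>)) x = x"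
proof (rule tensor_ext[OF linear_map_tensor_mult_right module.linear_map_id[OF module_T] x])
  show "t (replicate n \<one>\<^bsub>A\<^esub>) (replicate m \<one>\<^bsub>B\<^esub>) \<in> carrier (T n m)"
    by (intro elem_tensor_closed one_index)
  fix as bs assume ab: "(as, bs) \<in> idx n m"
  have "map2 (mult A) (replicate n \<one>\<^bsub>A\<^esub>) as = as" "map2 (mult B) (replicate m \<one>\<^bsub>B\<^esub>) bs = bs"
    using ab by (auto intro!: nth_equalityI A.l_one B.l_one simp: tensor_index_def subset_iff)
  then show "tensor_mult K A B n m (t (replicate n \<one>\<^bsub>A\<^esub>) (replicate m \<one>\<^bsub>B\<^esub>)) (t as bs) = t as bs"
    using tensor_mult_elem[OF one_index ab] by simp
qed

text \<open>Provides the commutative ring in which ideals, products of ideals and ring identities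
  are used for the quotient of \<open>J_ideal\<close>.\<close>

lemma algebra_tensor_algebra: "algebra K (tensor_algebra K A B n m)"
proof -
  interpret T: module K "T n m"
    by (rule module_T)
  have "cring (tensor_algebra K A B n m)"
  proof (rule cringI)
    show "abelian_group (tensor_algebra K A B n m)"
      by (rule abelian_groupI) (auto simp: T.add.m_ac intro: bexI[of _ "\<ominus>\<^bsub>T n m\<^esub> x" for x] T.l_neg)
    show "Group.comm_monoid (tensor_algebra K A B n m)"
      by (rule comm_monoidI)
        (simp_all add: tensor_mult_assoc tensor_mult_one tensor_mult_closed elem_tensor_closed
          one_index, rule tensor_mult_comm)
    fix x y z
    assume "x \<in> carrier (tensor_algebra K A B n m)" "y \<in> carrier (tensor_algebra K A B n m)"
      "z \<in> carrier (tensor_algebra K A B n m)"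
    then show "(x \<oplus>\<^bsub>tensor_algebra K A B n m\<^esub> y) \<otimes>\<^bsub>tensor_algebra K A B n m\<^esub> z =
        x \<otimes>\<^bsub>tensor_algebra K A B n m\<^esub> z \<oplus>\<^bsub>tensor_algebra K A B n m\<^esub>
        y \<otimes>\<^bsub>tensor_algebra K A B n m\<^esub> z"
      using linear_map.add[OF linear_map_tensor_mult_left] by simp
  qed
  then show ?thesis
    using linear_map.smult[OF linear_map_tensor_mult_left]
    by (intro algebraI A.R.is_cring)
      (simp_all add: T.smult_l_distr T.smult_r_distr T.smult_assoc1)
qed

end

section \<open>Low-degree tensors of a commutative triple\<close>

text \<open>Otherwise the indices of \<open>T 1 1\<close> and \<open>T 2 1\<close> are rewritten to \<open>Suc 0\<close>.\<close>

declare One_nat_def [simp del]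

lemma tensor_lift_tensor_algebra [simp]:
  "tensor_lift K (tensor_algebra K A B n m) = tensor_lift K (tensor_module K A B n m)"
  by (simp add: fun_eq_iff tensor_lift_def)

lemma (in algebra_pair) idx_iff [simp]:
  "([a], [\<alpha>]) \<in> idx 1 1 \<longleftrightarrow> a \<in> carrier A \<and> \<alpha> \<in> carrier B"
  "([a, b], [\<alpha>]) \<in> idx 2 1 \<longleftrightarrow> a \<in> carrier A \<and> b \<in> carrier A \<and> \<alpha> \<in> carrier B"
  "([a, b, c], [\<alpha>, \<beta>, \<gamma>]) \<in> idx 3 3 \<longleftrightarrow> a \<in> carrier A \<and> b \<in> carrier A \<and> c \<in> carrier A \<and>
    \<alpha> \<in> carrier B \<and> \<beta> \<in> carrier B \<and> \<gamma> \<in> carrier B"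
  by (auto simp: tensor_index_def One_nat_def)

lemma (in algebra_pair) idx11_cases:
  assumes "(as, bs) \<in> idx 1 1"
  obtains a \<alpha> where "as = [a]" "bs = [\<alpha>]" "a \<in> carrier A" "\<alpha> \<in> carrier B"
  using assms by (auto simp: tensor_index_def One_nat_def length_Suc_conv)

lemma (in algebra_pair) idx21_cases:
  assumes "(as, bs) \<in> idx 2 1"
  obtains a b \<alpha> where "as = [a, b]" "bs = [\<alpha>]" "a \<in> carrier A" "b \<in> carrier A" "\<alpha> \<in> carrier B"
  using assms by (auto simp: tensor_index_def One_nat_def numeral_2_eq_2 length_Suc_conv)

lemma (in algebra_pair) idx33_cases:
  assumes "(as, bs) \<in> idx 3 3"
  obtains a b c \<alpha> \<beta> \<gamma> where "as = [a, b, c]" "bs = [\<alpha>, \<beta>, \<gamma>]"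
    "a \<in> carrier A" "b \<in> carrier A" "c \<in> carrier A"
    "\<alpha> \<in> carrier B" "\<beta> \<in> carrier B" "\<gamma> \<in> carrier B"
  using assms by (auto simp: tensor_index_def numeral_3_eq_3 length_Suc_conv)

section \<open>Multilinearity in low degrees\<close>

lemma (in algebra_pair) multilinear11I:
  assumes "\<And>\<alpha>. \<alpha> \<in> carrier B \<Longrightarrow> linear_map K A M (\<lambda>x. f ([x], [\<alpha>]))"
    and "\<And>a. a \<in> carrier A \<Longrightarrow> linear_map K B M (\<lambda>x. f ([a], [x]))"
  shows "multilinear K A B 1 1 M f"
proof (rule multilinearI)
  fix as bs assume "(as, bs) \<in> idx 1 1"
  then obtain a \<alpha> where ab: "as = [a]" "bs = [\<alpha>]" "a \<in> carrier A" "\<alpha> \<in> carrier B"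
    by (rule idx11_cases)
  then show "f (as, bs) \<in> carrier M"
    using linear_map.closed[OF assms(1)] by simp
  show "linear_map K A M (\<lambda>x. f (as[i := x], bs))" if "i < 1" for i
    using that ab assms(1) by simp
  show "linear_map K B M (\<lambda>x. f (as, bs[j := x]))" if "j < 1" for j
    using that ab assms(2) by simp
qed

lemma (in algebra_pair) multilinear21I:
  assumes "\<And>b \<alpha>. \<lbrakk>b \<in> carrier A; \<alpha> \<in> carrier B\<rbrakk> \<Longrightarrow> linear_map K A M (\<lambda>x. f ([x, b], [\<alpha>]))"
    and "\<And>a \<alpha>. \<lbrakk>a \<in> carrier A; \<alpha> \<in> carrier B\<rbrakk> \<Longrightarrow> linear_map K A M (\<lambda>x. f ([a, x], [\<alpha>]))"
    and "\<And>a b. \<lbrakk>a \<in> carrier A; b \<in> carrier A\<rbrakk> \<Longrightarrow> linear_map K B M (\<lambda>x. f ([a, b], [x]))"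
  shows "multilinear K A B 2 1 M f"
proof (rule multilinearI)
  fix as bs assume "(as, bs) \<in> idx 2 1"
  then obtain a b \<alpha> where ab: "as = [a, b]" "bs = [\<alpha>]"
    "a \<in> carrier A" "b \<in> carrier A" "\<alpha> \<in> carrier B"
    by (rule idx21_cases)
  then show "f (as, bs) \<in> carrier M"
    using linear_map.closed[OF assms(1)] by simp
  show "linear_map K A M (\<lambda>x. f (as[i := x], bs))" if "i < 2" for i
    using that ab assms(1,2) by (auto simp: less_2_cases_iff One_nat_def)
  show "linear_map K B M (\<lambda>x. f (as, bs[j := x]))" if "j < 1" for j
    using that ab assms(3) by simp
qed

lemma (in algebra_pair) multilinear33I:
  assumes "\<And>a b c \<alpha> \<beta> \<gamma>. \<lbrakk>a \<in> carrier A; b \<in> carrier A; c \<in> carrier A;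
      \<alpha> \<in> carrier B; \<beta> \<in> carrier B; \<gamma> \<in> carrier B\<rbrakk> \<Longrightarrow>
      linear_map K A M (\<lambda>x. f ([x, b, c], [\<alpha>, \<beta>, \<gamma>])) \<and>
      linear_map K A M (\<lambda>x. f ([a, x, c], [\<alpha>, \<beta>, \<gamma>])) \<and>
      linear_map K A M (\<lambda>x. f ([a, b, x], [\<alpha>, \<beta>, \<gamma>])) \<and>
      linear_map K B M (\<lambda>x. f ([a, b, c], [x, \<beta>, \<gamma>])) \<and>
      linear_map K B M (\<lambda>x. f ([a, b, c], [\<alpha>, x, \<gamma>])) \<and>
      linear_map K B M (\<lambda>x. f ([a, b, c], [\<alpha>, \<beta>, x]))"
  shows "multilinear K A B 3 3 M f"
proof (rule multilinearI)
  fix as bs assume "(as, bs) \<in> idx 3 3"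
  then obtain a b c \<alpha> \<beta> \<gamma> where ab: "as = [a, b, c]" "bs = [\<alpha>, \<beta>, \<gamma>]"
    and carr: "a \<in> carrier A" "b \<in> carrier A" "c \<in> carrier A"
      "\<alpha> \<in> carrier B" "\<beta> \<in> carrier B" "\<gamma> \<in> carrier B"
    by (rule idx33_cases)
  note lin = assms[OF carr]
  show "f (as, bs) \<in> carrier M"
    using linear_map.closed[OF conjunct1[OF lin] carr(1)] ab by simp
  show "linear_map K A M (\<lambda>x. f (as[i := x], bs))" if "i < 3" for i
    using that ab lin by (auto simp: numeral_3_eq_3 less_Suc_eq)
  show "linear_map K B M (\<lambda>x. f (as, bs[j := x]))" if "j < 3" for j
    using that ab lin by (auto simp: numeral_3_eq_3 less_Suc_eq)
qed

text \<open>For u = 1 \<otimes> a \<otimes> \<alpha> and v = 1 \<otimes> b \<otimes> \<beta>, with p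
  and q their products moved into the first factor, the failure of the Leibniz rule becomes a
  product of two elements of the kernel of multiplication.\<close>

lemma (in cring) product_defect:
  assumes "u \<in> carrier R" "v \<in> carrier R" "p \<in> carrier R" "q \<in> carrier R"
  shows "(u \<otimes> v \<ominus> p \<otimes> q) \<ominus> (p \<otimes> (v \<ominus> q) \<oplus> q \<otimes> (u \<ominus> p)) = (u \<ominus> p) \<otimes> (v \<ominus> q)"
  using assms by algebra

text \<open>For w = 1 \<otimes> 1 \<otimes> \<alpha>, s = \<epsilon>(\<alpha>) \<otimes> 1 \<otimes>
  1 and e = 1 \<otimes> \<epsilon>(\<alpha>) \<otimes> 1, the failure of relation (iii) is exactly
  \<open>J_hat_elem\<close>.\<close>

lemma (in cring) double_defect:
  assumes "w \<in> carrier R" "s \<in> carrier R" "e \<in> carrier R"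
  shows "(w \<ominus> s \<oplus> (w \<ominus> s)) \<ominus> (e \<ominus> s) = w \<ominus> s \<oplus> w \<ominus> e"
  using assms by algebra

locale commutative_triple = algebra_pair K A B
  for K :: "'k ring" and A :: "('k, 'a) module" and B :: "('k, 'b) module" +
  fixes \<epsilon> :: "'b \<Rightarrow> 'a"
  assumes eps: "\<epsilon> \<in> algebra_hom K B A"
begin

lemma eps_simps [simp]:
  "\<alpha> \<in> carrier B \<Longrightarrow> \<epsilon> \<alpha> \<in> carrier A"
  "\<lbrakk>\<alpha> \<in> carrier B; \<beta> \<in> carrier B\<rbrakk> \<Longrightarrow> \<epsilon> (\<alpha> \<oplus>\<^bsub>B\<^esub> \<beta>) = \<epsilon> \<alpha> \<oplus>\<^bsub>A\<^esub> \<epsilon> \<beta>"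
  "\<lbrakk>\<alpha> \<in> carrier B; \<beta> \<in> carrier B\<rbrakk> \<Longrightarrow> \<epsilon> (\<alpha> \<otimes>\<^bsub>B\<^esub> \<beta>) = \<epsilon> \<alpha> \<otimes>\<^bsub>A\<^esub> \<epsilon> \<beta>"
  "\<epsilon> \<one>\<^bsub>B\<^esub> = \<one>\<^bsub>A\<^esub>"
  "\<lbrakk>r \<in> carrier K; \<alpha> \<in> carrier B\<rbrakk> \<Longrightarrow> \<epsilon> (r \<odot>\<^bsub>B\<^esub> \<alpha>) = r \<odot>\<^bsub>A\<^esub> \<epsilon> \<alpha>"
  using eps by (auto simp: algebra_hom_def ring_hom_def)

lemma smult_assoc_A [simp]:
  "\<lbrakk>r \<in> carrier K; x \<in> carrier A; y \<in> carrier A\<rbrakk> \<Longrightarrow> (r \<odot>\<^bsub>A\<^esub> x) \<otimes>\<^bsub>A\<^esub> y = r \<odot>\<^bsub>A\<^esub> (x \<otimes>\<^bsub>A\<^esub> y)"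
  "\<lbrakk>r \<in> carrier K; x \<in> carrier A; y \<in> carrier A\<rbrakk> \<Longrightarrow> x \<otimes>\<^bsub>A\<^esub> (r \<odot>\<^bsub>A\<^esub> y) = r \<odot>\<^bsub>A\<^esub> (x \<otimes>\<^bsub>A\<^esub> y)"
  using A.smult_assoc2[of r x y] A.smult_assoc2[of r y x] by (simp_all add: A.m_comm)

lemma smult_assoc_B [simp]:
  "\<lbrakk>r \<in> carrier K; x \<in> carrier B; y \<in> carrier B\<rbrakk> \<Longrightarrow> (r \<odot>\<^bsub>B\<^esub> x) \<otimes>\<^bsub>B\<^esub> y = r \<odot>\<^bsub>B\<^esub> (x \<otimes>\<^bsub>B\<^esub> y)"
  "\<lbrakk>r \<in> carrier K; x \<in> carrier B; y \<in> carrier B\<rbrakk> \<Longrightarrow> x \<otimes>\<^bsub>B\<^esub> (r \<odot>\<^bsub>B\<^esub> y) = r \<odot>\<^bsub>B\<^esub> (x \<otimes>\<^bsub>B\<^esub> y)"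
  using B.smult_assoc2[of r x y] B.smult_assoc2[of r y x] by (simp_all add: B.m_comm)

text \<open>The ones in the instantiated lists are placeholders that the list update
  overwrites.\<close>

lemma t11_linear:
  "\<alpha> \<in> carrier B \<Longrightarrow> linear_map K A (T 1 1) (\<lambda>x. t [x] [\<alpha>])"
  "a \<in> carrier A \<Longrightarrow> linear_map K B (T 1 1) (\<lambda>x. t [a] [x])"
  using elem_tensor_linear1[of "[\<one>\<^bsub>A\<^esub>]" "[\<alpha>]" 1 1 0] elem_tensor_linear2[of "[a]" "[\<one>\<^bsub>B\<^esub>]" 1 1 0]
  by simp_all

lemma t21_linear:
  "\<lbrakk>b \<in> carrier A; \<alpha> \<in> carrier B\<rbrakk> \<Longrightarrow> linear_map K A (T 2 1) (\<lambda>x. t [x, b] [\<alpha>])"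
  "\<lbrakk>a \<in> carrier A; \<alpha> \<in> carrier B\<rbrakk> \<Longrightarrow> linear_map K A (T 2 1) (\<lambda>x. t [a, x] [\<alpha>])"
  "\<lbrakk>a \<in> carrier A; b \<in> carrier A\<rbrakk> \<Longrightarrow> linear_map K B (T 2 1) (\<lambda>x. t [a, b] [x])"
  using elem_tensor_linear1[of "[\<one>\<^bsub>A\<^esub>, b]" "[\<alpha>]" 2 1 0]
    elem_tensor_linear1[of "[a, \<one>\<^bsub>A\<^esub>]" "[\<alpha>]" 2 1 "Suc 0"]
    elem_tensor_linear2[of "[a, b]" "[\<one>\<^bsub>B\<^esub>]" 2 1 0]
  by simp_all

lemma t_closed [simp]:
  "\<lbrakk>a \<in> carrier A; \<alpha> \<in> carrier B\<rbrakk> \<Longrightarrow> t [a] [\<alpha>] \<in> carrier (T 1 1)"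
  "\<lbrakk>a \<in> carrier A; b \<in> carrier A; \<alpha> \<in> carrier B\<rbrakk> \<Longrightarrow> t [a, b] [\<alpha>] \<in> carrier (T 2 1)"
  by (auto intro: elem_tensor_closed)

lemmas t21_add = t21_linear[THEN linear_map.add]
lemmas t21_smult = t21_linear[THEN linear_map.smult]

lemma mult11: "\<lbrakk>a \<in> carrier A; b \<in> carrier A; \<alpha> \<in> carrier B; \<beta> \<in> carrier B\<rbrakk> \<Longrightarrow>
    tensor_mult K A B 1 1 (t [a] [\<alpha>]) (t [b] [\<beta>]) = t [a \<otimes>\<^bsub>A\<^esub> b] [\<alpha> \<otimes>\<^bsub>B\<^esub> \<beta>]"
  by (simp add: tensor_mult_elem)

lemma mult21: "\<lbrakk>a \<in> carrier A; b \<in> carrier A; \<alpha> \<in> carrier B;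
    a' \<in> carrier A; b' \<in> carrier A; \<alpha>' \<in> carrier B\<rbrakk> \<Longrightarrow>
    tensor_mult K A B 2 1 (t [a, b] [\<alpha>]) (t [a', b'] [\<alpha>']) =
    t [a \<otimes>\<^bsub>A\<^esub> a', b \<otimes>\<^bsub>A\<^esub> b'] [\<alpha> \<otimes>\<^bsub>B\<^esub> \<alpha>']"
  by (simp add: tensor_mult_elem)

sublocale T21: module K "T 2 1"
  by (rule module_T)

sublocale T11: module K "T 1 1"
  by (rule module_T)

section \<open>The structure maps and the boundaries on elementary tensors\<close>

lemma linear_map_eps_mult:
  assumes "a \<in> carrier A"
  shows "linear_map K B A (\<lambda>\<alpha>. a \<otimes>\<^bsub>A\<^esub> \<epsilon> \<alpha>)"
  using assms by (intro linear_mapI[OF B.module A.module]) (simp_all add: A.r_distr)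

lemma scalar_map:
  shows linear_map_scalar_map: "linear_map K (T 1 1) A (scalar_map K A \<epsilon>)"
    and scalar_map_elem: "\<lbrakk>a \<in> carrier A; \<alpha> \<in> carrier B\<rbrakk> \<Longrightarrow>
      scalar_map K A \<epsilon> (t [a] [\<alpha>]) = a \<otimes>\<^bsub>A\<^esub> \<epsilon> \<alpha>"
proof -
  have "multilinear K A B 1 1 A (\<lambda>z. case z of ([a], [\<alpha>]) \<Rightarrow> a \<otimes>\<^bsub>A\<^esub> \<epsilon> \<alpha>)"
    by (rule multilinear11I) (simp_all add: linear_map_mult_A linear_map_eps_mult)
  note lift = tensor_lift[OF A.module this]
  show "linear_map K (T 1 1) A (scalar_map K A \<epsilon>)"
    unfolding scalar_map_def by (rule lift(1))
  show "scalar_map K A \<epsilon> (t [a] [\<alpha>]) = a \<otimes>\<^bsub>A\<^esub> \<epsilon> \<alpha>" if "a \<in> carrier A" "\<alpha> \<in> carrier B"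
    unfolding scalar_map_def using lift(2)[of "[a]" "[\<alpha>]"] that by simp
qed

lemma mult_map:
  shows linear_map_mult_map: "linear_map K (T 2 1) A (mult_map K A \<epsilon>)"
    and mult_map_elem: "\<lbrakk>a \<in> carrier A; b \<in> carrier A; \<alpha> \<in> carrier B\<rbrakk> \<Longrightarrow>
      mult_map K A \<epsilon> (t [a, b] [\<alpha>]) = a \<otimes>\<^bsub>A\<^esub> b \<otimes>\<^bsub>A\<^esub> \<epsilon> \<alpha>"
proof -
  have "multilinear K A B 2 1 A (\<lambda>z. case z of ([a, b], [\<alpha>]) \<Rightarrow> a \<otimes>\<^bsub>A\<^esub> b \<otimes>\<^bsub>A\<^esub> \<epsilon> \<alpha>)"
    by (rule multilinear21I; rule linear_mapI[OF A.module A.module] linear_mapI[OF B.module A.module])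
      (simp_all add: A.l_distr A.r_distr)
  note lift = tensor_lift[OF A.module this]
  show "linear_map K (T 2 1) A (mult_map K A \<epsilon>)"
    unfolding mult_map_def by (rule lift(1))
  show "mult_map K A \<epsilon> (t [a, b] [\<alpha>]) = a \<otimes>\<^bsub>A\<^esub> b \<otimes>\<^bsub>A\<^esub> \<epsilon> \<alpha>"
    if "a \<in> carrier A" "b \<in> carrier A" "\<alpha> \<in> carrier B"
    unfolding mult_map_def using lift(2)[of "[a, b]" "[\<alpha>]"] that by simp
qed

text \<open>By commutativity of \<open>A\<close> the two terms of the boundary cancel on elementary
  tensors. Every element is a cycle, so the homology is the cokernel of
  \<open>boundary2\<close>.\<close>

lemma kernel_boundary1: "a_kernel (tensor_algebra K A B 2 1) A (boundary1 K A \<epsilon>) = carrier (T 2 1)"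
proof -
  let ?f = "\<lambda>z. case z of ([a, b], [\<alpha>]) \<Rightarrow>
    (a \<otimes>\<^bsub>A\<^esub> \<epsilon> \<alpha> \<otimes>\<^bsub>A\<^esub> b) \<ominus>\<^bsub>A\<^esub> (b \<otimes>\<^bsub>A\<^esub> \<epsilon> \<alpha> \<otimes>\<^bsub>A\<^esub> a)"
  have "multilinear K A B 2 1 A ?f"
    by (rule multilinear21I; rule linear_mapI[OF A.module A.module] linear_mapI[OF B.module A.module])
      (simp_all add: A.m_ac A.diff_self)
  note lift = tensor_lift[OF A.module this]
  have zero: "linear_map K (T 2 1) A (\<lambda>z. \<zero>\<^bsub>A\<^esub>)"
    by (rule linear_mapI[OF module_T A.module]) simp_all
  have "boundary1 K A \<epsilon> z = \<zero>\<^bsub>A\<^esub>" if "z \<in> carrier (T 2 1)" for z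
    unfolding boundary1_def
  proof (rule tensor_ext[OF lift(1) zero that])
    fix as bs assume ab: "(as, bs) \<in> idx 2 1"
    show "tensor_lift K A ?f (t as bs) = \<zero>\<^bsub>A\<^esub>"
      unfolding lift(2)[OF ab] using ab
      by (rule idx21_cases) (simp add: A.m_ac A.diff_self)
  qed
  then show ?thesis
    by (auto simp: a_kernel_def')
qed

text \<open>Each of the six entries occurs exactly once in each of the three faces, so every face is
  linear in every slot.\<close>

lemma boundary2:
  shows linear_map_boundary2: "linear_map K (T 3 3) (T 2 1) (boundary2 K A B \<epsilon>)"
    and boundary2_elem: "\<lbrakk>a \<in> carrier A; b \<in> carrier A; c \<in> carrier A;
        \<alpha> \<in> carrier B; \<beta> \<in> carrier B; \<gamma> \<in> carrier B\<rbrakk> \<Longrightarrow>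
      boundary2 K A B \<epsilon> (t [a, b, c] [\<alpha>, \<beta>, \<gamma>]) =
      t [a \<otimes>\<^bsub>A\<^esub> \<epsilon> \<alpha> \<otimes>\<^bsub>A\<^esub> b, c] [\<beta> \<otimes>\<^bsub>B\<^esub> \<gamma>]
      \<ominus>\<^bsub>T 2 1\<^esub> t [a, b \<otimes>\<^bsub>A\<^esub> \<epsilon> \<gamma> \<otimes>\<^bsub>A\<^esub> c] [\<alpha> \<otimes>\<^bsub>B\<^esub> \<beta>]
      \<oplus>\<^bsub>T 2 1\<^esub> t [c \<otimes>\<^bsub>A\<^esub> \<epsilon> \<beta> \<otimes>\<^bsub>A\<^esub> a, b] [\<alpha> \<otimes>\<^bsub>B\<^esub> \<gamma>]"
proof -
  let ?f1 = "\<lambda>a b c \<alpha> \<beta> \<gamma>. t [a \<otimes>\<^bsub>A\<^esub> \<epsilon> \<alpha> \<otimes>\<^bsub>A\<^esub> b, c] [\<beta> \<otimes>\<^bsub>B\<^esub> \<gamma>]"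
  let ?f2 = "\<lambda>a b c \<alpha> \<beta> \<gamma>. t [a, b \<otimes>\<^bsub>A\<^esub> \<epsilon> \<gamma> \<otimes>\<^bsub>A\<^esub> c] [\<alpha> \<otimes>\<^bsub>B\<^esub> \<beta>]"
  let ?f3 = "\<lambda>a b c \<alpha> \<beta> \<gamma>. t [c \<otimes>\<^bsub>A\<^esub> \<epsilon> \<beta> \<otimes>\<^bsub>A\<^esub> a, b] [\<alpha> \<otimes>\<^bsub>B\<^esub> \<gamma>]"
  let ?lin = "\<lambda>f a b c \<alpha> \<beta> \<gamma>.
      linear_map K A (T 2 1) (\<lambda>x. f x b c \<alpha> \<beta> \<gamma>) \<and>
      linear_map K A (T 2 1) (\<lambda>x. f a x c \<alpha> \<beta> \<gamma>) \<and>
      linear_map K A (T 2 1) (\<lambda>x. f a b x \<alpha> \<beta> \<gamma>) \<and>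
      linear_map K B (T 2 1) (\<lambda>x. f a b c x \<beta> \<gamma>) \<and>
      linear_map K B (T 2 1) (\<lambda>x. f a b c \<alpha> x \<gamma>) \<and>
      linear_map K B (T 2 1) (\<lambda>x. f a b c \<alpha> \<beta> x)"
  note lin = linear_mapI[OF A.module module_T] linear_mapI[OF B.module module_T]
  have f1: "?lin ?f1 a b c \<alpha> \<beta> \<gamma>" and f2: "?lin ?f2 a b c \<alpha> \<beta> \<gamma>" and f3: "?lin ?f3 a b c \<alpha> \<beta> \<gamma>"
    if "a \<in> carrier A" "b \<in> carrier A" "c \<in> carrier A"
      "\<alpha> \<in> carrier B" "\<beta> \<in> carrier B" "\<gamma> \<in> carrier B" for a b c \<alpha> \<beta> \<gamma>
    using that
    by (intro conjI; intro lin;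
        simp add: A.l_distr A.r_distr B.l_distr B.r_distr t21_add t21_smult)+
  let ?f = "\<lambda>z. case z of ([a, b, c], [\<alpha>, \<beta>, \<gamma>]) \<Rightarrow>
    ?f1 a b c \<alpha> \<beta> \<gamma> \<ominus>\<^bsub>T 2 1\<^esub> ?f2 a b c \<alpha> \<beta> \<gamma> \<oplus>\<^bsub>T 2 1\<^esub> ?f3 a b c \<alpha> \<beta> \<gamma>"
  have "multilinear K A B 3 3 (T 2 1) ?f"
  proof (rule multilinear33I, goal_cases)
    case (1 a b c \<alpha> \<beta> \<gamma>)
    show ?case
      using f1[OF 1] f2[OF 1] f3[OF 1]
      by (elim conjE, intro conjI) (simp_all add: linear_map_add linear_map_minus)
  qed
  note lift = tensor_lift[OF module_T this]
  have eq: "boundary2 K A B \<epsilon> = tensor_lift K (T 2 1) ?f"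
    unfolding boundary2_def Let_def tensor_lift_tensor_algebra tensor_algebra_simps
      tensor_algebra_a_minus ..
  show "linear_map K (T 3 3) (T 2 1) (boundary2 K A B \<epsilon>)"
    unfolding eq by (rule lift(1))
  show "boundary2 K A B \<epsilon> (t [a, b, c] [\<alpha>, \<beta>, \<gamma>]) =
      ?f1 a b c \<alpha> \<beta> \<gamma> \<ominus>\<^bsub>T 2 1\<^esub> ?f2 a b c \<alpha> \<beta> \<gamma> \<oplus>\<^bsub>T 2 1\<^esub> ?f3 a b c \<alpha> \<beta> \<gamma>"
    if "a \<in> carrier A" "b \<in> carrier A" "c \<in> carrier A"
      "\<alpha> \<in> carrier B" "\<beta> \<in> carrier B" "\<gamma> \<in> carrier B"
    unfolding eq using lift(2)[of "[a, b, c]" "[\<alpha>, \<beta>, \<gamma>]"] that by simp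
qed

text \<open>The embedding of B \<otimes> A with first entry 1. Maps out of the differentials are
  built by sending \<open>d x\<close> to a class formed from \<open>incl x\<close>.\<close>

definition incl :: "('k, 'a, 'b) tensor \<Rightarrow> ('k, 'a, 'b) tensor"
  where "incl = tensor_lift K (T 2 1) (\<lambda>z. case z of ([b], [\<alpha>]) \<Rightarrow> t [\<one>\<^bsub>A\<^esub>, b] [\<alpha>])"

lemma incl:
  shows linear_map_incl: "linear_map K (T 1 1) (T 2 1) incl"
    and incl_elem: "\<lbrakk>b \<in> carrier A; \<alpha> \<in> carrier B\<rbrakk> \<Longrightarrow> incl (t [b] [\<alpha>]) = t [\<one>\<^bsub>A\<^esub>, b] [\<alpha>]"
proof -
  have "multilinear K A B 1 1 (T 2 1) (\<lambda>z. case z of ([b], [\<alpha>]) \<Rightarrow> t [\<one>\<^bsub>A\<^esub>, b] [\<alpha>])"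
    by (rule multilinear11I) (simp_all add: t21_linear)
  note lift = tensor_lift[OF module_T this]
  show "linear_map K (T 1 1) (T 2 1) incl"
    unfolding incl_def by (rule lift(1))
  show "incl (t [b] [\<alpha>]) = t [\<one>\<^bsub>A\<^esub>, b] [\<alpha>]" if "b \<in> carrier A" "\<alpha> \<in> carrier B"
    unfolding incl_def using lift(2)[of "[b]" "[\<alpha>]"] that by simp
qed


section \<open>The A-module structure of tensors\<close>

abbreviation TA :: "('a, ('k, 'a, 'b) tensor) module"
  where "TA \<equiv> tensor21_A K A B"

lemma TA_simps [simp]:
  "carrier TA = carrier (T 2 1)"
  "zero TA = zero (T 2 1)"
  "add TA = add (T 2 1)"
  "a \<odot>\<^bsub>TA\<^esub> z = tensor_mult K A B 2 1 (t [a, \<one>\<^bsub>A\<^esub>] [\<one>\<^bsub>B\<^esub>]) z"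
  by (simp_all add: tensor21_A_def Let_def)

lemma TA_a_inv [simp]: "a_inv TA = a_inv (T 2 1)"
  by (simp add: a_inv_def m_inv_def fun_eq_iff)

lemma TA_a_minus [simp]: "a_minus TA = a_minus (T 2 1)"
  by (simp add: a_minus_def fun_eq_iff)

lemma one21: "t (replicate 2 \<one>\<^bsub>A\<^esub>) (replicate 1 \<one>\<^bsub>B\<^esub>) = t [\<one>\<^bsub>A\<^esub>, \<one>\<^bsub>A\<^esub>] [\<one>\<^bsub>B\<^esub>]"
  by (simp add: numeral_2_eq_2 One_nat_def)

lemma mult_one21 [simp]:
  "z \<in> carrier (T 2 1) \<Longrightarrow> tensor_mult K A B 2 1 (t [\<one>\<^bsub>A\<^esub>, \<one>\<^bsub>A\<^esub>] [\<one>\<^bsub>B\<^esub>]) z = z"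
  using tensor_mult_one[of z 2 1] by (simp only: one21)

lemmas mult_closed21 [simp] = tensor_mult_closed[where n = 2 and m = 1]
lemmas mult_add_left = linear_map_tensor_mult_left[THEN linear_map.add]
lemmas mult_add_right = linear_map_tensor_mult_right[THEN linear_map.add]
lemmas mult_smult_left = linear_map_tensor_mult_left[THEN linear_map.smult]
lemmas mult_smult_right = linear_map_tensor_mult_right[THEN linear_map.smult]

lemma module_TA: "module A TA"
proof (rule moduleI)
  show "abelian_group TA"
    by (rule abelian_groupI)
      (auto simp: T21.add.m_ac intro: bexI[of _ "\<ominus>\<^bsub>T 2 1\<^esub> x" for x] T21.l_neg)
  fix a b x assume "a \<in> carrier A" "b \<in> carrier A" "x \<in> carrier TA"
  then show "(a \<otimes>\<^bsub>A\<^esub> b) \<odot>\<^bsub>TA\<^esub> x = a \<odot>\<^bsub>TA\<^esub> (b \<odot>\<^bsub>TA\<^esub> x)"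
    by (simp add: tensor_mult_assoc[symmetric] mult21)
qed (simp_all add: A.is_cring t21_add mult_add_left mult_add_right)

sublocale TA: module A TA
  by (rule module_TA)

lemma ring_hom_scalars: "(\<lambda>k. k \<odot>\<^bsub>A\<^esub> \<one>\<^bsub>A\<^esub>) \<in> ring_hom K A"
  by (rule ring_hom_memI) (simp_all add: A.smult_l_distr A.smult_assoc1[symmetric] A.R.m_comm)

text \<open>Lifts from tensor products need a target over \<open>K\<close>, while the differentials
  and the quotients of \<open>TA\<close> are modules over \<open>A\<close>.\<close>

abbreviation over_K :: "('a, 'n, 'x) module_scheme \<Rightarrow> ('k, 'n) module"
  where "over_K \<equiv> restrict_scalars (\<lambda>k. k \<odot>\<^bsub>A\<^esub> \<one>\<^bsub>A\<^esub>)"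

lemma module_over_K: "module A N \<Longrightarrow> module K (over_K N)"
  by (rule module_restrict_scalars[OF _ A.R.is_cring ring_hom_scalars])

text \<open>A scalar moves out of the first entry, so the two actions of \<open>K\<close> agree and
  \<open>A\<close>-linear maps out of \<open>TA\<close> are \<open>K\<close>-linear on
  \<open>T 2 1\<close>.\<close>

lemma TA_smult_K:
  assumes "k \<in> carrier K" "z \<in> carrier (T 2 1)"
  shows "(k \<odot>\<^bsub>A\<^esub> \<one>\<^bsub>A\<^esub>) \<odot>\<^bsub>TA\<^esub> z = k \<odot>\<^bsub>T 2 1\<^esub> z"
  using assms by (simp add: t21_smult mult_smult_left)

lemma linear_map_TA_over_K:
  assumes "linear_map A TA N h"
  shows "linear_map K (T 2 1) (over_K N) h"
proof -
  interpret linear_map A TA N h by fact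
  show ?thesis
    using add smult closed TA_smult_K
    by (intro linear_mapI module_T module_over_K N.module_axioms)
      (simp_all del: TA_simps(4) add: TA_smult_K[symmetric])
qed

text \<open>Since a \<otimes> b \<otimes> \<alpha> is the multiple by a of 1 \<otimes> b \<otimes>
  \<alpha>, the tensors with first entry 1 generate over \<open>A\<close>. Scalars of
  \<open>K\<close> are covered through \<open>TA_smult_K\<close>.\<close>

lemma TA_induct [consumes 1, case_names elem add smult]:
  assumes "z \<in> carrier (T 2 1)"
    and elem: "\<And>b \<alpha>. \<lbrakk>b \<in> carrier A; \<alpha> \<in> carrier B\<rbrakk> \<Longrightarrow> P (t [\<one>\<^bsub>A\<^esub>, b] [\<alpha>])"
    and add: "\<And>x y. \<lbrakk>x \<in> carrier (T 2 1); y \<in> carrier (T 2 1); P x; P y\<rbrakk> \<Longrightarrow> P (x \<oplus>\<^bsub>T 2 1\<^esub> y)"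
    and smult: "\<And>a x. \<lbrakk>a \<in> carrier A; x \<in> carrier (T 2 1); P x\<rbrakk> \<Longrightarrow> P (a \<odot>\<^bsub>TA\<^esub> x)"
  shows "P z"
  using assms(1)
proof (induction rule: tensor_induct)
  case (elem as bs)
  then obtain a b \<alpha> where ab: "as = [a, b]" "bs = [\<alpha>]"
    "a \<in> carrier A" "b \<in> carrier A" "\<alpha> \<in> carrier B"
    by (rule idx21_cases)
  then have "P (a \<odot>\<^bsub>TA\<^esub> t [\<one>\<^bsub>A\<^esub>, b] [\<alpha>])"
    by (intro smult assms(2)) simp_all
  with ab show ?case
    by (simp add: mult21)
next
  case (smult r x)
  then show ?case
    using assms(4)[of "r \<odot>\<^bsub>A\<^esub> \<one>\<^bsub>A\<^esub>" x] by (simp add: TA_smult_K del: TA_simps(4))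
qed (rule add)

lemma TA_ext:
  assumes "linear_map A TA N f" "linear_map A TA N g" "z \<in> carrier (T 2 1)"
    and "\<And>b \<alpha>. \<lbrakk>b \<in> carrier A; \<alpha> \<in> carrier B\<rbrakk> \<Longrightarrow> f (t [\<one>\<^bsub>A\<^esub>, b] [\<alpha>]) = g (t [\<one>\<^bsub>A\<^esub>, b] [\<alpha>])"
  shows "f z = g z"
proof -
  interpret f: linear_map A TA N f by fact
  interpret g: linear_map A TA N g by fact
  show ?thesis
    using assms(3)
  proof (induction rule: TA_induct)
    case (add x y)
    then show ?case using f.add[of x y] g.add[of x y] by simp
  next
    case (smult a x)
    then show ?case using f.smult[of a x] g.smult[of a x] by simp
  qed (rule assms(4))
qed

section \<open>Compatibility of multiplication with the action of A\<close>

lemma mult_map_add: "\<lbrakk>x \<in> carrier (T 2 1); y \<in> carrier (T 2 1)\<rbrakk> \<Longrightarrow>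
    mult_map K A \<epsilon> (x \<oplus>\<^bsub>T 2 1\<^esub> y) = mult_map K A \<epsilon> x \<oplus>\<^bsub>A\<^esub> mult_map K A \<epsilon> y"
  by (rule linear_map.add[OF linear_map_mult_map])

lemma mult_map_closed [simp]: "x \<in> carrier (T 2 1) \<Longrightarrow> mult_map K A \<epsilon> x \<in> carrier A"
  by (rule linear_map.closed[OF linear_map_mult_map])

lemma mult_map_smult:
  assumes "a \<in> carrier A" "z \<in> carrier (T 2 1)"
  shows "mult_map K A \<epsilon> (a \<odot>\<^bsub>TA\<^esub> z) = a \<otimes>\<^bsub>A\<^esub> mult_map K A \<epsilon> z"
proof -
  have a: "t [a, \<one>\<^bsub>A\<^esub>] [\<one>\<^bsub>B\<^esub>] \<in> carrier (T 2 1)"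
    using assms by simp
  show ?thesis
    unfolding TA_simps
  proof (rule tensor_ext[OF linear_map_comp[OF linear_map_tensor_mult_right[OF a] linear_map_mult_map]
        linear_map_comp[OF linear_map_mult_map linear_map_mult_A(2)[OF assms(1)]] assms(2)])
    fix as bs assume "(as, bs) \<in> idx 2 1"
    then show "mult_map K A \<epsilon> (tensor_mult K A B 2 1 (t [a, \<one>\<^bsub>A\<^esub>] [\<one>\<^bsub>B\<^esub>]) (t as bs)) =
        a \<otimes>\<^bsub>A\<^esub> mult_map K A \<epsilon> (t as bs)"
      using assms(1) by (elim idx21_cases) (simp add: mult21 mult_map_elem A.m_assoc)
  qed
qed

lemma TA_smult_mult:
  "\<lbrakk>a \<in> carrier A; x \<in> carrier (T 2 1); y \<in> carrier (T 2 1)\<rbrakk> \<Longrightarrow>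
    tensor_mult K A B 2 1 (a \<odot>\<^bsub>TA\<^esub> x) y = a \<odot>\<^bsub>TA\<^esub> tensor_mult K A B 2 1 x y"
  by (simp add: tensor_mult_assoc)

lemma TA_mult_smult:
  "\<lbrakk>a \<in> carrier A; x \<in> carrier (T 2 1); y \<in> carrier (T 2 1)\<rbrakk> \<Longrightarrow>
    tensor_mult K A B 2 1 x (a \<odot>\<^bsub>TA\<^esub> y) = a \<odot>\<^bsub>TA\<^esub> tensor_mult K A B 2 1 x y"
  using TA_smult_mult[of a y x] tensor_mult_comm[of x 2 1] by simp

end

section \<open>Secondary differentials\<close>

text \<open>Removes the carrier update in \<open>sec_HH1\<close> once all elements are known to be
  cycles.\<close>

lemma update_carrier_self: "M\<lparr>carrier := carrier M\<rparr> = M"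
  by simp

context commutative_triple
begin

abbreviation kfree :: "('a, ('k, 'a, 'b) tensor \<Rightarrow> 'a) module"
  where "kfree \<equiv> free_module A (carrier (T 1 1))"

text \<open>The differentials as an \<open>A\<close>-module, before restriction along
  \<open>scalar_map\<close>; maps to and from them are built at this level.\<close>

abbreviation Omega :: "('a, (('k, 'a, 'b) tensor \<Rightarrow> 'a) set) module"
  where "Omega \<equiv> quot_module kfree (span_module A kfree (sec_kaehler_rels K A B \<epsilon>))"

lemma sec_kaehler_eq: "sec_kaehler K A B \<epsilon> = restrict_scalars (scalar_map K A \<epsilon>) Omega"
  by (simp add: sec_kaehler_def Let_def)

lemma sec_kaehler_rels_eq:
  "sec_kaehler_rels K A B \<epsilon> =
    {free_gen A (l \<odot>\<^bsub>T 1 1\<^esub> x \<oplus>\<^bsub>T 1 1\<^esub> u \<odot>\<^bsub>T 1 1\<^esub> y) \<ominus>\<^bsub>kfree\<^esub>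
      ((l \<odot>\<^bsub>A\<^esub> \<one>\<^bsub>A\<^esub>) \<odot>\<^bsub>kfree\<^esub> free_gen A x \<oplus>\<^bsub>kfree\<^esub> (u \<odot>\<^bsub>A\<^esub> \<one>\<^bsub>A\<^esub>) \<odot>\<^bsub>kfree\<^esub> free_gen A y) | l u x y.
      l \<in> carrier K \<and> u \<in> carrier K \<and> x \<in> carrier (T 1 1) \<and> y \<in> carrier (T 1 1)} \<union>
    {free_gen A (tensor_mult K A B 1 1 (t [a] [\<alpha>]) (t [b] [\<beta>])) \<ominus>\<^bsub>kfree\<^esub>
      ((a \<otimes>\<^bsub>A\<^esub> \<epsilon> \<alpha>) \<odot>\<^bsub>kfree\<^esub> free_gen A (t [b] [\<beta>]) \<oplus>\<^bsub>kfree\<^esub>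
       (b \<otimes>\<^bsub>A\<^esub> \<epsilon> \<beta>) \<odot>\<^bsub>kfree\<^esub> free_gen A (t [a] [\<alpha>])) | \<alpha> \<beta> a b.
      \<alpha> \<in> carrier B \<and> \<beta> \<in> carrier B \<and> a \<in> carrier A \<and> b \<in> carrier A} \<union>
    {(free_gen A (t [\<one>\<^bsub>A\<^esub>] [\<alpha>]) \<oplus>\<^bsub>kfree\<^esub> free_gen A (t [\<one>\<^bsub>A\<^esub>] [\<alpha>])) \<ominus>\<^bsub>kfree\<^esub>
      free_gen A (t [\<epsilon> \<alpha>] [\<one>\<^bsub>B\<^esub>]) | \<alpha>. \<alpha> \<in> carrier B}"
  unfolding sec_kaehler_rels_def Let_def tensor_algebra_simps ..

lemma sec_kaehler_rels_cases:
  assumes "z \<in> sec_kaehler_rels K A B \<epsilon>"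
  obtains
    (linear) l u x y where "l \<in> carrier K" "u \<in> carrier K" "x \<in> carrier (T 1 1)" "y \<in> carrier (T 1 1)"
      "z = free_gen A (l \<odot>\<^bsub>T 1 1\<^esub> x \<oplus>\<^bsub>T 1 1\<^esub> u \<odot>\<^bsub>T 1 1\<^esub> y) \<ominus>\<^bsub>kfree\<^esub>
        ((l \<odot>\<^bsub>A\<^esub> \<one>\<^bsub>A\<^esub>) \<odot>\<^bsub>kfree\<^esub> free_gen A x \<oplus>\<^bsub>kfree\<^esub> (u \<odot>\<^bsub>A\<^esub> \<one>\<^bsub>A\<^esub>) \<odot>\<^bsub>kfree\<^esub> free_gen A y)"
  | (leibniz) \<alpha> \<beta> a b where
      "\<alpha> \<in> carrier B" "\<beta> \<in> carrier B" "a \<in> carrier A" "b \<in> carrier A"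
      "z = free_gen A (tensor_mult K A B 1 1 (t [a] [\<alpha>]) (t [b] [\<beta>])) \<ominus>\<^bsub>kfree\<^esub>
        ((a \<otimes>\<^bsub>A\<^esub> \<epsilon> \<alpha>) \<odot>\<^bsub>kfree\<^esub> free_gen A (t [b] [\<beta>]) \<oplus>\<^bsub>kfree\<^esub>
         (b \<otimes>\<^bsub>A\<^esub> \<epsilon> \<beta>) \<odot>\<^bsub>kfree\<^esub> free_gen A (t [a] [\<alpha>]))"
  | (double) \<alpha> where "\<alpha> \<in> carrier B"
      "z = (free_gen A (t [\<one>\<^bsub>A\<^esub>] [\<alpha>]) \<oplus>\<^bsub>kfree\<^esub> free_gen A (t [\<one>\<^bsub>A\<^esub>] [\<alpha>])) \<ominus>\<^bsub>kfree\<^esub>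
        free_gen A (t [\<epsilon> \<alpha>] [\<one>\<^bsub>B\<^esub>])"
  using assms unfolding sec_kaehler_rels_eq
  by (elim UnE CollectE exE conjE) (rule that; assumption)+

lemma gen_closed [simp]: "x \<in> carrier (T 1 1) \<Longrightarrow> free_gen A x \<in> carrier kfree"
  by (rule A.free_gen_closed)

sublocale kfree: module A kfree
  by (rule A.free_module_module)

lemma sec_kaehler_rels_subset: "sec_kaehler_rels K A B \<epsilon> \<subseteq> carrier kfree"
proof
  fix z assume "z \<in> sec_kaehler_rels K A B \<epsilon>"
  then show "z \<in> carrier kfree"
    by (cases rule: sec_kaehler_rels_cases) (simp_all add: mult11)
qed

sublocale Om: module_quotient A kfree "span_module A kfree (sec_kaehler_rels K A B \<epsilon>)"
  by (intro module_quotient.intro module_quotient_axioms.intro kfree.module_axioms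
      kfree.span_module_submodule sec_kaehler_rels_subset)

sublocale Omega: module A Omega
  by (rule Om.module_quot)

section \<open>The universal derivation and its rules\<close>

definition d :: "('k, 'a, 'b) tensor \<Rightarrow> (('k, 'a, 'b) tensor \<Rightarrow> 'a) set"
  where "d x = Om.proj (free_gen A x)"

lemma d_closed [simp]: "x \<in> carrier (T 1 1) \<Longrightarrow> d x \<in> carrier Omega"
  unfolding d_def by (intro Om.proj_closed gen_closed)

lemma proj_eq_if_rel:
  assumes "x \<in> carrier kfree" "y \<in> carrier kfree" "x \<ominus>\<^bsub>kfree\<^esub> y \<in> sec_kaehler_rels K A B \<epsilon>"
  shows "Om.proj x = Om.proj y"
  using assms span_module_superset[THEN subsetD, OF assms(3)] by (simp add: Om.proj_eq_iff)

lemma d_combination: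
  assumes "l \<in> carrier K" "u \<in> carrier K" "x \<in> carrier (T 1 1)" "y \<in> carrier (T 1 1)"
  shows "d (l \<odot>\<^bsub>T 1 1\<^esub> x \<oplus>\<^bsub>T 1 1\<^esub> u \<odot>\<^bsub>T 1 1\<^esub> y) =
    (l \<odot>\<^bsub>A\<^esub> \<one>\<^bsub>A\<^esub>) \<odot>\<^bsub>Omega\<^esub> d x \<oplus>\<^bsub>Omega\<^esub> (u \<odot>\<^bsub>A\<^esub> \<one>\<^bsub>A\<^esub>) \<odot>\<^bsub>Omega\<^esub> d y"
proof -
  have "d (l \<odot>\<^bsub>T 1 1\<^esub> x \<oplus>\<^bsub>T 1 1\<^esub> u \<odot>\<^bsub>T 1 1\<^esub> y) = Om.proj
      ((l \<odot>\<^bsub>A\<^esub> \<one>\<^bsub>A\<^esub>) \<odot>\<^bsub>kfree\<^esub> free_gen A x \<oplus>\<^bsub>kfree\<^esub> (u \<odot>\<^bsub>A\<^esub> \<one>\<^bsub>A\<^esub>) \<odot>\<^bsub>kfree\<^esub> free_gen A y)"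
    unfolding d_def
    by (rule proj_eq_if_rel) (use assms in \<open>simp, simp, unfold sec_kaehler_rels_eq, blast\<close>)
  then show ?thesis
    using assms by (simp add: d_def Om.proj_add Om.proj_smult)
qed

lemma d_mult:
  assumes "a \<in> carrier A" "b \<in> carrier A" "\<alpha> \<in> carrier B" "\<beta> \<in> carrier B"
  shows "d (t [a \<otimes>\<^bsub>A\<^esub> b] [\<alpha> \<otimes>\<^bsub>B\<^esub> \<beta>]) =
    (a \<otimes>\<^bsub>A\<^esub> \<epsilon> \<alpha>) \<odot>\<^bsub>Omega\<^esub> d (t [b] [\<beta>]) \<oplus>\<^bsub>Omega\<^esub> (b \<otimes>\<^bsub>A\<^esub> \<epsilon> \<beta>) \<odot>\<^bsub>Omega\<^esub> d (t [a] [\<alpha>])"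
proof -
  have "d (tensor_mult K A B 1 1 (t [a] [\<alpha>]) (t [b] [\<beta>])) = Om.proj
      ((a \<otimes>\<^bsub>A\<^esub> \<epsilon> \<alpha>) \<odot>\<^bsub>kfree\<^esub> free_gen A (t [b] [\<beta>]) \<oplus>\<^bsub>kfree\<^esub>
       (b \<otimes>\<^bsub>A\<^esub> \<epsilon> \<beta>) \<odot>\<^bsub>kfree\<^esub> free_gen A (t [a] [\<alpha>]))"
    unfolding d_def
    by (rule proj_eq_if_rel) (use assms in \<open>simp add: mult11, simp, unfold sec_kaehler_rels_eq, blast\<close>)
  then show ?thesis
    using assms by (simp add: d_def Om.proj_add Om.proj_smult mult11)
qed

lemma d_double:
  assumes "\<alpha> \<in> carrier B"
  shows "d (t [\<one>\<^bsub>A\<^esub>] [\<alpha>]) \<oplus>\<^bsub>Omega\<^esub> d (t [\<one>\<^bsub>A\<^esub>] [\<alpha>]) = d (t [\<epsilon> \<alpha>] [\<one>\<^bsub>B\<^esub>])"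
proof -
  have "Om.proj (free_gen A (t [\<one>\<^bsub>A\<^esub>] [\<alpha>]) \<oplus>\<^bsub>kfree\<^esub> free_gen A (t [\<one>\<^bsub>A\<^esub>] [\<alpha>])) =
      d (t [\<epsilon> \<alpha>] [\<one>\<^bsub>B\<^esub>])"
    unfolding d_def
    by (rule proj_eq_if_rel) (use assms in \<open>simp, simp, unfold sec_kaehler_rels_eq, blast\<close>)
  then show ?thesis
    using assms by (simp add: d_def Om.proj_add)
qed

text \<open>Relation (iii) at \<alpha> = 1 reads 2 d(1) = d(1), because \<epsilon> preserves
  1.\<close>

lemma d_one: "d (t [\<one>\<^bsub>A\<^esub>] [\<one>\<^bsub>B\<^esub>]) = \<zero>\<^bsub>Omega\<^esub>"
  using d_double[of "\<one>\<^bsub>B\<^esub>"] by (simp add: Omega.add.r_cancel_one')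

text \<open>Additivity is relation (i) with both coefficients 1, homogeneity is relation (i) with
  second coefficient 0.\<close>

lemma linear_map_d: "linear_map K (T 1 1) (over_K Omega) d"
proof (rule linear_mapI[OF module_T module_over_K[OF Omega.module_axioms]])
  fix x y assume "x \<in> carrier (T 1 1)" "y \<in> carrier (T 1 1)"
  then show "d (x \<oplus>\<^bsub>T 1 1\<^esub> y) = d x \<oplus>\<^bsub>over_K Omega\<^esub> d y"
    using d_combination[of "\<one>\<^bsub>K\<^esub>" "\<one>\<^bsub>K\<^esub>" x y] by simp
next
  fix r x assume "r \<in> carrier K" "x \<in> carrier (T 1 1)"
  then show "d (r \<odot>\<^bsub>T 1 1\<^esub> x) = r \<odot>\<^bsub>over_K Omega\<^esub> d x"
    using d_combination[of r "\<zero>\<^bsub>K\<^esub>" x x] by simp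
qed simp

text \<open>The universal property of the differentials: the extension of \<open>g\<close> to the
  free module kills relation (i) by linearity and the other two by hypothesis, hence it factors
  through \<open>Omega\<close>.\<close>

lemma kaehler_lift:
  fixes N :: "('a, 'n) module"
  assumes N: "module A N" and g: "linear_map K (T 1 1) (over_K N) g"
    and leibniz: "\<And>a b \<alpha> \<beta>. \<lbrakk>a \<in> carrier A; b \<in> carrier A; \<alpha> \<in> carrier B; \<beta> \<in> carrier B\<rbrakk> \<Longrightarrow>
      g (t [a \<otimes>\<^bsub>A\<^esub> b] [\<alpha> \<otimes>\<^bsub>B\<^esub> \<beta>]) =
      (a \<otimes>\<^bsub>A\<^esub> \<epsilon> \<alpha>) \<odot>\<^bsub>N\<^esub> g (t [b] [\<beta>]) \<oplus>\<^bsub>N\<^esub> (b \<otimes>\<^bsub>A\<^esub> \<epsilon> \<beta>) \<odot>\<^bsub>N\<^esub> g (t [a] [\<alpha>])"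
    and double: "\<And>\<alpha>. \<alpha> \<in> carrier B \<Longrightarrow>
      g (t [\<one>\<^bsub>A\<^esub>] [\<alpha>]) \<oplus>\<^bsub>N\<^esub> g (t [\<one>\<^bsub>A\<^esub>] [\<alpha>]) = g (t [\<epsilon> \<alpha>] [\<one>\<^bsub>B\<^esub>])"
  shows "\<exists>h. linear_map A Omega N h \<and> (\<forall>x\<in>carrier (T 1 1). h (d x) = g x)"
proof -
  interpret N: module A N by fact
  interpret g: linear_map K "T 1 1" "over_K N" g by fact
  have gc [simp]: "g x \<in> carrier N" if "x \<in> carrier (T 1 1)" for x
    using g.closed[OF that] by simp
  then have gf: "g \<in> carrier (T 1 1) \<rightarrow> carrier N"
    by blast
  interpret L: linear_map A kfree N "free_lift A N g"
    by (rule N.linear_map_free_lift[OF gf])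
  have lift: "free_lift A N g (free_gen A x) = g x" if "x \<in> carrier (T 1 1)" for x
    using gf that by (rule N.free_lift_gen)
  have "sec_kaehler_rels K A B \<epsilon> \<subseteq> a_kernel kfree N (free_lift A N g)"
  proof
    fix z assume z: "z \<in> sec_kaehler_rels K A B \<epsilon>"
    then have "free_lift A N g z = \<zero>\<^bsub>N\<^esub>"
    proof (cases rule: sec_kaehler_rels_cases)
      case (linear l u x y)
      then show ?thesis
        using g.add[of "l \<odot>\<^bsub>T 1 1\<^esub> x" "u \<odot>\<^bsub>T 1 1\<^esub> y"] g.smult
        by (simp add: L.minus L.add L.smult lift N.diff_self)
    next
      case (leibniz \<alpha> \<beta> a b)
      then show ?thesis
        by (simp add: L.minus L.add L.smult lift mult11 assms(3) N.diff_self)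
    next
      case (double \<alpha>)
      then show ?thesis
        by (simp add: L.minus L.add lift assms(4) N.diff_self)
    qed
    then show "z \<in> a_kernel kfree N (free_lift A N g)"
      using z sec_kaehler_rels_subset by (auto simp: a_kernel_def')
  qed
  then have ker: "span_module A kfree (sec_kaehler_rels K A B \<epsilon>) \<subseteq> a_kernel kfree N (free_lift A N g)"
    by (intro span_module_least L.kernel_submodule)
  show ?thesis
  proof (intro exI conjI ballI)
    show "linear_map A Omega N (Om.induced (free_lift A N g))"
      by (rule Om.linear_map_induced[OF L.linear_map_axioms ker])
    show "Om.induced (free_lift A N g) (d x) = g x" if "x \<in> carrier (T 1 1)" for x
      using that unfolding d_def
      by (simp add: Om.induced_proj[OF L.linear_map_axioms ker] lift)
  qed
qed

text \<open>Additivity of \<open>d\<close> extends the assumption from elementary tensors to all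
  symbols, with \<open>K\<close> acting through \<open>A\<close>; these are the free generators of
  \<open>kfree\<close>.\<close>

lemma Omega_submodule_eq:
  assumes P: "submodule P A Omega"
    and elem: "\<And>b \<alpha>. \<lbrakk>b \<in> carrier A; \<alpha> \<in> carrier B\<rbrakk> \<Longrightarrow> d (t [b] [\<alpha>]) \<in> P"
  shows "P = carrier Omega"
proof -
  interpret p: linear_map A kfree Omega Om.proj
    by (rule Om.linear_map_proj)
  interpret d: linear_map K "T 1 1" "over_K Omega" d
    by (rule linear_map_d)
  note PE = Omega.submoduleE[OF P]
  have "d x \<in> P" if "x \<in> carrier (T 1 1)" for x
    using that
  proof (induction rule: tensor_induct)
    case (elem as bs)
    then show ?case
      using assms(2) by (elim idx11_cases) simp
  next
    case (add x y)
    then show ?case using d.add[of x y] PE(5) by simp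
  next
    case (smult r x)
    then show ?case using d.smult[of r x] PE(4) by simp
  qed
  then have "{x \<in> carrier kfree. Om.proj x \<in> P} = carrier kfree"
    by (intro A.free_module_submodule_eq p.vimage_submodule P) (auto simp: d_def)
  then have "carrier Omega \<subseteq> P"
    unfolding Om.carrier_quot by blast
  then show ?thesis
    using PE(1) by blast
qed


section \<open>The comparison map\<close>

text \<open>Built over \<open>K\<close> because it is a lift from a tensor product;
  \<open>linear_map_psi\<close> upgrades it to an \<open>A\<close>-linear map.\<close>

definition psi :: "('k, 'a, 'b) tensor \<Rightarrow> (('k, 'a, 'b) tensor \<Rightarrow> 'a) set"
  where "psi = tensor_lift K (over_K Omega) (\<lambda>z. case z of ([a, b], [\<alpha>]) \<Rightarrow> a \<odot>\<^bsub>Omega\<^esub> d (t [b] [\<alpha>]))"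

lemma linear_map_smult_Omega:
  assumes "a \<in> carrier A"
  shows "linear_map K (over_K Omega) (over_K Omega) (\<lambda>w. a \<odot>\<^bsub>Omega\<^esub> w)"
  using assms
  by (intro linear_mapI module_over_K Omega.module_axioms)
    (simp_all add: Omega.smult_r_distr Omega.smult_assoc1[symmetric] A.m_comm)

lemma psi:
  shows linear_map_psi_K: "linear_map K (T 2 1) (over_K Omega) psi"
    and psi_elem: "\<lbrakk>a \<in> carrier A; b \<in> carrier A; \<alpha> \<in> carrier B\<rbrakk> \<Longrightarrow>
      psi (t [a, b] [\<alpha>]) = a \<odot>\<^bsub>Omega\<^esub> d (t [b] [\<alpha>])"
proof -
  have M: "module K (over_K Omega)"
    by (intro module_over_K Omega.module_axioms)
  have "multilinear K A B 2 1 (over_K Omega) (\<lambda>z. case z of ([a, b], [\<alpha>]) \<Rightarrow> a \<odot>\<^bsub>Omega\<^esub> d (t [b] [\<alpha>]))"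
  proof (rule multilinear21I)
    fix b \<alpha> assume "b \<in> carrier A" "\<alpha> \<in> carrier B"
    then show "linear_map K A (over_K Omega)
        (\<lambda>x. case ([x, b], [\<alpha>]) of ([a, b], [\<alpha>]) \<Rightarrow> a \<odot>\<^bsub>Omega\<^esub> d (t [b] [\<alpha>]))"
      by (intro linear_mapI A.module M)
        (simp_all add: Omega.smult_l_distr Omega.smult_assoc1[symmetric])
  next
    fix a \<alpha> assume "a \<in> carrier A" "\<alpha> \<in> carrier B"
    then show "linear_map K A (over_K Omega)
        (\<lambda>x. case ([a, x], [\<alpha>]) of ([a, b], [\<alpha>]) \<Rightarrow> a \<odot>\<^bsub>Omega\<^esub> d (t [b] [\<alpha>]))"
      using linear_map_comp[OF linear_map_comp[OF t11_linear(1) linear_map_d] linear_map_smult_Omega]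
      by simp
  next
    fix a b assume "a \<in> carrier A" "b \<in> carrier A"
    then show "linear_map K B (over_K Omega)
        (\<lambda>x. case ([a, b], [x]) of ([a, b], [\<alpha>]) \<Rightarrow> a \<odot>\<^bsub>Omega\<^esub> d (t [b] [\<alpha>]))"
      using linear_map_comp[OF linear_map_comp[OF t11_linear(2) linear_map_d] linear_map_smult_Omega]
      by simp
  qed
  note lift = tensor_lift[OF M this]
  show "linear_map K (T 2 1) (over_K Omega) psi"
    unfolding psi_def by (rule lift(1))
  show "psi (t [a, b] [\<alpha>]) = a \<odot>\<^bsub>Omega\<^esub> d (t [b] [\<alpha>])"
    if "a \<in> carrier A" "b \<in> carrier A" "\<alpha> \<in> carrier B"
    unfolding psi_def using lift(2)[of "[a, b]" "[\<alpha>]"] that by simp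
qed

lemma linear_map_psi: "linear_map A TA Omega psi"
proof -
  interpret K: linear_map K "T 2 1" "over_K Omega" psi
    by (rule linear_map_psi_K)
  have "psi (a \<odot>\<^bsub>TA\<^esub> z) = a \<odot>\<^bsub>Omega\<^esub> psi z" if a: "a \<in> carrier A" and z: "z \<in> carrier (T 2 1)" for a z
    unfolding TA_simps
  proof (rule tensor_ext[OF linear_map_comp[OF linear_map_tensor_mult_right linear_map_psi_K]
        linear_map_comp[OF linear_map_psi_K linear_map_smult_Omega[OF a]] z])
    show "t [a, \<one>\<^bsub>A\<^esub>] [\<one>\<^bsub>B\<^esub>] \<in> carrier (T 2 1)"
      using a by simp
    fix as bs assume "(as, bs) \<in> idx 2 1"
    then show "psi (tensor_mult K A B 2 1 (t [a, \<one>\<^bsub>A\<^esub>] [\<one>\<^bsub>B\<^esub>]) (t as bs)) = a \<odot>\<^bsub>Omega\<^esub> psi (t as bs)"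
      using a by (elim idx21_cases) (simp add: mult21 psi_elem Omega.smult_assoc1)
  qed
  then show ?thesis
    using K.closed K.add by (intro linear_mapI TA.module_axioms Omega.module_axioms) simp_all
qed

sublocale psi: linear_map A TA Omega psi
  by (rule linear_map_psi)

lemma psi_closed [simp]: "z \<in> carrier (T 2 1) \<Longrightarrow> psi z \<in> carrier Omega"
  using psi.closed by simp

lemma psi_add: "\<lbrakk>x \<in> carrier (T 2 1); y \<in> carrier (T 2 1)\<rbrakk> \<Longrightarrow>
    psi (x \<oplus>\<^bsub>T 2 1\<^esub> y) = psi x \<oplus>\<^bsub>Omega\<^esub> psi y"
  using psi.add by simp

lemma psi_minus: "\<lbrakk>x \<in> carrier (T 2 1); y \<in> carrier (T 2 1)\<rbrakk> \<Longrightarrow>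
    psi (x \<ominus>\<^bsub>T 2 1\<^esub> y) = psi x \<ominus>\<^bsub>Omega\<^esub> psi y"
  using psi.minus by simp

text \<open>Already the elements 1 \<otimes> b \<otimes> \<alpha> reach the generators d(\<alpha>
  \<otimes> b).\<close>

lemma psi_surj: "psi ` carrier (T 2 1) = carrier Omega"
proof (rule Omega_submodule_eq)
  show "submodule (psi ` carrier (T 2 1)) A Omega"
    using psi.image_submodule by simp
  fix b \<alpha> assume "b \<in> carrier A" "\<alpha> \<in> carrier B"
  then show "d (t [b] [\<alpha>]) \<in> psi ` carrier (T 2 1)"
    using psi_elem[of "\<one>\<^bsub>A\<^esub>" b \<alpha>] by (intro image_eqI[of _ _ "t [\<one>\<^bsub>A\<^esub>, b] [\<alpha>]"]) simp_all
qed

text \<open>Both sides are \<open>A\<close>-linear in each argument, which reduces the rule to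
  tensors with first entry 1, where it is the Leibniz relation \<open>d_mult\<close>.\<close>

lemma psi_derivation:
  assumes u: "u \<in> carrier (T 2 1)" and v: "v \<in> carrier (T 2 1)"
  shows "psi (tensor_mult K A B 2 1 u v) =
    mult_map K A \<epsilon> u \<odot>\<^bsub>Omega\<^esub> psi v \<oplus>\<^bsub>Omega\<^esub> mult_map K A \<epsilon> v \<odot>\<^bsub>Omega\<^esub> psi u"
  using u
proof (induction rule: TA_induct)
  case (elem b \<alpha>)
  show ?case
    using v
  proof (induction rule: TA_induct)
    case (elem b' \<alpha>')
    with \<open>b \<in> carrier A\<close> \<open>\<alpha> \<in> carrier B\<close> show ?case
      by (simp add: mult21 psi_elem mult_map_elem d_mult)
  next
    case (add x y)
    with \<open>b \<in> carrier A\<close> \<open>\<alpha> \<in> carrier B\<close> show ?case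
      by (simp add: mult_add_right psi_add mult_map_add Omega.smult_l_distr
        Omega.smult_r_distr Omega.add.m_ac)
  next
    case (smult a x)
    with \<open>b \<in> carrier A\<close> \<open>\<alpha> \<in> carrier B\<close> show ?case
      using psi.smult[of a]
      by (simp add: TA_mult_smult mult_map_smult Omega.smult_r_distr Omega.smult_assoc1[symmetric] A.m_comm
          del: TA_simps(4))
  qed
next
  case (add x y)
  then show ?case
    using v by (simp add: mult_add_left psi_add mult_map_add Omega.smult_l_distr
        Omega.smult_r_distr Omega.add.m_ac)
next
  case (smult a x)
  then show ?case
    using v psi.smult[of a]
    by (simp add: TA_smult_mult mult_map_smult Omega.smult_r_distr Omega.smult_assoc1[symmetric] A.m_comm
        del: TA_simps(4))
qed


section \<open>Hochschild homology\<close>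

abbreviation bd_image :: "('k, 'a, 'b) tensor set"
  where "bd_image \<equiv> boundary2 K A B \<epsilon> ` carrier (T 3 3)"

lemma boundary2_in_image:
  assumes "a \<in> carrier A" "b \<in> carrier A" "c \<in> carrier A"
    "\<alpha> \<in> carrier B" "\<beta> \<in> carrier B" "\<gamma> \<in> carrier B"
  shows "t [a \<otimes>\<^bsub>A\<^esub> \<epsilon> \<alpha> \<otimes>\<^bsub>A\<^esub> b, c] [\<beta> \<otimes>\<^bsub>B\<^esub> \<gamma>]
      \<ominus>\<^bsub>T 2 1\<^esub> t [a, b \<otimes>\<^bsub>A\<^esub> \<epsilon> \<gamma> \<otimes>\<^bsub>A\<^esub> c] [\<alpha> \<otimes>\<^bsub>B\<^esub> \<beta>]
      \<oplus>\<^bsub>T 2 1\<^esub> t [c \<otimes>\<^bsub>A\<^esub> \<epsilon> \<beta> \<otimes>\<^bsub>A\<^esub> a, b] [\<alpha> \<otimes>\<^bsub>B\<^esub> \<gamma>] \<in> bd_image"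
  using assms by (intro image_eqI[where x = "t [a, b, c] [\<alpha>, \<beta>, \<gamma>]"] elem_tensor_closed)
    (simp_all add: boundary2_elem)

text \<open>As the image of a \<open>K\<close>-linear map this is at first a
  \<open>K\<close>-subspace. The entry a is a factor of the first entry of every face, so
  multiplying a boundary by x amounts to replacing a by xa.\<close>

lemma submodule_bd_image: "submodule bd_image A TA"
proof -
  interpret b: linear_map K "T 3 3" "T 2 1" "boundary2 K A B \<epsilon>"
    by (rule linear_map_boundary2)
  note P = T21.submoduleE[OF b.image_submodule]
  have "x \<odot>\<^bsub>TA\<^esub> boundary2 K A B \<epsilon> w \<in> bd_image" if x: "x \<in> carrier A" and "w \<in> carrier (T 3 3)" for x w
    using that(2)
  proof (induction rule: tensor_induct)
    case (elem as bs)
    then obtain a b c \<alpha> \<beta> \<gamma> where "as = [a, b, c]" "bs = [\<alpha>, \<beta>, \<gamma>]"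
      "a \<in> carrier A" "b \<in> carrier A" "c \<in> carrier A"
      "\<alpha> \<in> carrier B" "\<beta> \<in> carrier B" "\<gamma> \<in> carrier B"
      by (rule idx33_cases)
    moreover from this have "t [x, \<one>\<^bsub>A\<^esub>] [\<one>\<^bsub>B\<^esub>] \<in> carrier (T 2 1)"
      using x by simp
    note linear_map.minus[OF linear_map_tensor_mult_right[OF this]]
    ultimately show ?case
      using x boundary2_in_image[of "x \<otimes>\<^bsub>A\<^esub> a" b c \<alpha> \<beta> \<gamma>]
      by (simp add: boundary2_elem mult_add_right mult21 A.m_ac)
  next
    case (add y z)
    then show ?case
      using x P(5) by (simp add: b.add mult_add_right)
  next
    case (smult r y)
    then show ?case
      using x P(4) by (simp add: b.smult mult_smult_right)
  qed
  moreover have "\<zero>\<^bsub>T 2 1\<^esub> \<in> bd_image"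
    by (rule T21.submodule_zero[OF b.image_submodule])
  ultimately show ?thesis
    using P by (intro TA.submoduleI) auto
qed

lemma psi_boundary2:
  assumes "w \<in> carrier (T 3 3)"
  shows "psi (boundary2 K A B \<epsilon> w) = \<zero>\<^bsub>Omega\<^esub>"
proof -
  have M: "module K (over_K Omega)"
    by (intro module_over_K Omega.module_axioms)
  have "linear_map K (T 3 3) (over_K Omega) (\<lambda>z. \<zero>\<^bsub>Omega\<^esub>)"
    using module.smult_r_null[OF M] by (intro linear_mapI module_T M) simp_all
  then show ?thesis
  proof (rule tensor_ext[OF linear_map_comp[OF linear_map_boundary2 linear_map_psi_K] _ assms])
    fix as bs assume "(as, bs) \<in> idx 3 3"
    then obtain a b c \<alpha> \<beta> \<gamma> where ab: "as = [a, b, c]" "bs = [\<alpha>, \<beta>, \<gamma>]"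
      and [simp]: "a \<in> carrier A" "b \<in> carrier A" "c \<in> carrier A"
        "\<alpha> \<in> carrier B" "\<beta> \<in> carrier B" "\<gamma> \<in> carrier B"
      by (rule idx33_cases)
    \<comment> \<open>Every differential below expands in these two kinds, one for each tensor
      factor.\<close>
    define \<delta> where "\<delta> = (\<lambda>b. d (t [b] [\<one>\<^bsub>B\<^esub>]))"
    define D where "D = (\<lambda>\<alpha>. d (t [\<one>\<^bsub>A\<^esub>] [\<alpha>]))"
    have c [simp]: "\<delta> x \<in> carrier Omega" if "x \<in> carrier A" for x
      using that by (simp add: \<delta>_def)
    have c' [simp]: "D x \<in> carrier Omega" if "x \<in> carrier B" for x
      using that by (simp add: D_def)
    have split: "d (t [x] [\<xi>]) = x \<odot>\<^bsub>Omega\<^esub> D \<xi> \<oplus>\<^bsub>Omega\<^esub> \<epsilon> \<xi> \<odot>\<^bsub>Omega\<^esub> \<delta> x"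
      if "x \<in> carrier A" "\<xi> \<in> carrier B" for x \<xi>
      using that d_mult[of x "\<one>\<^bsub>A\<^esub>" "\<one>\<^bsub>B\<^esub>" \<xi>] by (simp add: D_def \<delta>_def)
    have \<delta>_mult: "\<delta> (x \<otimes>\<^bsub>A\<^esub> y) = x \<odot>\<^bsub>Omega\<^esub> \<delta> y \<oplus>\<^bsub>Omega\<^esub> y \<odot>\<^bsub>Omega\<^esub> \<delta> x"
      if "x \<in> carrier A" "y \<in> carrier A" for x y
      using that d_mult[of x y "\<one>\<^bsub>B\<^esub>" "\<one>\<^bsub>B\<^esub>"] by (simp add: \<delta>_def)
    have D_mult: "D (\<xi> \<otimes>\<^bsub>B\<^esub> \<zeta>) = \<epsilon> \<xi> \<odot>\<^bsub>Omega\<^esub> D \<zeta> \<oplus>\<^bsub>Omega\<^esub> \<epsilon> \<zeta> \<odot>\<^bsub>Omega\<^esub> D \<xi>"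
      if "\<xi> \<in> carrier B" "\<zeta> \<in> carrier B" for \<xi> \<zeta>
      using that d_mult[of "\<one>\<^bsub>A\<^esub>" "\<one>\<^bsub>A\<^esub>" \<xi> \<zeta>] by (simp add: D_def)
    have \<delta>_eps: "\<delta> (\<epsilon> \<xi>) = D \<xi> \<oplus>\<^bsub>Omega\<^esub> D \<xi>" if "\<xi> \<in> carrier B" for \<xi>
      using that d_double by (simp add: D_def \<delta>_def)
    \<comment> \<open>The two faces with plus sign are collected in \<open>?l\<close>, the face with
      minus sign is \<open>?r\<close>.\<close>
    let ?l = "(a \<otimes>\<^bsub>A\<^esub> \<epsilon> \<alpha> \<otimes>\<^bsub>A\<^esub> b) \<odot>\<^bsub>Omega\<^esub> d (t [c] [\<beta> \<otimes>\<^bsub>B\<^esub> \<gamma>]) \<oplus>\<^bsub>Omega\<^esub>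
        (c \<otimes>\<^bsub>A\<^esub> \<epsilon> \<beta> \<otimes>\<^bsub>A\<^esub> a) \<odot>\<^bsub>Omega\<^esub> d (t [b] [\<alpha> \<otimes>\<^bsub>B\<^esub> \<gamma>])"
    let ?r = "a \<odot>\<^bsub>Omega\<^esub> d (t [b \<otimes>\<^bsub>A\<^esub> \<epsilon> \<gamma> \<otimes>\<^bsub>A\<^esub> c] [\<alpha> \<otimes>\<^bsub>B\<^esub> \<beta>])"
    \<comment> \<open>Each face in \<open>?l\<close> contributes one copy of abc
      \<epsilon>(\<alpha>\<beta>) D(\<gamma>). In \<open>?r\<close> the pair comes from
      \<delta>(\<epsilon>(\<gamma>)) = 2 D(\<gamma>), which is where relation (iii) enters; the
      other terms match by the Leibniz rule.\<close>
    have "?l = ?r"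
      by (simp add: split \<delta>_mult D_mult \<delta>_eps Omega.smult_r_distr Omega.smult_assoc1[symmetric]
          A.m_ac Omega.add.m_ac)
    moreover have "psi (boundary2 K A B \<epsilon> (t as bs)) = ?l \<ominus>\<^bsub>Omega\<^esub> ?r"
      by (simp add: ab boundary2_elem psi_add psi_minus psi_elem)
        (simp add: a_minus_def Omega.add.m_ac)
    ultimately show "psi (boundary2 K A B \<epsilon> (t as bs)) = \<zero>\<^bsub>Omega\<^esub>"
      by (simp add: Omega.diff_self)
  qed
qed

lemma kernel_psi: "bd_image = a_kernel TA Omega psi"
proof
  show "bd_image \<subseteq> a_kernel TA Omega psi"
    using psi_boundary2 linear_map.closed[OF linear_map_boundary2] by (auto simp: a_kernel_def')
  interpret Q: module_quotient A TA bd_image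
    by (intro module_quotient.intro module_quotient_axioms.intro module_TA submodule_bd_image)
  \<comment> \<open>The difference is reversed because in both uses the sum \<open>y\<close>
    consists of the first and third faces, which carry the plus sign.\<close>
  have proj_eqI: "Q.proj x = Q.proj y"
    if "x \<in> carrier (T 2 1)" "y \<in> carrier (T 2 1)" "y \<ominus>\<^bsub>T 2 1\<^esub> x \<in> bd_image" for x y
    using that Q.proj_eq_iff[of y x] by simp
  have g: "linear_map K (T 1 1) (over_K (quot_module TA bd_image)) (\<lambda>x. Q.proj (incl x))"
    by (rule linear_map_comp[OF linear_map_incl linear_map_TA_over_K[OF Q.linear_map_proj]])
  have "\<exists>h. linear_map A Omega (quot_module TA bd_image) h \<and>
      (\<forall>x\<in>carrier (T 1 1). h (d x) = Q.proj (incl x))"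
  proof (rule kaehler_lift[OF Q.module_quot g])
    fix a b \<alpha> \<beta> assume ab: "a \<in> carrier A" "b \<in> carrier A" "\<alpha> \<in> carrier B" "\<beta> \<in> carrier B"
    have "Q.proj (t [\<one>\<^bsub>A\<^esub>, a \<otimes>\<^bsub>A\<^esub> b] [\<alpha> \<otimes>\<^bsub>B\<^esub> \<beta>]) =
        Q.proj (t [a \<otimes>\<^bsub>A\<^esub> \<epsilon> \<alpha>, b] [\<beta>] \<oplus>\<^bsub>T 2 1\<^esub> t [b \<otimes>\<^bsub>A\<^esub> \<epsilon> \<beta>, a] [\<alpha>])"
      using ab boundary2_in_image[of "\<one>\<^bsub>A\<^esub>" a b \<alpha> \<beta> "\<one>\<^bsub>B\<^esub>"]
      by (intro proj_eqI) (simp_all add: a_minus_def T21.add.m_ac A.m_ac)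
    then show "Q.proj (incl (t [a \<otimes>\<^bsub>A\<^esub> b] [\<alpha> \<otimes>\<^bsub>B\<^esub> \<beta>])) =
        (a \<otimes>\<^bsub>A\<^esub> \<epsilon> \<alpha>) \<odot>\<^bsub>quot_module TA bd_image\<^esub> Q.proj (incl (t [b] [\<beta>]))
        \<oplus>\<^bsub>quot_module TA bd_image\<^esub>
        (b \<otimes>\<^bsub>A\<^esub> \<epsilon> \<beta>) \<odot>\<^bsub>quot_module TA bd_image\<^esub> Q.proj (incl (t [a] [\<alpha>]))"
      using ab by (simp add: incl_elem Q.proj_smult Q.proj_add mult21)
  next
    fix \<alpha> assume a: "\<alpha> \<in> carrier B"
    have "Q.proj (t [\<one>\<^bsub>A\<^esub>, \<epsilon> \<alpha>] [\<one>\<^bsub>B\<^esub>]) =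
        Q.proj (t [\<one>\<^bsub>A\<^esub>, \<one>\<^bsub>A\<^esub>] [\<alpha>] \<oplus>\<^bsub>T 2 1\<^esub> t [\<one>\<^bsub>A\<^esub>, \<one>\<^bsub>A\<^esub>] [\<alpha>])"
      using a boundary2_in_image[of "\<one>\<^bsub>A\<^esub>" "\<one>\<^bsub>A\<^esub>" "\<one>\<^bsub>A\<^esub>" "\<one>\<^bsub>B\<^esub>" "\<one>\<^bsub>B\<^esub>" \<alpha>]
      by (intro proj_eqI) (simp_all add: a_minus_def T21.add.m_ac)
    then show "Q.proj (incl (t [\<one>\<^bsub>A\<^esub>] [\<alpha>])) \<oplus>\<^bsub>quot_module TA bd_image\<^esub> Q.proj (incl (t [\<one>\<^bsub>A\<^esub>] [\<alpha>])) =
        Q.proj (incl (t [\<epsilon> \<alpha>] [\<one>\<^bsub>B\<^esub>]))"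
      using a by (simp add: incl_elem Q.proj_add)
  qed
  then obtain h where h: "linear_map A Omega (quot_module TA bd_image) h"
    "\<forall>x\<in>carrier (T 1 1). h (d x) = Q.proj (incl x)"
    by blast
  interpret h: linear_map A Omega "quot_module TA bd_image" h by fact
  \<comment> \<open>Both sides are \<open>A\<close>-linear, so it suffices to follow 1 \<otimes> b
    \<otimes> \<alpha> through d(\<alpha> \<otimes> b) back to its own class.\<close>
  have "h (psi z) = Q.proj z" if "z \<in> carrier (T 2 1)" for z
    by (rule TA_ext[OF linear_map_comp[OF linear_map_psi h(1)] Q.linear_map_proj that])
      (simp add: psi_elem h(2) incl_elem)
  then show "a_kernel TA Omega psi \<subseteq> bd_image"
    using Q.proj_eq_zero_iff h.zero by (force simp: a_kernel_def')
qed

lemma sec_HH1_eq: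
  "sec_HH1 K A B \<epsilon> = restrict_scalars (scalar_map K A \<epsilon>) (quot_module TA bd_image)"
  unfolding sec_HH1_def kernel_boundary1 tensor_algebra_simps TA_simps(1)[symmetric]
    update_carrier_self ..

lemma scalar_map_closed: "scalar_map K A \<epsilon> \<in> carrier (tensor_algebra K A B 1 1) \<rightarrow> carrier A"
  using linear_map.closed[OF linear_map_scalar_map] by simp

lemma sec_HH1_isomorphic_sec_kaehler:
  "module_isomorphic (tensor_algebra K A B 1 1) (sec_HH1 K A B \<epsilon>) (sec_kaehler K A B \<epsilon>)"
  unfolding sec_HH1_eq sec_kaehler_eq
  by (intro module_isomorphic_restrict_scalars[OF _ scalar_map_closed]
      module_isomorphic_first_isomorphism[OF linear_map_psi _ kernel_psi])
    (simp add: psi_surj)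


section \<open>The quotient of the kernel of multiplication\<close>

abbreviation J :: "('k, 'a, 'b) tensor set"
  where "J \<equiv> J_ideal K A B \<epsilon>"

abbreviation S :: "('k, ('k, 'a, 'b) tensor) module"
  where "S \<equiv> tensor_algebra K A B 2 1"

abbreviation I :: "('k, 'a, 'b) tensor set"
  where "I \<equiv> Idl\<^bsub>S\<^esub> ((J \<cdot>\<^bsub>S\<^esub> J) <+>\<^bsub>S\<^esub> J_hat K A B \<epsilon>)"

sublocale S: algebra K S
  by (rule algebra_tensor_algebra)

lemma J_iff: "z \<in> J \<longleftrightarrow> z \<in> carrier (T 2 1) \<and> mult_map K A \<epsilon> z = \<zero>\<^bsub>A\<^esub>"
  by (simp add: J_ideal_def a_kernel_def')

lemma J_hat_elem_eq:
  "J_hat_elem K A B \<epsilon> \<alpha> = t [\<one>\<^bsub>A\<^esub>, \<one>\<^bsub>A\<^esub>] [\<alpha>] \<ominus>\<^bsub>T 2 1\<^esub> t [\<epsilon> \<alpha>, \<one>\<^bsub>A\<^esub>] [\<one>\<^bsub>B\<^esub>]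
    \<oplus>\<^bsub>T 2 1\<^esub> t [\<one>\<^bsub>A\<^esub>, \<one>\<^bsub>A\<^esub>] [\<alpha>] \<ominus>\<^bsub>T 2 1\<^esub> t [\<one>\<^bsub>A\<^esub>, \<epsilon> \<alpha>] [\<one>\<^bsub>B\<^esub>]"
  by (simp add: J_hat_elem_def Let_def)

text \<open>Reduction to elementary tensors in both factors leaves a rearrangement in the
  commutative ring \<open>A\<close>. The closure of \<open>J\<close> under multiplication by the
  ring rests on it.\<close>

lemma mult_map_mult:
  assumes "u \<in> carrier (T 2 1)" "v \<in> carrier (T 2 1)"
  shows "mult_map K A \<epsilon> (tensor_mult K A B 2 1 u v) = mult_map K A \<epsilon> u \<otimes>\<^bsub>A\<^esub> mult_map K A \<epsilon> v"
  using assms(1)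
proof (induction rule: TA_induct)
  case (elem b \<alpha>)
  then have u: "t [\<one>\<^bsub>A\<^esub>, b] [\<alpha>] \<in> carrier (T 2 1)"
    by simp
  show ?case
  proof (rule tensor_ext[OF linear_map_comp[OF linear_map_tensor_mult_right[OF u] linear_map_mult_map]
        linear_map_comp[OF linear_map_mult_map linear_map_mult_A(2)] assms(2)])
    show "mult_map K A \<epsilon> (t [\<one>\<^bsub>A\<^esub>, b] [\<alpha>]) \<in> carrier A"
      using u by simp
    fix as bs assume "(as, bs) \<in> idx 2 1"
    then show "mult_map K A \<epsilon> (tensor_mult K A B 2 1 (t [\<one>\<^bsub>A\<^esub>, b] [\<alpha>]) (t as bs)) =
        mult_map K A \<epsilon> (t [\<one>\<^bsub>A\<^esub>, b] [\<alpha>]) \<otimes>\<^bsub>A\<^esub> mult_map K A \<epsilon> (t as bs)"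
      using elem by (elim idx21_cases) (simp add: mult21 mult_map_elem A.m_ac)
  qed
next
  case (add x y)
  then show ?case
    using assms(2) by (simp add: mult_add_left mult_map_add A.l_distr)
next
  case (smult a x)
  then show ?case
    using assms(2) by (simp add: TA_smult_mult mult_map_smult A.m_assoc del: TA_simps(4))
qed

lemma submodule_J: "submodule J A TA"
proof -
  interpret m: linear_map K "T 2 1" A "mult_map K A \<epsilon>"
    by (rule linear_map_mult_map)
  show ?thesis
    using mult_map_smult
    by (intro TA.submoduleI) (auto simp: J_iff m.zero m.uminus mult_map_add)
qed

text \<open>In psi(xz) = m(x) psi(z) + m(z) psi(x) both m(z) and psi(z) vanish, so multiples stay
  inside. Containment of \<open>I\<close> is thereby reduced to its generators.\<close>

lemma ideal_J_kernel_psi: "ideal {z \<in> J. psi z = \<zero>\<^bsub>Omega\<^esub>} S"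
proof (rule idealI)
  note J = TA.submoduleE[OF submodule_J] TA.submodule_zero[OF submodule_J]
  show "subgroup {z \<in> J. psi z = \<zero>\<^bsub>Omega\<^esub>} (add_monoid S)"
  proof (rule S.add.subgroupI)
    show "{z \<in> J. psi z = \<zero>\<^bsub>Omega\<^esub>} \<noteq> {}"
      using J(7) psi.zero by auto
    fix x assume x: "x \<in> {z \<in> J. psi z = \<zero>\<^bsub>Omega\<^esub>}"
    then show "\<ominus>\<^bsub>S\<^esub> x \<in> {z \<in> J. psi z = \<zero>\<^bsub>Omega\<^esub>}"
      using J(3)[of x] psi.uminus[of x] by (simp add: J_iff)
    fix y assume "y \<in> {z \<in> J. psi z = \<zero>\<^bsub>Omega\<^esub>}"
    with x show "x \<oplus>\<^bsub>S\<^esub> y \<in> {z \<in> J. psi z = \<zero>\<^bsub>Omega\<^esub>}"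
      using J(5)[of x y] psi_add[of x y] by (simp add: J_iff)
  qed (auto simp: J_iff)
  fix a x assume "a \<in> {z \<in> J. psi z = \<zero>\<^bsub>Omega\<^esub>}" "x \<in> carrier S"
  then show "x \<otimes>\<^bsub>S\<^esub> a \<in> {z \<in> J. psi z = \<zero>\<^bsub>Omega\<^esub>}" "a \<otimes>\<^bsub>S\<^esub> x \<in> {z \<in> J. psi z = \<zero>\<^bsub>Omega\<^esub>}"
    by (simp_all add: J_iff mult_map_mult psi_derivation)
qed (rule cring.axioms(1)[OF S.M_cring])

text \<open>On a product of two elements of \<open>J\<close> both coefficients in the derivation
  rule are zero.\<close>

lemma J_mult_vanishes: "J \<cdot>\<^bsub>S\<^esub> J \<subseteq> {z \<in> J. psi z = \<zero>\<^bsub>Omega\<^esub>}"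
proof
  interpret Z: ideal "{z \<in> J. psi z = \<zero>\<^bsub>Omega\<^esub>}" S
    by (rule ideal_J_kernel_psi)
  fix z assume "z \<in> J \<cdot>\<^bsub>S\<^esub> J"
  then show "z \<in> {z \<in> J. psi z = \<zero>\<^bsub>Omega\<^esub>}"
  proof (induction rule: ideal_prod.induct)
    case (prod i j)
    then show ?case
      by (simp add: J_iff mult_map_mult psi_derivation)
  qed (rule Z.a_closed)
qed

text \<open>The term \<epsilon>(\<alpha>) \<otimes> 1 \<otimes> 1 goes to a multiple of d(1) = 0;
  what remains is relation (iii).\<close>

lemma J_hat_elem_vanishes:
  assumes "\<alpha> \<in> carrier B"
  shows "J_hat_elem K A B \<epsilon> \<alpha> \<in> {z \<in> J. psi z = \<zero>\<^bsub>Omega\<^esub>}"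
proof -
  interpret m: linear_map K "T 2 1" A "mult_map K A \<epsilon>"
    by (rule linear_map_mult_map)
  have "psi (J_hat_elem K A B \<epsilon> \<alpha>) =
      (d (t [\<one>\<^bsub>A\<^esub>] [\<alpha>]) \<oplus>\<^bsub>Omega\<^esub> d (t [\<one>\<^bsub>A\<^esub>] [\<alpha>])) \<ominus>\<^bsub>Omega\<^esub> d (t [\<epsilon> \<alpha>] [\<one>\<^bsub>B\<^esub>])"
    using assms
    by (simp add: J_hat_elem_eq psi_add psi_minus psi_elem d_one Omega.diff_zero)
  then have "psi (J_hat_elem K A B \<epsilon> \<alpha>) = \<zero>\<^bsub>Omega\<^esub>"
    using assms by (simp add: d_double Omega.diff_self)
  moreover have "mult_map K A \<epsilon> (J_hat_elem K A B \<epsilon> \<alpha>) = \<zero>\<^bsub>A\<^esub>"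
    using assms by (simp add: J_hat_elem_eq m.minus m.add mult_map_elem A.diff_self)
  ultimately show ?thesis
    using assms by (simp add: J_iff) (simp add: J_hat_elem_eq)
qed

lemma J_hat_vanishes: "J_hat K A B \<epsilon> \<subseteq> {z \<in> J. psi z = \<zero>\<^bsub>Omega\<^esub>}"
proof -
  interpret Z: ideal "{z \<in> J. psi z = \<zero>\<^bsub>Omega\<^esub>}" S
    by (rule ideal_J_kernel_psi)
  have "(\<Oplus>\<^bsub>S\<^esub>i\<in>{..<n}. J_hat_elem K A B \<epsilon> (s i)) \<in> {z \<in> J. psi z = \<zero>\<^bsub>Omega\<^esub>}"
    if "s \<in> {..<n} \<rightarrow> carrier B" for n :: nat and s
    using that
  proof (induction n)
    case 0
    show ?case
      using Z.zero_closed by simp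
  next
    case (Suc n)
    have mem: "J_hat_elem K A B \<epsilon> (s i) \<in> {z \<in> J. psi z = \<zero>\<^bsub>Omega\<^esub>}" if "i < Suc n" for i
      using that Suc.prems by (intro J_hat_elem_vanishes) auto
    have "(\<Oplus>\<^bsub>S\<^esub>i\<in>insert n {..<n}. J_hat_elem K A B \<epsilon> (s i)) =
        J_hat_elem K A B \<epsilon> (s n) \<oplus>\<^bsub>S\<^esub> (\<Oplus>\<^bsub>S\<^esub>i\<in>{..<n}. J_hat_elem K A B \<epsilon> (s i))"
      using mem Z.a_subset by (intro S.finsum_insert) (auto simp: less_Suc_eq)
    also have "\<dots> \<in> {z \<in> J. psi z = \<zero>\<^bsub>Omega\<^esub>}"
      using Suc.prems by (intro Z.a_closed mem Suc.IH) auto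
    finally show ?case
      by (simp only: lessThan_Suc)
  qed
  then show ?thesis
    unfolding J_hat_def by blast
qed

text \<open>The empty sum; with it, elements of the square of \<open>J\<close> lie in the generating
  set of \<open>I\<close>.\<close>

lemma J_hat_zero: "\<zero>\<^bsub>S\<^esub> \<in> J_hat K A B \<epsilon>"
  unfolding J_hat_def by (rule CollectI, rule exI[of _ 0])
    (simp del: tensor_algebra_simps tensor_algebra_finsum)

lemma J_hat_elem_in_J_hat:
  assumes "\<alpha> \<in> carrier B"
  shows "J_hat_elem K A B \<epsilon> \<alpha> \<in> J_hat K A B \<epsilon>"
proof -
  have c: "J_hat_elem K A B \<epsilon> \<alpha> \<in> carrier S"
    using J_hat_elem_vanishes[OF assms] by (simp add: J_iff)
  have "(\<Oplus>\<^bsub>S\<^esub>i\<in>{..<Suc 0}. J_hat_elem K A B \<epsilon> \<alpha>) = J_hat_elem K A B \<epsilon> \<alpha>"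
    using S.finsum_insert[of "{}" "0::nat" "\<lambda>_. J_hat_elem K A B \<epsilon> \<alpha>"] S.r_zero[OF c] c
    by (simp add: lessThan_Suc del: tensor_algebra_simps tensor_algebra_finsum)
  then show ?thesis
    unfolding J_hat_def using assms
    by (intro CollectI exI[of _ "Suc 0"] exI[of _ "\<lambda>_. \<alpha>"]) auto
qed

lemma generators_vanish: "(J \<cdot>\<^bsub>S\<^esub> J) <+>\<^bsub>S\<^esub> J_hat K A B \<epsilon> \<subseteq> {z \<in> J. psi z = \<zero>\<^bsub>Omega\<^esub>}"
proof -
  interpret Z: ideal "{z \<in> J. psi z = \<zero>\<^bsub>Omega\<^esub>}" S
    by (rule ideal_J_kernel_psi)
  show ?thesis
  proof
    fix z assume "z \<in> (J \<cdot>\<^bsub>S\<^esub> J) <+>\<^bsub>S\<^esub> J_hat K A B \<epsilon>"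
    then obtain x y where "x \<in> J \<cdot>\<^bsub>S\<^esub> J" "y \<in> J_hat K A B \<epsilon>" "z = x \<oplus>\<^bsub>S\<^esub> y"
      unfolding set_add_def' by blast
    then show "z \<in> {z \<in> J. psi z = \<zero>\<^bsub>Omega\<^esub>}"
      by (simp only:) (intro Z.a_closed J_mult_vanishes[THEN subsetD] J_hat_vanishes[THEN subsetD])
  qed
qed

lemma I_vanishes: "I \<subseteq> {z \<in> J. psi z = \<zero>\<^bsub>Omega\<^esub>}"
  by (intro S.genideal_minimal ideal_J_kernel_psi generators_vanish)

lemma generators_in_I: "(J \<cdot>\<^bsub>S\<^esub> J) <+>\<^bsub>S\<^esub> J_hat K A B \<epsilon> \<subseteq> I"
  using generators_vanish by (intro S.genideal_self) (auto simp: J_iff)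

lemma ideal_I: "ideal I S"
  using generators_vanish by (intro S.genideal_ideal) (auto simp: J_iff)

lemma J_mult_in_I:
  assumes "u \<in> J" "v \<in> J"
  shows "tensor_mult K A B 2 1 u v \<in> I"
proof -
  have "u \<otimes>\<^bsub>S\<^esub> v \<oplus>\<^bsub>S\<^esub> \<zero>\<^bsub>S\<^esub> \<in> (J \<cdot>\<^bsub>S\<^esub> J) <+>\<^bsub>S\<^esub> J_hat K A B \<epsilon>"
    unfolding set_add_def' using ideal_prod.prod[OF assms, of S] J_hat_zero by blast
  then show ?thesis
    using generators_in_I assms by (auto simp: J_iff)
qed

lemma J_hat_elem_in_I:
  assumes "\<alpha> \<in> carrier B"
  shows "J_hat_elem K A B \<epsilon> \<alpha> \<in> I"
proof -
  have zero: "\<zero>\<^bsub>S\<^esub> \<in> J"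
    using TA.submodule_zero[OF submodule_J] by simp
  \<comment> \<open>The zero summand is exhibited in the square of \<open>J\<close> as the product
    of zero with itself.\<close>
  have "\<zero>\<^bsub>S\<^esub> \<otimes>\<^bsub>S\<^esub> \<zero>\<^bsub>S\<^esub> \<oplus>\<^bsub>S\<^esub> J_hat_elem K A B \<epsilon> \<alpha> \<in> (J \<cdot>\<^bsub>S\<^esub> J) <+>\<^bsub>S\<^esub> J_hat K A B \<epsilon>"
    unfolding set_add_def' using ideal_prod.prod[OF zero zero] J_hat_elem_in_J_hat[OF assms] by blast
  moreover have "\<zero>\<^bsub>S\<^esub> \<otimes>\<^bsub>S\<^esub> \<zero>\<^bsub>S\<^esub> \<oplus>\<^bsub>S\<^esub> J_hat_elem K A B \<epsilon> \<alpha> = J_hat_elem K A B \<epsilon> \<alpha>"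
    using J_hat_elem_vanishes[OF assms] S.l_zero S.l_null[OF S.zero_closed]
    by (simp add: J_iff del: tensor_algebra_simps(2-))
  ultimately show ?thesis
    using generators_in_I by auto
qed

text \<open>Since \<open>A\<close> acts by multiplication with the ring elements a \<otimes> 1
  \<otimes> 1, every ideal is an \<open>A\<close>-submodule.\<close>

lemma submodule_I: "submodule I A TA"
proof -
  interpret I: ideal I S
    by (rule ideal_I)
  show ?thesis
  proof (rule TA.submoduleI)
    show "I \<subseteq> carrier TA"
      using I.a_subset by simp
    show "\<zero>\<^bsub>TA\<^esub> \<in> I"
      using I.zero_closed by simp
    fix x assume x: "x \<in> I"
    then show "\<ominus>\<^bsub>TA\<^esub> x \<in> I"
      using I.a_inv_closed[of x] by simp
    show "a \<odot>\<^bsub>TA\<^esub> x \<in> I" if "a \<in> carrier A" for a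
      using I.I_l_closed[OF x, of "t [a, \<one>\<^bsub>A\<^esub>] [\<one>\<^bsub>B\<^esub>]"] that by simp
    fix y assume "y \<in> I"
    with x show "x \<oplus>\<^bsub>TA\<^esub> y \<in> I"
      using I.a_closed[of x y] by simp
  qed
qed

lemma kernel_psi_J: "I = a_kernel (TA\<lparr>carrier := J\<rparr>) Omega psi"
proof
  show "I \<subseteq> a_kernel (TA\<lparr>carrier := J\<rparr>) Omega psi"
    using I_vanishes by (auto simp: a_kernel_def')
  \<comment> \<open>The quotient is taken of all of \<open>TA\<close>: classes there detect
    membership in \<open>I\<close>, and no map has to be corestricted to \<open>J\<close>.\<close>
  interpret Q: module_quotient A TA I
    by (intro module_quotient.intro module_quotient_axioms.intro module_TA submodule_I)
  let ?N = "quot_module TA I"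
  let ?s = "\<lambda>a. t [a, \<one>\<^bsub>A\<^esub>] [\<one>\<^bsub>B\<^esub>]"
  \<comment> \<open>On elementary tensors \<open>scalar_map\<close> is the product of the entries of
    \<open>incl\<close>; subtracting it in the first factor moves the value into
    \<open>J\<close>.\<close>
  let ?phi = "\<lambda>x. incl x \<ominus>\<^bsub>T 2 1\<^esub> ?s (scalar_map K A \<epsilon> x)"
  have s: "linear_map K A (T 2 1) ?s"
    by (intro t21_linear) simp_all
  have g: "linear_map K (T 1 1) (over_K ?N) (\<lambda>x. Q.proj (?phi x))"
    by (rule linear_map_comp[OF linear_map_minus[OF linear_map_incl
            linear_map_comp[OF linear_map_scalar_map s]] linear_map_TA_over_K[OF Q.linear_map_proj]])
  have phi_elem: "?phi (t [a] [\<alpha>]) = t [\<one>\<^bsub>A\<^esub>, a] [\<alpha>] \<ominus>\<^bsub>T 2 1\<^esub> ?s (a \<otimes>\<^bsub>A\<^esub> \<epsilon> \<alpha>)"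
    if "a \<in> carrier A" "\<alpha> \<in> carrier B" for a \<alpha>
    using that by (simp add: incl_elem scalar_map_elem)
  have phi_J: "t [\<one>\<^bsub>A\<^esub>, a] [\<alpha>] \<ominus>\<^bsub>T 2 1\<^esub> ?s (a \<otimes>\<^bsub>A\<^esub> \<epsilon> \<alpha>) \<in> J"
    if "a \<in> carrier A" "\<alpha> \<in> carrier B" for a \<alpha>
    using that by (simp add: J_iff linear_map.minus[OF linear_map_mult_map] mult_map_elem A.diff_self)
  have "\<exists>h. linear_map A Omega ?N h \<and> (\<forall>x\<in>carrier (T 1 1). h (d x) = Q.proj (?phi x))"
  proof (rule kaehler_lift[OF Q.module_quot g])
    fix a b \<alpha> \<beta> assume ab: "a \<in> carrier A" "b \<in> carrier A" "\<alpha> \<in> carrier B" "\<beta> \<in> carrier B"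
    let ?u = "t [\<one>\<^bsub>A\<^esub>, a] [\<alpha>]" and ?v = "t [\<one>\<^bsub>A\<^esub>, b] [\<beta>]"
    let ?p = "?s (a \<otimes>\<^bsub>A\<^esub> \<epsilon> \<alpha>)" and ?q = "?s (b \<otimes>\<^bsub>A\<^esub> \<epsilon> \<beta>)"
    have c: "?u \<in> carrier S" "?v \<in> carrier S" "?p \<in> carrier S" "?q \<in> carrier S"
      using ab by simp_all
    \<comment> \<open>Both terms of \<open>?phi\<close> are multiplicative, so its value on a
      product is a difference of products.\<close>
    have "t [\<one>\<^bsub>A\<^esub>, a \<otimes>\<^bsub>A\<^esub> b] [\<alpha> \<otimes>\<^bsub>B\<^esub> \<beta>] \<ominus>\<^bsub>T 2 1\<^esub> ?s (a \<otimes>\<^bsub>A\<^esub> b \<otimes>\<^bsub>A\<^esub> \<epsilon> (\<alpha> \<otimes>\<^bsub>B\<^esub> \<beta>)) =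
        ?u \<otimes>\<^bsub>S\<^esub> ?v \<ominus>\<^bsub>S\<^esub> ?p \<otimes>\<^bsub>S\<^esub> ?q"
      using ab by (simp add: mult21 A.m_ac)
    \<comment> \<open>By \<open>product_defect\<close> this equals (u - p)(v - q), and both factors
      lie in \<open>J\<close> by \<open>phi_J\<close>.\<close>
    moreover have "(?u \<otimes>\<^bsub>S\<^esub> ?v \<ominus>\<^bsub>S\<^esub> ?p \<otimes>\<^bsub>S\<^esub> ?q) \<ominus>\<^bsub>S\<^esub>
        (?p \<otimes>\<^bsub>S\<^esub> (?v \<ominus>\<^bsub>S\<^esub> ?q) \<oplus>\<^bsub>S\<^esub> ?q \<otimes>\<^bsub>S\<^esub> (?u \<ominus>\<^bsub>S\<^esub> ?p)) \<in> I"
      unfolding S.product_defect[OF c] using J_mult_in_I[OF phi_J phi_J] ab by simp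
    ultimately have "Q.proj (t [\<one>\<^bsub>A\<^esub>, a \<otimes>\<^bsub>A\<^esub> b] [\<alpha> \<otimes>\<^bsub>B\<^esub> \<beta>] \<ominus>\<^bsub>T 2 1\<^esub>
          ?s (a \<otimes>\<^bsub>A\<^esub> b \<otimes>\<^bsub>A\<^esub> \<epsilon> (\<alpha> \<otimes>\<^bsub>B\<^esub> \<beta>))) =
        Q.proj ((a \<otimes>\<^bsub>A\<^esub> \<epsilon> \<alpha>) \<odot>\<^bsub>TA\<^esub> (?v \<ominus>\<^bsub>T 2 1\<^esub> ?q) \<oplus>\<^bsub>TA\<^esub> (b \<otimes>\<^bsub>A\<^esub> \<epsilon> \<beta>) \<odot>\<^bsub>TA\<^esub> (?u \<ominus>\<^bsub>T 2 1\<^esub> ?p))"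
      using ab by (subst Q.proj_eq_iff) simp_all
    then show "Q.proj (?phi (t [a \<otimes>\<^bsub>A\<^esub> b] [\<alpha> \<otimes>\<^bsub>B\<^esub> \<beta>])) =
        (a \<otimes>\<^bsub>A\<^esub> \<epsilon> \<alpha>) \<odot>\<^bsub>?N\<^esub> Q.proj (?phi (t [b] [\<beta>])) \<oplus>\<^bsub>?N\<^esub>
        (b \<otimes>\<^bsub>A\<^esub> \<epsilon> \<beta>) \<odot>\<^bsub>?N\<^esub> Q.proj (?phi (t [a] [\<alpha>]))"
      using ab by (simp add: phi_elem Q.proj_smult Q.proj_add)
  next
    fix \<alpha> assume a: "\<alpha> \<in> carrier B"
    let ?w = "t [\<one>\<^bsub>A\<^esub>, \<one>\<^bsub>A\<^esub>] [\<alpha>]"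
    \<comment> \<open>The doubled bracket is \<open>?phi\<close> at \<alpha> \<otimes> 1, the
      subtracted one \<open>?phi\<close> at 1 \<otimes> \<epsilon>(\<alpha>);
      \<open>double_defect\<close> identifies the difference.\<close>
    have "(?w \<ominus>\<^bsub>T 2 1\<^esub> ?s (\<epsilon> \<alpha>) \<oplus>\<^bsub>T 2 1\<^esub> (?w \<ominus>\<^bsub>T 2 1\<^esub> ?s (\<epsilon> \<alpha>))) \<ominus>\<^bsub>T 2 1\<^esub>
        (t [\<one>\<^bsub>A\<^esub>, \<epsilon> \<alpha>] [\<one>\<^bsub>B\<^esub>] \<ominus>\<^bsub>T 2 1\<^esub> ?s (\<epsilon> \<alpha>)) = J_hat_elem K A B \<epsilon> \<alpha>"
      using a S.double_defect[of ?w "?s (\<epsilon> \<alpha>)" "t [\<one>\<^bsub>A\<^esub>, \<epsilon> \<alpha>] [\<one>\<^bsub>B\<^esub>]"]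
      by (simp add: J_hat_elem_eq)
    then have "Q.proj (?w \<ominus>\<^bsub>T 2 1\<^esub> ?s (\<epsilon> \<alpha>) \<oplus>\<^bsub>TA\<^esub> (?w \<ominus>\<^bsub>T 2 1\<^esub> ?s (\<epsilon> \<alpha>))) =
        Q.proj (t [\<one>\<^bsub>A\<^esub>, \<epsilon> \<alpha>] [\<one>\<^bsub>B\<^esub>] \<ominus>\<^bsub>T 2 1\<^esub> ?s (\<epsilon> \<alpha>))"
      using a J_hat_elem_in_I[OF a] by (subst Q.proj_eq_iff) simp_all
    then show "Q.proj (?phi (t [\<one>\<^bsub>A\<^esub>] [\<alpha>])) \<oplus>\<^bsub>?N\<^esub> Q.proj (?phi (t [\<one>\<^bsub>A\<^esub>] [\<alpha>])) =
        Q.proj (?phi (t [\<epsilon> \<alpha>] [\<one>\<^bsub>B\<^esub>]))"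
      using a by (simp add: phi_elem Q.proj_add)
  qed
  then obtain h where h: "linear_map A Omega ?N h"
    "\<forall>x\<in>carrier (T 1 1). h (d x) = Q.proj (?phi x)"
    by blast
  interpret h: linear_map A Omega ?N h by fact
  have "linear_map A TA TA (\<lambda>z. ?s (mult_map K A \<epsilon> z))"
    using mult_map_smult
    by (intro linear_mapI module_TA) (simp_all add: mult_map_add t21_add mult21)
  note lin = linear_map_comp[OF linear_map_minus[OF TA.linear_map_id this] Q.linear_map_proj]
  have comp: "h (psi z) = Q.proj (z \<ominus>\<^bsub>TA\<^esub> ?s (mult_map K A \<epsilon> z))" if "z \<in> carrier (T 2 1)" for z
    by (rule TA_ext[OF linear_map_comp[OF linear_map_psi h(1)] lin that])
      (simp add: psi_elem h(2) phi_elem mult_map_elem)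
  \<comment> \<open>On \<open>J\<close> the correction term in \<open>comp\<close> vanishes, so
    psi(z) = 0 makes the class of z itself zero.\<close>
  have "Q.proj z = \<zero>\<^bsub>?N\<^esub>" if "z \<in> J" "psi z = \<zero>\<^bsub>Omega\<^esub>" for z
    using that comp[of z] h.zero linear_map.zero[OF s]
    by (simp add: J_iff T21.diff_zero)
  then show "a_kernel (TA\<lparr>carrier := J\<rparr>) Omega psi \<subseteq> I"
    using Q.proj_eq_zero_iff by (auto simp: a_kernel_def' J_iff)
qed

lemma psi_J_surj: "psi ` J = carrier Omega"
proof
  show "psi ` J \<subseteq> carrier Omega"
    by (auto simp: J_iff)
  show "carrier Omega \<subseteq> psi ` J"
  proof
    fix w assume "w \<in> carrier Omega"
    then obtain z where z: "z \<in> carrier (T 2 1)" "w = psi z"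
      using psi_surj by blast
    \<comment> \<open>Subtracting this element moves z into \<open>J\<close>, and psi does not
      change because d(1) = 0.\<close>
    let ?s = "t [mult_map K A \<epsilon> z, \<one>\<^bsub>A\<^esub>] [\<one>\<^bsub>B\<^esub>]"
    have "z \<ominus>\<^bsub>T 2 1\<^esub> ?s \<in> J"
      using z by (simp add: J_iff linear_map.minus[OF linear_map_mult_map] mult_map_elem A.diff_self)
    moreover have "psi (z \<ominus>\<^bsub>T 2 1\<^esub> ?s) = w"
      using z by (simp add: psi_minus psi_elem d_one Omega.diff_zero)
    ultimately show "w \<in> psi ` J"
      by blast
  qed
qed

lemma J_quotient_eq:
  "J_quotient K A B \<epsilon> = restrict_scalars (scalar_map K A \<epsilon>) (quot_module (TA\<lparr>carrier := J\<rparr>) I)"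
  by (simp only: J_quotient_def Let_def)

lemma sec_kaehler_isomorphic_J_quotient:
  "module_isomorphic (tensor_algebra K A B 1 1) (sec_kaehler K A B \<epsilon>) (J_quotient K A B \<epsilon>)"
proof -
  have TJ: "module A (TA\<lparr>carrier := J\<rparr>)"
    by (rule submodule.submodule_is_module[OF submodule_J module_TA])
  have lin: "linear_map A (TA\<lparr>carrier := J\<rparr>) Omega psi"
    using psi.add psi.smult
    by (intro linear_mapI TJ Omega.module_axioms) (simp_all add: J_iff)
  \<comment> \<open>Rewriting \<open>I\<close> as the kernel of the restricted psi shows at once
    that it is a submodule of \<open>J\<close>.\<close>
  interpret Q: module_quotient A "TA\<lparr>carrier := J\<rparr>" I
    unfolding kernel_psi_J
    by (intro module_quotient.intro module_quotient_axioms.intro TJ linear_map.kernel_submodule[OF lin])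
  interpret QM: module A "quot_module (TA\<lparr>carrier := J\<rparr>) I"
    by (rule Q.module_quot)
  have "module_isomorphic A (quot_module (TA\<lparr>carrier := J\<rparr>) I) Omega"
    by (rule module_isomorphic_first_isomorphism[OF lin _ kernel_psi_J]) (simp add: psi_J_surj)
  then have "module_isomorphic A Omega (quot_module (TA\<lparr>carrier := J\<rparr>) I)"
    by (rule module_isomorphic_sym) (rule QM.a_closed QM.smult_closed; assumption)+
  then show ?thesis
    unfolding sec_kaehler_eq J_quotient_eq
    by (rule module_isomorphic_restrict_scalars[OF _ scalar_map_closed])
qed

end

theorem theorem4p3:
  fixes K :: "'k ring" and A :: "('k, 'a) module" and B :: "('k, 'b) module" and \<epsilon> :: "'b \<Rightarrow> 'a"
  assumes "field K"
    and "\<And>n::nat. n > 0 \<Longrightarrow> [n] \<cdot>\<^bsub>K\<^esub> \<one>\<^bsub>K\<^esub> \<noteq> \<zero>\<^bsub>K\<^esub>"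
    and "algebra K A"
    and "algebra K B"
    and "\<epsilon> \<in> algebra_hom K B A"
  shows "module_isomorphic (tensor_algebra K A B 1 1) (sec_HH1 K A B \<epsilon>) (sec_kaehler K A B \<epsilon>) \<and>
         module_isomorphic (tensor_algebra K A B 1 1) (sec_kaehler K A B \<epsilon>) (J_quotient K A B \<epsilon>)"
proof -
  interpret commutative_triple K A B \<epsilon>
    using assms(3-5)
    by (intro commutative_triple.intro commutative_triple_axioms.intro algebra_pair.intro)
  show ?thesis
    using sec_HH1_isomorphic_sec_kaehler sec_kaehler_isomorphic_J_quotient by blast
qed

end
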